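(* Let $\mathcal C$ be a polyhedral complex in $\mathbb R^n$ with convex support and let $\mathcal G$ be the adjacency graph on maximal faces of $\mathcal C$. Then a subset $\mathcal E$ of the edges of $\mathcal G$ is the edge set of a polyhedral complex coarsening $\mathcal C$ if and only if $\mathcal E$ has the polygon property.
   Context: A polyhedron is a nonempty intersection of finitely many closed halfspaces. A polyhedral complex is a finite nonempty collection $\mathcal C$ of polyhedra such that every face of a member is a member, and for $F,G\in\mathcal C$ the intersection $F\cap G$ is a face of $F$ and of $G$. A fan is a polyhedral complex all of whose nonempty faces contain the origin. The support $\operatorname{Supp}(\mathcal C)$ is the union of the members. A complex $\mathcal C'$ coarsens $\mathcal C$ if $\operatorname{Supp}(\mathcal C')=\operatorname{Supp}(\mathcal C)$ and every face of $\mathcal C'$ is a union of faces of $\mathcal C$. Convention: $\operatorname{Supp}(\mathcal C)$ is assumed full-dimensional; otherwise everything is interpreted inside the affine hull of $\operatorname{Supp}(\mathcal C)$. The adjacency graph $\mathcal G$ has as vertices the full-dimensional faces of $\mathcal C$ (these are exactly the maximal faces), with an edge $M$---$N$ whenever $M\cap N$ is a codimension-1 face. The edge set of a complex $\mathcal C'$ coarsening $\mathcal C$ is the set of edges $M$---$N$ of $\mathcal G$ such that $M$ and $N$ are contained in a common face of $\mathcal C'$. Polygons: for each codimension-2 face $F$ of $\mathcal C$ not contained in the boundary of $\operatorname{Supp}(\mathcal C)$, the full-dimensional faces of $\mathcal C$ containing $F$ form a cycle $\mathcal P_F$ in $\mathcal G$. Let $\operatorname{Perp}(F)$ be the 2-dimensional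 linear subspace orthogonal to the affine hull of $F$. Fix $x$ in the relative interior of $F$ and, for each $M$ in $\mathcal P_F$, let $\sigma_M=\{v\in\operatorname{Perp}(F):\exists\,\epsilon>0,\ x+\epsilon v\in M\}$. These cones are the maximal cones of a complete fan $\mathcal C|_F$ in $\operatorname{Perp}(F)$ whose adjacency graph is identified with $\mathcal P_F$ via $M\mapsto\sigma_M$. Polygon property: a set $\mathcal E$ of edges of $\mathcal G$ has the polygon property if, for every such $F$, the set of edges of $\mathcal E$ lying in $\mathcal P_F$ is (under this identification) the edge set of some fan in $\operatorname{Perp}(F)$ coarsening $\mathcal C|_F$. *)

theory Defs
  imports "HOL-Analysis.Analysis"
begin

text \<open>Whether the empty set is listed as a member of a complex is left open: the library's
  \<open>polyhedron\<close> and \<open>face_of\<close> admit the empty set, closure under faces is only required for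
  nonempty faces, and some member has to be nonempty.  No notion below depends on whether
  the empty set is a member.\<close>

definition polyhedral_complex :: "'a::euclidean_space set set \<Rightarrow> bool" where
  "polyhedral_complex C \<longleftrightarrow>
     finite C \<and> (\<exists>F\<in>C. F \<noteq> {}) \<and>
     (\<forall>F\<in>C. polyhedron F) \<and>
     (\<forall>F\<in>C. \<forall>G. G face_of F \<and> G \<noteq> {} \<longrightarrow> G \<in> C) \<and>
     (\<forall>F\<in>C. \<forall>G\<in>C. (F \<inter> G) face_of F \<and> (F \<inter> G) face_of G)"

definition polyhedral_fan :: "'a::euclidean_space set set \<Rightarrow> bool" where
  "polyhedral_fan C \<longleftrightarrow> polyhedral_complex C \<and> (\<forall>F\<in>C. F \<noteq> {} \<longrightarrow> 0 \<in> F)"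

definition Supp :: "'a set set \<Rightarrow> 'a set" where
  "Supp C = \<Union>C"

definition coarsens :: "'a set set \<Rightarrow> 'a set set \<Rightarrow> bool" where
  "coarsens C' C \<longleftrightarrow> Supp C' = Supp C \<and> (\<forall>F\<in>C'. \<exists>D\<subseteq>C. F = \<Union>D)"

text \<open>The support need not be full-dimensional: codimension, boundary and orthogonal
  complement are all taken inside the affine hull of the support.\<close>

definition codim_faces :: "'a::euclidean_space set set \<Rightarrow> int \<Rightarrow> 'a set set" where
  "codim_faces C k = {F\<in>C. F \<noteq> {} \<and> aff_dim F = aff_dim (Supp C) - k}"

text \<open>An edge of the adjacency graph joining \<open>M\<close> and \<open>N\<close> is the two-element set \<open>{M, N}\<close>;
  \<open>M \<noteq> N\<close> is forced by the dimensions.\<close>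

definition adjacency_edges :: "'a::euclidean_space set set \<Rightarrow> 'a set set set" where
  "adjacency_edges C =
     {{M, N} | M N. M \<in> codim_faces C 0 \<and> N \<in> codim_faces C 0 \<and> M \<inter> N \<in> codim_faces C 1}"

definition edge_set :: "'a::euclidean_space set set \<Rightarrow> 'a set set \<Rightarrow> 'a set set set" where
  "edge_set C C' =
     {{M, N} | M N. {M, N} \<in> adjacency_edges C \<and> (\<exists>G\<in>C'. M \<subseteq> G \<and> N \<subseteq> G)}"

definition interior_codim2_faces :: "'a::euclidean_space set set \<Rightarrow> 'a set set" where
  "interior_codim2_faces C = {F \<in> codim_faces C 2. \<not> F \<subseteq> rel_frontier (Supp C)}"

definition polygon_vertices :: "'a::euclidean_space set set \<Rightarrow> 'a set \<Rightarrow> 'a set set" where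
  "polygon_vertices C F = {M \<in> codim_faces C 0. F \<subseteq> M}"

definition polygon_edges :: "'a::euclidean_space set set \<Rightarrow> 'a set \<Rightarrow> 'a set set set" where
  "polygon_edges C F = {e \<in> adjacency_edges C. e \<subseteq> polygon_vertices C F}"

text \<open>The differences \<open>p - q\<close> make up the linear space parallel to the affine hull of the
  support; it is the whole space when the support is full-dimensional.\<close>

definition Perp :: "'a::euclidean_space set set \<Rightarrow> 'a set \<Rightarrow> 'a set" where
  "Perp C F =
     {p - q | p q. p \<in> affine hull (Supp C) \<and> q \<in> affine hull (Supp C)} \<inter>
     {v. \<forall>y\<in>affine hull F. \<forall>z\<in>affine hull F. v \<bullet> (y - z) = 0}"

definition local_cone :: "'a::euclidean_space set set \<Rightarrow> 'a set \<Rightarrow> 'a \<Rightarrow> 'a set \<Rightarrow> 'a set" where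
  "local_cone C F x M = {v \<in> Perp C F. \<exists>\<epsilon>>0. x + \<epsilon> *\<^sub>R v \<in> M}"

definition local_fan :: "'a::euclidean_space set set \<Rightarrow> 'a set \<Rightarrow> 'a \<Rightarrow> 'a set set" where
  "local_fan C F x = {\<tau>. \<exists>M\<in>polygon_vertices C F. \<tau> face_of local_cone C F x M}"

text \<open>The choice of the base point \<open>x\<close> is immaterial, as the cones do not depend on it.
  The image under \<open>(`) (local_cone C F x)\<close> sends an edge \<open>{M, N}\<close> to the pair of cones
  of \<open>M\<close> and \<open>N\<close>.\<close>

definition polygon_property :: "'a::euclidean_space set set \<Rightarrow> 'a set set set \<Rightarrow> bool" where
  "polygon_property C E \<longleftrightarrow>
     (\<forall>F\<in>interior_codim2_faces C. \<forall>x\<in>rel_interior F.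
        \<exists>D. polyhedral_fan D \<and> coarsens D (local_fan C F x) \<and>
            edge_set (local_fan C F x) D = (`) (local_cone C F x) ` (E \<inter> polygon_edges C F))"

end

theory Submission
  imports Defs
begin

text \<open>Call a wall \<open>M \<inter> N\<close> kept if the edge \<open>{M, N}\<close> is not in \<open>E\<close>.  In the plane orthogonal to a
  codimension-2 face \<open>F\<close>, the kept walls become rays, and \<open>E\<close> comes from a coarsening near \<open>F\<close> iff
  no half-plane contains all of these rays unless they all lie on its boundary line.  If this holds
  at all \<open>F\<close>, the coarsening consists of the faces of the unions of cells joined by edges of \<open>E\<close>:
  move a segment that crosses no kept wall, in a generic plane.  If it ever met a kept wall, it would
  first do so at a point of a codimension-2 face all of whose kept rays are ahead of it, which is
  impossible.  Pivoting such a segment about one end point shows that the unions are convex, and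
  translating it parallel to itself shows that they intersect in common faces.
  Conversely, if the kept rays of a coarsening lie in a closed half-plane, then a single face fills
  the opposite half-plane.  It contains a neighbourhood of \<open>F\<close> in the bounding line, hence so does
  every face around \<open>F\<close>, and no kept ray can lie off that line.  This equivalence, applied to \<open>C\<close>
  and to each local fan, gives the theorem.\<close>

section \<open>Direction spaces and generic points\<close>

text \<open>Balancing is tested by linear functionals that are constant on \<open>F\<close>, so that
  it reads the same at \<open>F\<close> in \<open>C\<close> and at the origin of the local fan. The
  planar case then needs no separate treatment: it is the same equivalence, for a fan whose support
  is a plane.

  A segment is in generic position if its sweep meets no face of codimension above 2 and if its two
  directions are independent modulo every codimension-2 face it meets. One obstacle is to reach such
  a position without losing the supposed hit with a kept wall. For the pivoting segment this forces
  one end to be fixed before the exceptional sets for the other are known. The other obstacle is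
  that a wall could enter through an end of the segment. A pivot keeps one end inside a cell and
  moves the other across a single wall of \<open>E\<close>. A translated segment has no such ends;
  it is protected by the conical shape of the complex around points of the line, at the price that
  only walls transversal to the segment are watched.\<close>

definition dirs :: "'a::euclidean_space set \<Rightarrow> 'a set" where
  "dirs X = span {y - z | y z. y \<in> X \<and> z \<in> X}"

lemma subspace_dirs: "subspace (dirs X)"
  by (simp add: dirs_def)

lemma dirs_mono: "X \<subseteq> Y \<Longrightarrow> dirs X \<subseteq> dirs Y"
  unfolding dirs_def by (rule span_mono) blast

lemma dirs_eq_span:
  assumes "z \<in> X"
  shows "dirs X = span ((\<lambda>x. x - z) ` X)"
proof
  have "y - y' \<in> span ((\<lambda>x. x - z) ` X)" if "y \<in> X" "y' \<in> X" for y y'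
  proof -
    have "(y - z) - (y' - z) \<in> span ((\<lambda>x. x - z) ` X)"
      using that by (intro span_diff span_base) auto
    then show ?thesis by simp
  qed
  then show "dirs X \<subseteq> span ((\<lambda>x. x - z) ` X)"
    unfolding dirs_def by (intro span_minimal) auto
  show "span ((\<lambda>x. x - z) ` X) \<subseteq> dirs X"
    unfolding dirs_def using assms by (intro span_mono) auto
qed

lemma dirs_affine_hull_image:
  assumes "z \<in> X"
  shows "(\<lambda>x. x - z) ` (affine hull X) = dirs X"
  using diffs_affine_hull_span[OF assms] dirs_eq_span[OF assms] by simp

lemma affine_hull_iff_dirs:
  assumes "z \<in> X"
  shows "y \<in> affine hull X \<longleftrightarrow> y - z \<in> dirs X"
  using dirs_affine_hull_image[OF assms] by (force simp: image_iff)

lemma diff_in_dirs: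
  assumes "y \<in> affine hull X" "z \<in> affine hull X"
  shows "y - z \<in> dirs X"
proof -
  obtain a where a: "a \<in> X" using assms(1) by (metis affine_hull_eq_empty all_not_in_conv)
  have "(y - a) - (z - a) \<in> dirs X"
    using assms a by (metis affine_hull_iff_dirs subspace_diff subspace_dirs)
  then show ?thesis by simp
qed

lemma diff_in_dirs':
  assumes "y \<in> X" "z \<in> X"
  shows "y - z \<in> dirs X"
  using assms by (simp add: diff_in_dirs hull_inc)

lemma add_dirs_affine_hull:
  assumes "z \<in> affine hull X" "v \<in> dirs X"
  shows "z + v \<in> affine hull X"
proof -
  obtain a where a: "a \<in> X" using assms(1) by (metis affine_hull_eq_empty all_not_in_conv)
  have "(z - a) + v \<in> dirs X"
    using assms a by (intro subspace_add[OF subspace_dirs]) (auto simp: affine_hull_iff_dirs)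
  then show ?thesis using a by (simp add: affine_hull_iff_dirs algebra_simps)
qed

lemma dirs_scale: "v \<in> dirs X \<Longrightarrow> c *\<^sub>R v \<in> dirs X"
  by (simp add: subspace_dirs subspace_scale)

lemma dirs_add: "v \<in> dirs X \<Longrightarrow> w \<in> dirs X \<Longrightarrow> v + w \<in> dirs X"
  by (simp add: subspace_dirs subspace_add)

lemma dirs_diff: "v \<in> dirs X \<Longrightarrow> w \<in> dirs X \<Longrightarrow> v - w \<in> dirs X"
  by (simp add: subspace_dirs subspace_diff)

lemma dirs_minus: "v \<in> dirs X \<Longrightarrow> - v \<in> dirs X"
  by (simp add: subspace_dirs subspace_neg)

lemma dirs_zero: "0 \<in> dirs X"
  by (simp add: subspace_dirs subspace_0)

lemma dirs_scale_iff: "c \<noteq> 0 \<Longrightarrow> c *\<^sub>R v \<in> dirs X \<longleftrightarrow> v \<in> dirs X"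
  using dirs_scale[of "c *\<^sub>R v" X "inverse c"] dirs_scale[of v X c] by auto

lemma dim_dirs:
  assumes "X \<noteq> {}"
  shows "int (dim (dirs X)) = aff_dim X"
proof -
  obtain z where z: "z \<in> X" using assms by auto
  have "aff_dim X = int (dim ((+) (- z) ` X))"
    using z by (intro aff_dim_eq_dim) (simp add: hull_inc)
  then show ?thesis using dirs_eq_span[OF z] by (simp add: dim_span)
qed

lemma subspace_complement_1:
  fixes U V :: "'a::euclidean_space set"
  assumes "subspace U" "subspace V" "U \<subseteq> V" "dim V = dim U + 1"
    and "d \<in> V" "d \<notin> U" "v \<in> V"
  obtains a where "v - a *\<^sub>R d \<in> U"
proof -
  have U: "span U = U" using assms(1) by (simp add: span_eq_iff)
  have "span (insert d U) = V"
  proof (rule subspace_dim_equal)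
    show "span (insert d U) \<subseteq> V" using assms by (intro span_minimal) auto
    show "dim V \<le> dim (span (insert d U))"
      using assms(4,6) by (simp add: dim_insert U del: span_eq_iff)
  qed (use assms in auto)
  then have "v \<in> span (insert d U)" using assms by simp
  then show ?thesis using that U by (auto simp: span_breakdown_eq)
qed

text \<open>Supplies coordinates with respect to the two directions of a sweep, modulo the
  directions of a codimension-2 face.\<close>

lemma subspace_complement_2:
  fixes U V :: "'a::euclidean_space set"
  assumes "subspace U" "subspace V" "U \<subseteq> V" "dim V = dim U + 2"
    and "d \<in> V" "e \<in> V" "v \<in> V"
    and indep: "\<And>a b. a *\<^sub>R d + b *\<^sub>R e \<in> U \<Longrightarrow> a = 0 \<and> b = 0"
  obtains a b where "v - a *\<^sub>R d - b *\<^sub>R e \<in> U"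
proof -
  have U: "span U = U" using assms(1) by (simp add: span_eq_iff)
  have d: "d \<notin> U" using indep[of 1 0] by auto
  have e: "e \<notin> span (insert d U)"
  proof
    assume "e \<in> span (insert d U)"
    then obtain k where "e - k *\<^sub>R d \<in> U" using U by (auto simp: span_breakdown_eq)
    then show False using indep[of "-k" 1] by simp
  qed
  have "\<exists>a. v - a *\<^sub>R e \<in> span (insert d U)"
  proof (rule subspace_complement_1[of "span (insert d U)" V e v])
    show "span (insert d U) \<subseteq> V" using assms by (intro span_minimal) auto
    show "dim V = dim (span (insert d U)) + 1" using assms(4) d by (simp add: dim_insert U del: span_eq_iff)
  qed (use assms e in auto)
  then obtain b where "v - b *\<^sub>R e \<in> span (insert d U)" by blast
  then obtain a where "v - b *\<^sub>R e - a *\<^sub>R d \<in> U" using U by (auto simp: span_breakdown_eq)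
  then show ?thesis using that[of a b] by (simp add: algebra_simps)
qed

section \<open>Small moves in relative interiors and convex sets\<close>

lemma rel_interior_move:
  assumes "z \<in> rel_interior X" "f \<in> dirs X"
  shows "\<exists>e>0. \<forall>\<delta>. \<bar>\<delta>\<bar> \<le> e \<longrightarrow> z + \<delta> *\<^sub>R f \<in> rel_interior X"
proof -
  have z: "z \<in> affine hull X" using assms(1) by (meson hull_inc rel_interior_subset subsetD)
  obtain r where r: "r > 0" "ball z r \<inter> affine hull X \<subseteq> rel_interior X"
  proof -
    have "openin (top_of_set (affine hull X)) (rel_interior X)" by (rule openin_rel_interior)
    then show ?thesis using assms(1) that unfolding openin_contains_ball by (metis inf_commute)
  qed
  define e where "e = r / (2 * (norm f + 1))"
  have e: "e > 0" using r by (simp add: e_def add_nonneg_pos)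
  have "z + \<delta> *\<^sub>R f \<in> rel_interior X" if "\<bar>\<delta>\<bar> \<le> e" for \<delta>
  proof -
    have "\<bar>\<delta>\<bar> * norm f \<le> e * norm f" using that by (simp add: mult_right_mono)
    also have "\<dots> < r"
    proof -
      have "e * norm f \<le> e * (norm f + 1)" using e by simp
      also have "\<dots> = r / 2" by (simp add: e_def field_simps add_nonneg_eq_0_iff)
      finally show ?thesis using r by simp
    qed
    finally have "z + \<delta> *\<^sub>R f \<in> ball z r" by (simp add: dist_norm)
    moreover have "z + \<delta> *\<^sub>R f \<in> affine hull X"
      using z assms(2) by (simp add: add_dirs_affine_hull dirs_scale)
    ultimately show ?thesis using r by blast
  qed
  then show ?thesis using e by blast
qed

lemma rel_interior_move_eventually:
  assumes "z \<in> rel_interior X" "f \<in> dirs X"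
  shows "\<forall>\<^sub>F \<delta> in at_right 0. z + \<delta> *\<^sub>R f \<in> rel_interior X"
proof -
  obtain e where "e > 0" "\<forall>\<delta>. \<bar>\<delta>\<bar> \<le> e \<longrightarrow> z + \<delta> *\<^sub>R f \<in> rel_interior X"
    using rel_interior_move[OF assms] by blast
  then show ?thesis unfolding eventually_at_right_field by (intro exI[of _ e]) auto
qed

text \<open>Splitting off weight \<open>\<delta>\<close> on \<open>w\<close> leaves a point
  \<open>y\<close> of \<open>F\<close> that absorbs the tangential term \<open>f\<close>. As
  \<open>y\<close> does not depend on \<open>w\<close>, this serves both for membership in a convex
  set and for membership in its relative interior.\<close>

lemma convex_move_aux:
  assumes "z \<in> rel_interior F" "f \<in> dirs F"
  shows "\<forall>\<^sub>F \<delta> in at_right 0. 0 < \<delta> \<and> \<delta> < 1 \<and>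
    (\<exists>y\<in>F. \<forall>w. z + \<delta> *\<^sub>R ((w - z) + f) = (1 - \<delta>) *\<^sub>R y + \<delta> *\<^sub>R w)"
proof -
  obtain e where e: "e > 0" "\<forall>\<delta>. \<bar>\<delta>\<bar> \<le> e \<longrightarrow> z + \<delta> *\<^sub>R f \<in> rel_interior F"
    using rel_interior_move[OF assms] by blast
  have "0 < \<delta> \<and> \<delta> < 1 \<and>
    (\<exists>y\<in>F. \<forall>w. z + \<delta> *\<^sub>R ((w - z) + f) = (1 - \<delta>) *\<^sub>R y + \<delta> *\<^sub>R w)"
    if d: "0 < \<delta>" "\<delta> < min (1/2) (e/2)" for \<delta>
  proof -
    \<comment> \<open>Solving for \<open>y\<close> gives the step
      \<open>\<delta> / (1 - \<delta>)\<close> along \<open>f\<close>. For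
      \<open>\<delta> < 1/2\<close> it is at most \<open>2 * \<delta>\<close>, hence the bound
      \<open>e/2\<close>.\<close>
    have le: "\<delta> / (1 - \<delta>) \<le> e"
    proof -
      have "\<delta> / (1 - \<delta>) \<le> \<delta> / (1/2)" using d by (intro divide_left_mono) auto
      then show ?thesis using d by simp
    qed
    then have "z + (\<delta> / (1 - \<delta>)) *\<^sub>R f \<in> F"
      using e(2) d rel_interior_subset by force
    moreover have "z + \<delta> *\<^sub>R ((w - z) + f) = (1 - \<delta>) *\<^sub>R (z + (\<delta> / (1 - \<delta>)) *\<^sub>R f) + \<delta> *\<^sub>R w" for w
      using d by (simp add: scaleR_right_distrib scaleR_left_diff_distrib scaleR_right_diff_distrib)
    ultimately show ?thesis using d by auto
  qed
  then show ?thesis unfolding eventually_at_right_field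
    using e(1) by (intro exI[of _ "min (1/2) (e/2)"]) auto
qed

text \<open>The tangent cone of \<open>X\<close> at \<open>z\<close> is invariant under
  \<open>dirs F\<close>, so a vector into \<open>X\<close> may be changed modulo
  \<open>dirs F\<close> before it is followed.\<close>

lemma convex_move:
  assumes "convex X" "F \<subseteq> X" "z \<in> rel_interior F" "f \<in> dirs F" "w \<in> X"
  shows "\<forall>\<^sub>F \<delta> in at_right 0. z + \<delta> *\<^sub>R ((w - z) + f) \<in> X"
  using convex_move_aux[OF assms(3,4)]
proof (rule eventually_mono)
  fix \<delta> :: real
  assume "0 < \<delta> \<and> \<delta> < 1 \<and>
    (\<exists>y\<in>F. \<forall>w. z + \<delta> *\<^sub>R ((w - z) + f) = (1 - \<delta>) *\<^sub>R y + \<delta> *\<^sub>R w)"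
  then show "z + \<delta> *\<^sub>R ((w - z) + f) \<in> X"
    using assms by (metis convex_alt less_imp_le subsetD)
qed

lemma convex_move_rel_interior:
  assumes "convex X" "F \<subseteq> X" "z \<in> rel_interior F" "f \<in> dirs F" "w \<in> rel_interior X"
  shows "\<forall>\<^sub>F \<delta> in at_right 0. z + \<delta> *\<^sub>R ((w - z) + f) \<in> rel_interior X"
  using convex_move_aux[OF assms(3,4)]
proof (rule eventually_mono)
  fix \<delta> :: real
  assume *: "0 < \<delta> \<and> \<delta> < 1 \<and>
    (\<exists>y\<in>F. \<forall>w. z + \<delta> *\<^sub>R ((w - z) + f) = (1 - \<delta>) *\<^sub>R y + \<delta> *\<^sub>R w)"
  then obtain y where y: "y \<in> F" "z + \<delta> *\<^sub>R ((w - z) + f) = (1 - \<delta>) *\<^sub>R y + \<delta> *\<^sub>R w" by blast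
  have "y - \<delta> *\<^sub>R (y - w) \<in> rel_interior X"
    using assms y * by (intro rel_interior_convex_shrink) auto
  then show "z + \<delta> *\<^sub>R ((w - z) + f) \<in> rel_interior X"
    unfolding y(2) by (simp add: algebra_simps)
qed

lemma eventually_at_right_0_obtains:
  assumes "\<forall>\<^sub>F \<delta> in at_right (0::real). P \<delta>"
  obtains \<delta> where "\<delta> > 0" "P \<delta>"
proof -
  obtain b where "b > 0" "\<forall>y>0. y < b \<longrightarrow> P y"
    using assms unfolding eventually_at_right_field by blast
  then show ?thesis using that[of "b/2"] by simp
qed

lemma eventually_at_right_0_less: "(b::real) > 0 \<Longrightarrow> \<forall>\<^sub>F \<delta> in at_right 0. \<delta> < b"
  unfolding eventually_at_right_field by blast

lemma eventually_at_right_0_pos: "\<forall>\<^sub>F \<delta> in at_right (0::real). \<delta> > 0"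
  by (rule eventually_at_right_less)

section \<open>Generic points of convex sets\<close>

lemma line_meets_affine_once:
  assumes "affine X" "(1 - s) *\<^sub>R p + s *\<^sub>R q \<in> X" "(1 - t) *\<^sub>R p + t *\<^sub>R q \<in> X" "s \<noteq> t"
  shows "(1 - r) *\<^sub>R p + r *\<^sub>R q \<in> X"
proof -
  define k where "k = (r - s) / (t - s)"
  have k: "k * (t - s) = r - s" using assms(4) by (simp add: k_def)
  have "(1 - k) *\<^sub>R ((1 - s) *\<^sub>R p + s *\<^sub>R q) + k *\<^sub>R ((1 - t) *\<^sub>R p + t *\<^sub>R q)
      = (1 - (s + k * (t - s))) *\<^sub>R p + (s + k * (t - s)) *\<^sub>R q"
    by (simp add: algebra_simps)
  also have "\<dots> = (1 - r) *\<^sub>R p + r *\<^sub>R q" by (simp add: k)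
  finally show ?thesis using mem_affine[OF assms(1,2,3), of "1-k" k] by simp
qed

text \<open>On the line from a point off the earlier sets to a point off the new one, no set takes
  up two parameters, since it would then contain both points. Finitely many parameters are lost, and
  infinitely many remain in the unit interval.\<close>

lemma convex_avoid_affine:
  assumes "finite XX" "convex O'" "O' \<noteq> {}"
    and "\<And>X. X \<in> XX \<Longrightarrow> affine X \<and> \<not> O' \<subseteq> X"
  shows "\<exists>p\<in>O'. p \<notin> \<Union>XX"
  using assms(1,4)
proof (induction XX)
  case empty
  then show ?case using assms(3) by auto
next
  case (insert X XX)
  then obtain p where p: "p \<in> O'" "p \<notin> \<Union>XX" by auto
  obtain q where q: "q \<in> O'" "q \<notin> X" using insert.prems by auto
  define l where "l s = (1 - s) *\<^sub>R p + s *\<^sub>R q" for s :: real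
  have fin: "finite {s. l s \<in> Y}" if "Y \<in> insert X XX" for Y
  proof (rule ccontr)
    assume inf: "infinite {s. l s \<in> Y}"
    then obtain s where s: "l s \<in> Y" using not_finite_existsD by blast
    have "infinite ({s. l s \<in> Y} - {s})" using inf by simp
    then have "{s. l s \<in> Y} - {s} \<noteq> {}" by (metis finite.emptyI)
    then obtain t where t: "l t \<in> Y" "t \<noteq> s" by blast
    have Y: "affine Y" using insert.prems that by auto
    have "l r \<in> Y" for r
      using line_meets_affine_once[OF Y s[unfolded l_def] t(1)[unfolded l_def] t(2)[symmetric]]
      by (simp add: l_def)
    from this[of 0] this[of 1] show False using p q that by (auto simp: l_def)
  qed
  have "finite (\<Union>Y\<in>insert X XX. {s. l s \<in> Y})" using insert.hyps(1) fin by blast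
  moreover have "infinite {0..1::real}" by simp
  ultimately obtain s where s: "s \<in> {0..1}" "s \<notin> (\<Union>Y\<in>insert X XX. {s. l s \<in> Y})"
    by (meson finite_subset subsetI)
  then have "l s \<in> O'" using assms(2) p q by (simp add: l_def convex_alt)
  then show ?case using s by auto
qed

section \<open>Cells and walls\<close>

text \<open>A face of least dimension through \<open>x\<close> works: if \<open>x\<close> were on
  its relative frontier, a supporting hyperplane would cut out a smaller face through
  \<open>x\<close>.\<close>

lemma obtains_face_rel_interior:
  fixes F :: "'a::euclidean_space set"
  assumes "convex F" "x \<in> F"
  obtains G where "G face_of F" "x \<in> rel_interior G"
proof -
  define P where "P G \<longleftrightarrow> G face_of F \<and> x \<in> G" for G
  have "P F" using assms by (simp add: P_def face_of_refl)
  \<comment> \<open>The dimension is shifted by one because the empty set has dimension -1 and the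
    measure has to be a natural number.\<close>
  then obtain G where G: "P G" and min: "\<And>H. P H \<Longrightarrow> nat (aff_dim G + 1) \<le> nat (aff_dim H + 1)"
    using ex_has_least_nat[of P F "\<lambda>G. nat (aff_dim G + 1)"] by blast
  have cG: "convex G" using G by (auto simp: P_def face_of_imp_convex)
  have "x \<in> rel_interior G"
  proof (rule ccontr)
    assume nx: "x \<notin> rel_interior G"
    have xG: "x \<in> G" using G by (simp add: P_def)
    obtain a where a: "\<And>y. y \<in> closure G \<Longrightarrow> a \<bullet> x \<le> a \<bullet> y"
      "\<And>y. y \<in> rel_interior G \<Longrightarrow> a \<bullet> x < a \<bullet> y"
      using supporting_hyperplane_relative_frontier[OF cG _ nx] xG closure_subset
      by (metis subsetD)
    define H where "H = G \<inter> {y. a \<bullet> y = a \<bullet> x}"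
    have Hf: "H face_of G" unfolding H_def
      by (rule face_of_Int_supporting_hyperplane_ge[OF cG]) (use a(1) closure_subset in auto)
    then have "P H" using G xG face_of_trans unfolding P_def H_def by blast
    moreover obtain m where m: "m \<in> rel_interior G" using cG xG rel_interior_eq_empty by fastforce
    ultimately have "H \<noteq> G" using a(2)[OF m] rel_interior_subset by (force simp: H_def)
    then have "aff_dim H < aff_dim G" using cG Hf face_of_aff_dim_lt by blast
    moreover have "aff_dim H \<ge> -1" by (rule aff_dim_geq)
    ultimately have "nat (aff_dim H + 1) < nat (aff_dim G + 1)" by linarith
    then show False using min[OF \<open>P H\<close>] by linarith
  qed
  then show ?thesis using that[of G] G unfolding P_def by blast
qed

lemma rel_interior_extend_back:
  fixes X :: "'a::euclidean_space set"
  assumes "z \<in> rel_interior X" "y \<in> X"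
  shows "\<forall>\<^sub>F \<delta> in at_right 0. z + \<delta> *\<^sub>R (z - y) \<in> rel_interior X"
  using assms(1)
proof (rule rel_interior_move_eventually)
  show "z - y \<in> dirs X" using assms rel_interior_subset by (intro diff_in_dirs') auto
qed

section \<open>Edges, kept walls and classes of linked cells\<close>

lemma adjacency_edges_iff:
  "{M, N} \<in> adjacency_edges C \<longleftrightarrow>
    M \<in> codim_faces C 0 \<and> N \<in> codim_faces C 0 \<and> M \<inter> N \<in> codim_faces C 1"
  unfolding adjacency_edges_def by (auto simp: doubleton_eq_iff Int_commute)

text \<open>\<open>Inter\<close> turns an edge \<open>{M, N}\<close> into its wall
  \<open>M \<inter> N\<close>. When the support is convex, the edge can be recovered from the wall
  by \<open>wall_unique\<close>, so no information is lost.\<close>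

definition kept_walls :: "'a::euclidean_space set set \<Rightarrow> 'a set set set \<Rightarrow> 'a set set" where
  "kept_walls C E = Inter ` (adjacency_edges C - E)"

definition linked :: "'a set set set \<Rightarrow> 'a set \<Rightarrow> 'a set \<Rightarrow> bool" where
  "linked E = (\<lambda>M N. {M, N} \<in> E)\<^sup>*\<^sup>*"

definition region :: "'a::euclidean_space set set \<Rightarrow> 'a set set set \<Rightarrow> 'a set \<Rightarrow> 'a set" where
  "region C E M = \<Union>{N \<in> codim_faces C 0. linked E M N}"

lemma linked_refl: "linked E M M"
  by (simp add: linked_def)

lemma linked_trans: "linked E M N \<Longrightarrow> linked E N K \<Longrightarrow> linked E M K"
  unfolding linked_def by (rule rtranclp_trans)

lemma linked_edge: "{M, N} \<in> E \<Longrightarrow> linked E M N"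
  unfolding linked_def by (rule r_into_rtranclp)

lemma linked_sym: "linked E M N \<Longrightarrow> linked E N M"
  unfolding linked_def
proof (induction rule: rtranclp_induct)
  case (step y z)
  have "{z, y} \<in> E" using step.hyps(2) by (simp add: insert_commute)
  then show ?case using step.IH by (rule converse_rtranclp_into_rtranclp)
qed simp

lemma region_eq: "linked E M N \<Longrightarrow> region C E M = region C E N"
  unfolding region_def using linked_sym linked_trans by metis

text \<open>In terms of the outward ray \<open>r\<^sub>W\<close> of each wall \<open>W\<close> around \<open>F\<close>, the condition says that no
  half-plane contains all rays of walls outside \<open>E\<close> unless they lie on its boundary line.\<close>

definition balanced_at :: "'a::euclidean_space set set \<Rightarrow> 'a set set set \<Rightarrow> 'a set \<Rightarrow> bool" where
  "balanced_at C E F \<longleftrightarrow>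
     (\<forall>n. (\<forall>y\<in>F. \<forall>z\<in>F. n \<bullet> (y - z) = 0) \<longrightarrow>
        (\<forall>W\<in>kept_walls C E. F \<subseteq> W \<longrightarrow> (\<forall>w\<in>W. \<forall>x\<in>F. 0 \<le> n \<bullet> (w - x))) \<longrightarrow>
        (\<forall>W\<in>kept_walls C E. F \<subseteq> W \<longrightarrow> (\<forall>w\<in>W. \<forall>x\<in>F. n \<bullet> (w - x) = 0)))"

locale convex_complex =
  fixes C :: "'a::euclidean_space set set"
  assumes complex: "polyhedral_complex C"
    and convex_Supp: "convex (Supp C)"
begin

abbreviation "S \<equiv> Supp C"
abbreviation "cells \<equiv> codim_faces C 0"

lemma finite_C: "finite C"
  and polyhedron_C: "F \<in> C \<Longrightarrow> polyhedron F"
  and face_C: "F \<in> C \<Longrightarrow> G face_of F \<Longrightarrow> G \<noteq> {} \<Longrightarrow> G \<in> C"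
  and Int_face_C: "F \<in> C \<Longrightarrow> G \<in> C \<Longrightarrow> F \<inter> G face_of F"
    "F \<in> C \<Longrightarrow> G \<in> C \<Longrightarrow> F \<inter> G face_of G"
  using complex by (auto simp: polyhedral_complex_def)

lemma convex_C: "F \<in> C \<Longrightarrow> convex F"
  and closed_C: "F \<in> C \<Longrightarrow> closed F"
  by (simp_all add: polyhedron_C polyhedron_imp_convex polyhedron_imp_closed)

lemma C_subset: "F \<in> C \<Longrightarrow> F \<subseteq> S"
  by (auto simp: Supp_def)

lemma S_nonempty: "S \<noteq> {}"
  using complex by (auto simp: polyhedral_complex_def Supp_def)

lemma cellsD:
  assumes "M \<in> cells"
  shows "M \<in> C" "M \<noteq> {}" "aff_dim M = aff_dim S" "affine hull M = affine hull S"
    "dirs M = dirs S" "convex M" "closed M" "M \<subseteq> S"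
proof -
  show M: "M \<in> C" "M \<noteq> {}" "aff_dim M = aff_dim S" "convex M" "closed M" "M \<subseteq> S"
    using assms convex_C closed_C C_subset by (auto simp: codim_faces_def)
  show eq: "affine hull M = affine hull S"
    using M by (intro affine_dim_equal) (auto simp: hull_mono)
  obtain z where "z \<in> M" using M by auto
  then show "dirs M = dirs S"
    using dirs_affine_hull_image[of z M] dirs_affine_hull_image[of z S] eq M by auto
qed

text \<open>A face of \<open>F\<close> that meets the relative interior of \<open>F\<close> is all
  of \<open>F\<close>; the face here is \<open>F \<inter> G\<close>.\<close>

lemma face_contains:
  assumes "x \<in> rel_interior F" "x \<in> G" "F \<in> C" "G \<in> C"
  shows "F \<subseteq> G"
  using subset_of_face_of[OF Int_face_C(1)[OF assms(3,4)], of F] assms rel_interior_subset by blast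

lemma cell_subset:
  assumes "M \<in> cells" "N \<in> C" "M \<subseteq> N"
  shows "M = N"
proof (rule ccontr)
  assume ne: "M \<noteq> N"
  have "M face_of N" using Int_face_C(2)[of M N] cellsD(1)[OF assms(1)] assms by (simp add: Int_absorb2)
  then have "aff_dim M < aff_dim N" using ne assms convex_C face_of_aff_dim_lt by blast
  then show False using cellsD(3)[OF assms(1)] aff_dim_subset[OF C_subset[OF assms(2)]] by simp
qed

lemma cell_rel_interior:
  assumes "M \<in> cells" "N \<in> C" "x \<in> rel_interior M" "x \<in> N"
  shows "M = N"
  using cell_subset face_contains assms cellsD(1) by blast

lemma rel_interior_cell_subset:
  assumes "M \<in> cells"
  shows "rel_interior M \<subseteq> rel_interior S"
  using assms cellsD by (intro subset_rel_interior) auto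

lemma rel_interior_cell_nonempty:
  assumes "M \<in> cells"
  shows "rel_interior M \<noteq> {}"
  using assms cellsD by (simp add: rel_interior_eq_empty)

lemma minimal_face:
  assumes "x \<in> F" "F \<in> C"
  obtains G where "G \<in> C" "G face_of F" "x \<in> rel_interior G"
proof -
  obtain G where "G face_of F" "x \<in> rel_interior G"
    using obtains_face_rel_interior[OF convex_C] assms by blast
  then show ?thesis using that face_C[OF assms(2)] rel_interior_subset by blast
qed

lemma generic_point:
  assumes "openin (top_of_set (affine hull S)) O'" "convex O'" "O' \<noteq> {}"
    and "finite XX" "\<And>X. X \<in> XX \<Longrightarrow> affine X \<and> aff_dim X < aff_dim S"
  obtains p where "p \<in> O'" "p \<notin> \<Union>XX"
proof -
  have "affine hull O' = affine hull S"
    using affine_hull_openin[OF assms(1,3)] by simp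
  then have d: "aff_dim O' = aff_dim S" by (metis aff_dim_affine_hull)
  have "\<not> O' \<subseteq> X" if "X \<in> XX" for X
    using aff_dim_subset[of O' X] d assms(5)[OF that] by linarith
  then show ?thesis using convex_avoid_affine[OF assms(4,2,3)] assms(5) that by blast
qed

lemma openin_rel_interior_cell:
  assumes "M \<in> cells"
  shows "openin (top_of_set (affine hull S)) (rel_interior M)"
  using openin_rel_interior[of M] cellsD(4)[OF assms] by simp

lemma openin_rel_interior_cell_ball:
  assumes "M \<in> cells" "z \<in> M" "e > 0"
  shows "openin (top_of_set (affine hull S)) (rel_interior M \<inter> ball z e)"
    "convex (rel_interior M \<inter> ball z e)" "rel_interior M \<inter> ball z e \<noteq> {}"
proof -
  show "openin (top_of_set (affine hull S)) (rel_interior M \<inter> ball z e)"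
    using openin_rel_interior_cell[OF assms(1)] by (simp add: openin_Int_open)
  show "convex (rel_interior M \<inter> ball z e)"
    using cellsD[OF assms(1)] by (intro convex_Int convex_rel_interior) auto
  have "z \<in> closure (rel_interior M)"
    using cellsD[OF assms(1)] assms(2) by (simp add: convex_closure_rel_interior)
  then show "rel_interior M \<inter> ball z e \<noteq> {}"
    using assms(3) unfolding closure_approachable by (fastforce simp: dist_commute)
qed

text \<open>A point off all cells would have a ball around it off all cells, these being closed and
  finite in number. By convexity the ball meets the relative interior of \<open>S\<close>, and a
  generic point there avoids the affine hulls of all smaller faces, so it would lie in no face at
  all.\<close>

lemma S_eq_Union_cells: "S = \<Union>cells"
proof
  show "\<Union>cells \<subseteq> S" using cellsD by blast
  show "S \<subseteq> \<Union>cells"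
  proof (rule ccontr)
    assume "\<not> S \<subseteq> \<Union>cells"
    then obtain z where z: "z \<in> S" "z \<notin> \<Union>cells" by blast
    have "closed (\<Union>cells)"
      using finite_C cellsD(7) by (intro closed_Union) (auto simp: codim_faces_def)
    then obtain e where e: "e > 0" "ball z e \<inter> \<Union>cells = {}"
    proof -
      have "open (- \<Union>cells)" "z \<in> - \<Union>cells" using \<open>closed (\<Union>cells)\<close> z(2) by (auto simp: open_Compl)
      then obtain e where "e > 0" "ball z e \<subseteq> - \<Union>cells" using open_contains_ball by blast
      then show ?thesis using that by blast
    qed
    let ?O = "rel_interior S \<inter> ball z e"
    have op: "openin (top_of_set (affine hull S)) ?O"
      using openin_rel_interior[of S] by (simp add: openin_Int_open)
    have "z \<in> closure (rel_interior S)"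
      using convex_closure_rel_interior[OF convex_Supp] z closure_subset by blast
    then have ne: "?O \<noteq> {}"
      using e unfolding closure_approachable by (fastforce simp: dist_commute)
    have "convex ?O" by (intro convex_Int convex_rel_interior convex_Supp) simp
    moreover have "affine X \<and> aff_dim X < aff_dim S" if X: "X \<in> (hull) affine ` (C - cells)" for X
    proof -
      obtain F where F: "F \<in> C" "F \<notin> cells" "X = affine hull F" using X by blast
      have "aff_dim F \<le> aff_dim S" using F C_subset aff_dim_subset by blast
      moreover have "F = {} \<or> aff_dim F \<noteq> aff_dim S" using F by (auto simp: codim_faces_def)
      \<comment> \<open>This covers \<open>F = {}\<close>, a possible member of \<open>C\<close>,
        whose dimension is -1.\<close>
      moreover have "aff_dim S \<ge> 0" using dim_dirs[OF S_nonempty] by linarith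
      ultimately show ?thesis using F by (auto simp: aff_dim_affine_hull)
    qed
    ultimately obtain p where p: "p \<in> ?O" "p \<notin> \<Union>((hull) affine ` (C - cells))"
      using generic_point[OF op _ ne, of "(hull) affine ` (C - cells)"] finite_C by blast
    then have "p \<in> S" using rel_interior_subset by blast
    then obtain F where F: "p \<in> F" "F \<in> C" by (auto simp: Supp_def)
    then have "F \<in> cells" using p(2) hull_inc[of p F affine] by blast
    then show False using p F e by blast
  qed
qed

lemma cell_at:
  assumes "z \<in> S"
  obtains M where "M \<in> cells" "z \<in> M"
  using assms S_eq_Union_cells by blast

section \<open>Walls and their two sides\<close>

lemma wall_dims:
  assumes "W \<in> codim_faces C 1"
  shows "W \<in> C" "W \<noteq> {}" "convex W" "closed W" "W \<subseteq> S" "dim (dirs S) = dim (dirs W) + 1"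
    "dirs W \<subseteq> dirs S"
proof -
  show W: "W \<in> C" "W \<noteq> {}" "convex W" "closed W" "W \<subseteq> S"
    using assms convex_C closed_C C_subset by (auto simp: codim_faces_def)
  show "dim (dirs S) = dim (dirs W) + 1"
    using dim_dirs[of S] dim_dirs[of W] W S_nonempty assms by (auto simp: codim_faces_def)
  show "dirs W \<subseteq> dirs S" using W dirs_mono by blast
qed

lemma finite_codim: "finite (codim_faces C k)"
  using finite_C by (rule rev_finite_subset) (auto simp: codim_faces_def)

lemma wall_rel_interior_obtains:
  assumes "W \<in> codim_faces C 1"
  obtains w where "w \<in> rel_interior W"
  using wall_dims[OF assms] by (metis all_not_in_conv rel_interior_eq_empty)

lemma wall_split:
  assumes "W \<in> codim_faces C 1" "d \<in> dirs S" "d \<notin> dirs W" "v \<in> dirs S"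
  obtains a where "v - a *\<^sub>R d \<in> dirs W"
  using subspace_complement_1[OF subspace_dirs subspace_dirs wall_dims(7)[OF assms(1)]
      wall_dims(6)[OF assms(1)] assms(2,3,4)] by blast

lemma edge_not_eq:
  assumes "{M, N} \<in> adjacency_edges C"
  shows "M \<noteq> N"
  using assms by (auto simp: adjacency_edges_iff codim_faces_def)

lemma wall_disjoint_rel_interior:
  assumes "W \<in> codim_faces C 1" "M \<in> cells"
  shows "rel_interior M \<inter> W = {}"
proof (rule ccontr)
  assume "rel_interior M \<inter> W \<noteq> {}"
  then have "M = W" using cell_rel_interior assms(2) wall_dims(1)[OF assms(1)] by blast
  then show False using assms by (auto simp: codim_faces_def)
qed

text \<open>The wall is a face of \<open>N\<close>, so its affine hull meets \<open>N\<close> only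
  in the wall.\<close>

lemma adjacent_affine_hull_disjoint:
  assumes "{M, N} \<in> adjacency_edges C" "z \<in> M \<inter> N" "q \<in> rel_interior N"
  shows "q - z \<notin> dirs (M \<inter> N)"
proof
  assume "q - z \<in> dirs (M \<inter> N)"
  then have "q \<in> affine hull (M \<inter> N)" using assms(2) by (simp add: affine_hull_iff_dirs)
  moreover have MN: "M \<in> cells" "N \<in> cells" "M \<inter> N \<in> codim_faces C 1"
    using assms by (auto simp: adjacency_edges_iff)
  moreover have "M \<inter> N = affine hull (M \<inter> N) \<inter> N"
    using face_of_imp_eq_affine_Int[OF _ Int_face_C(2)] cellsD MN by blast
  moreover have "q \<in> N" using assms(3) rel_interior_subset by blast
  ultimately have "q \<in> M \<inter> N" by blast
  then show False using wall_disjoint_rel_interior[OF MN(3,2)] assms(3) by blast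
qed

text \<open>Modulo the directions of the wall, \<open>dirs S\<close> is one-dimensional, so a vector
  into \<open>M\<close> is a multiple \<open>b\<close> of the vector \<open>q - z\<close> into
  \<open>N\<close>. A positive \<open>b\<close> would make the interiors of two cells overlap, and
  \<open>b = 0\<close> would put \<open>M\<close> into the hull of the wall.\<close>

lemma opposite_sides:
  assumes "{M, N} \<in> adjacency_edges C" "z \<in> rel_interior (M \<inter> N)" "q \<in> rel_interior N"
  shows "\<forall>\<^sub>F \<delta> in at_right 0. z + \<delta> *\<^sub>R (z - q) \<in> rel_interior M"
proof -
  let ?W = "M \<inter> N"
  have MN: "M \<in> cells" "N \<in> cells" "?W \<in> codim_faces C 1"
    using assms by (auto simp: adjacency_edges_iff)
  have zW: "z \<in> ?W" using assms(2) rel_interior_subset by blast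
  have qN: "q \<in> N" using assms(3) rel_interior_subset by blast
  obtain m where m: "m \<in> rel_interior M" using rel_interior_cell_nonempty[OF MN(1)] by blast
  have mM: "m \<in> M" using m rel_interior_subset by blast
  have q: "q - z \<in> dirs S" "q - z \<notin> dirs ?W"
    using diff_in_dirs'[of q N z] qN zW cellsD(5)[OF MN(2)]
      adjacent_affine_hull_disjoint[OF assms(1) zW assms(3)] by auto
  have "m - z \<in> dirs S" using diff_in_dirs'[of m M z] mM zW cellsD(5)[OF MN(1)] by auto
  then obtain b where b: "m - z - b *\<^sub>R (q - z) \<in> dirs ?W"
    using wall_split[OF MN(3) q] by blast
  \<comment> \<open>\<open>f\<close> is tangent to the wall and corrects \<open>m - z\<close> to an
    exact multiple of \<open>q - z\<close>.\<close>
  define f where "f = b *\<^sub>R (q - z) - (m - z)"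
  have f: "f \<in> dirs ?W" using dirs_minus[OF b] by (simp add: f_def)
  have fe: "(m - z) + f = b *\<^sub>R (q - z)" by (simp add: f_def)
  have b0: "b \<noteq> 0"
  proof
    assume "b = 0"
    then have "m - z \<in> dirs ?W" using b by simp
    moreover have "{N, M} \<in> adjacency_edges C" using assms(1) by (simp add: insert_commute)
    ultimately show False using adjacent_affine_hull_disjoint[of N M z m] zW m
      by (simp add: Int_commute)
  qed
  have ev: "\<forall>\<^sub>F \<delta> in at_right 0. z + \<delta> *\<^sub>R (b *\<^sub>R (q - z)) \<in> rel_interior M"
    using convex_move_rel_interior[OF cellsD(6)[OF MN(1)] _ assms(2) f m] unfolding fe by simp
  have "b < 0"
  proof (rule ccontr)
    assume "\<not> b < 0"
    then have b: "b > 0" using b0 by simp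
    have "\<forall>\<^sub>F \<delta> in at_right 0. z + \<delta> *\<^sub>R (b *\<^sub>R (q - z)) \<in> rel_interior M \<and> \<delta> < 1/b \<and> \<delta> > 0"
      using ev b by (intro eventually_conj eventually_at_right_0_less eventually_at_right_0_pos) auto
    then obtain \<delta> where d: "\<delta> > 0" "z + \<delta> *\<^sub>R (b *\<^sub>R (q - z)) \<in> rel_interior M" "\<delta> < 1/b"
      using eventually_at_right_0_obtains by (metis (mono_tags, lifting))
    have db: "0 < \<delta> * b" "\<delta> * b \<le> 1" using d b by (auto simp: field_simps)
    have "z - (\<delta> * b) *\<^sub>R (z - q) \<in> rel_interior N"
      using cellsD(6)[OF MN(2)] assms(3) zW db by (intro rel_interior_convex_shrink) auto
    then have "z + \<delta> *\<^sub>R (b *\<^sub>R (q - z)) \<in> rel_interior N" by (simp add: algebra_simps)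
    then have "M = N" using d(2) cell_rel_interior[OF MN(1) cellsD(1)[OF MN(2)]] rel_interior_subset by blast
    then show False using edge_not_eq[OF assms(1)] by simp
  qed
  \<comment> \<open>Dividing the parameter by \<open>-b\<close> turns the vector
    \<open>b *\<^sub>R (q - z)\<close> into \<open>z - q\<close>.\<close>
  have "\<forall>\<^sub>F \<delta> in at_right 0. z + (\<delta> / (-b)) *\<^sub>R (b *\<^sub>R (q - z)) \<in> rel_interior M"
  proof -
    obtain e where e: "e > 0" "\<forall>y>0. y < e \<longrightarrow> z + y *\<^sub>R (b *\<^sub>R (q - z)) \<in> rel_interior M"
      using ev unfolding eventually_at_right_field by auto
    show ?thesis unfolding eventually_at_right_field
    proof (intro exI[of _ "e * (-b)"] conjI allI impI)
      show "0 < e * - b" using e \<open>b < 0\<close> by (simp add: mult_pos_neg)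
      fix y :: real assume y: "0 < y" "y < e * - b"
      have "0 < y / (-b)" "y / (-b) < e"
        using y \<open>b < 0\<close> by (simp_all add: divide_simps)
      then show "z + (y / - b) *\<^sub>R b *\<^sub>R (q - z) \<in> rel_interior M" using e(2) by blast
    qed
  qed
  then show ?thesis using \<open>b < 0\<close> by (simp add: algebra_simps)
qed

text \<open>If three cells shared a wall, two of them would both lie on the side opposite to the
  third, and their interiors would meet.\<close>

lemma wall_unique_aux:
  assumes "{M, N} \<in> adjacency_edges C" "{M', N'} \<in> adjacency_edges C" "M' \<inter> N' = M \<inter> N"
  shows "M' \<in> {M, N}"
proof (rule ccontr)
  let ?W = "M \<inter> N"
  assume ne: "M' \<notin> {M, N}"
  have c: "M \<in> cells" "N \<in> cells" "?W \<in> codim_faces C 1" "M' \<in> cells"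
    using assms by (auto simp: adjacency_edges_iff)
  \<comment> \<open>\<open>K \<inter> M'\<close> is a proper face of \<open>K\<close> and has the
    wall as a face. The wall already has codimension 1, so the two agree.\<close>
  have adj: "{K, M'} \<in> adjacency_edges C \<and> K \<inter> M' = ?W" if K: "K \<in> {M, N}" for K
  proof -
    have Kc: "K \<in> cells" "K \<noteq> M'" using K c ne by auto
    have sub: "?W \<subseteq> K \<inter> M'" using K assms(3) by auto
    have f1: "K \<inter> M' face_of K" using Int_face_C(1) Kc c cellsD(1) by blast
    have "K \<inter> M' \<noteq> K" using cell_subset[OF Kc(1) cellsD(1)[OF c(4)]] Kc(2) by blast
    then have lt: "aff_dim (K \<inter> M') < aff_dim S"
      using face_of_aff_dim_lt[OF cellsD(6) f1] Kc cellsD(3) by metis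
    have "?W face_of K" using Int_face_C K c cellsD(1) by blast
    then have Wf: "?W face_of K \<inter> M'" using sub by (rule face_of_subset) auto
    have "?W = K \<inter> M'"
    proof (rule ccontr)
      assume "?W \<noteq> K \<inter> M'"
      then have "aff_dim ?W < aff_dim (K \<inter> M')"
        using face_of_aff_dim_lt[OF _ Wf] cellsD(6) Kc c by (metis convex_Int)
      then show False using lt c(3) by (auto simp: codim_faces_def)
    qed
    then show ?thesis using Kc c by (auto simp: adjacency_edges_iff)
  qed
  obtain z where z: "z \<in> rel_interior ?W" using wall_rel_interior_obtains[OF c(3)] .
  obtain q where q: "q \<in> rel_interior M'" using rel_interior_cell_nonempty[OF c(4)] by blast
  have "\<forall>\<^sub>F \<delta> in at_right 0. z + \<delta> *\<^sub>R (z - q) \<in> rel_interior M \<and> z + \<delta> *\<^sub>R (z - q) \<in> rel_interior N"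
    using opposite_sides[of M M' z q] opposite_sides[of N M' z q] adj z q
    by (intro eventually_conj) auto
  then obtain x where "x \<in> rel_interior M" "x \<in> rel_interior N"
    using eventually_at_right_0_obtains by blast
  then have "M = N" using cell_rel_interior c cellsD(1) rel_interior_subset by blast
  then show False using edge_not_eq[OF assms(1)] by simp
qed

lemma wall_unique:
  assumes "{M, N} \<in> adjacency_edges C" "{M', N'} \<in> adjacency_edges C" "M' \<inter> N' = M \<inter> N"
  shows "{M', N'} = {M, N}"
proof -
  have "M' \<in> {M, N}" using wall_unique_aux[OF assms] .
  moreover have "N' \<in> {M, N}"
    using wall_unique_aux[OF assms(1), of N' M'] assms by (simp add: insert_commute Int_commute)
  moreover have "M' \<noteq> N'" using edge_not_eq[OF assms(2)] .
  ultimately show ?thesis by auto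
qed

lemma kept_wallsE:
  assumes "W \<in> kept_walls C E"
  obtains M N where "W = M \<inter> N" "{M, N} \<in> adjacency_edges C" "{M, N} \<notin> E"
    "M \<in> cells" "N \<in> cells" "W \<in> codim_faces C 1"
  using assms unfolding kept_walls_def adjacency_edges_def by fastforce

lemma kept_walls_codim: "W \<in> kept_walls C E \<Longrightarrow> W \<in> codim_faces C 1"
  by (erule kept_wallsE)

lemma finite_kept_walls: "finite (kept_walls C E)"
proof (rule finite_subset)
  show "kept_walls C E \<subseteq> C" using kept_walls_codim wall_dims(1) by blast
qed (rule finite_C)

lemma closed_Union_kept_walls: "closed (\<Union>(kept_walls C E))"
  using finite_kept_walls kept_walls_codim wall_dims(4) by (intro closed_Union) auto

text \<open>A wall through a relative interior point of another has that other wall as a face, and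
  equal dimensions make them equal; then both come from the same edge.\<close>

lemma kept_wall_at_wall:
  assumes "W \<in> kept_walls C E" "{M, N} \<in> adjacency_edges C" "z \<in> rel_interior (M \<inter> N)" "z \<in> W"
  shows "{M, N} \<notin> E"
proof -
  obtain M' N' where W: "W = M' \<inter> N'" "{M', N'} \<in> adjacency_edges C" "{M', N'} \<notin> E" "W \<in> codim_faces C 1"
    using kept_wallsE[OF assms(1)] by metis
  have MN: "M \<inter> N \<in> codim_faces C 1" using assms(2) by (simp add: adjacency_edges_iff)
  have sub: "M \<inter> N \<subseteq> W"
    using face_contains[OF assms(3,4)] wall_dims(1)[OF MN] wall_dims(1)[OF W(4)] by blast
  have "M \<inter> N face_of W"
    using Int_face_C(2)[OF wall_dims(1)[OF MN] wall_dims(1)[OF W(4)]] sub by (simp add: Int_absorb2)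
  then have "M \<inter> N = W"
    using face_of_aff_dim_lt[OF wall_dims(3)[OF W(4)]] MN W(4) by (force simp: codim_faces_def)
  then show ?thesis using wall_unique[OF assms(2) W(2)] W by auto
qed

end

section \<open>Sweeping a segment across the complex\<close>

text \<open>The parameters of all hits form a compact set, so an earliest time is attained.\<close>

lemma first_hit:
  fixes g :: "real \<Rightarrow> real \<Rightarrow> 'a::euclidean_space"
  assumes cont: "continuous_on ({0..T} \<times> {a..b}) (\<lambda>(t, s). g t s)"
    and K: "closed K" and hit: "t1 \<in> {0..T}" "s1 \<in> {a..b}" "g t1 s1 \<in> K"
  obtains t s where "t \<in> {0..T}" "s \<in> {a..b}" "g t s \<in> K"
    "\<And>t' s'. 0 \<le> t' \<Longrightarrow> t' < t \<Longrightarrow> s' \<in> {a..b} \<Longrightarrow> g t' s' \<notin> K"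
proof -
  define X where "X = ({0..T} \<times> {a..b}) \<inter> (\<lambda>(t, s). g t s) -` K"
  have cl: "closed X"
    unfolding X_def by (intro continuous_closed_preimage[OF cont _ K] closed_Times) auto
  have "compact (({0..T} \<times> {a..b}) \<inter> X)"
    using cl by (intro compact_Int_closed compact_Times) auto
  then have "compact X" by (simp add: X_def Int_absorb1 Int_assoc[symmetric])
  then have "compact (fst ` X)" by (intro compact_continuous_image continuous_intros)
  moreover have "fst ` X \<noteq> {}"
  proof -
    have "(t1, s1) \<in> X" using hit by (simp add: X_def)
    then show ?thesis by blast
  qed
  ultimately obtain t where t: "t \<in> fst ` X" "\<forall>t'\<in>fst ` X. t \<le> t'"
    using compact_attains_inf by blast
  then obtain s where "(t, s) \<in> X" by force
  then have ts: "t \<in> {0..T}" "s \<in> {a..b}" "g t s \<in> K" by (auto simp: X_def)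
  moreover have "g t' s' \<notin> K" if "0 \<le> t'" "t' < t" "s' \<in> {a..b}" for t' s'
  proof
    assume "g t' s' \<in> K"
    then have "(t', s') \<in> X" using that ts(1) by (auto simp: X_def)
    then show False using t(2) that(2) by force
  qed
  ultimately show ?thesis using that by blast
qed

lemma closed_segment_param: "x \<in> closed_segment p q \<longleftrightarrow> (\<exists>s\<in>{0..1}. x = p + s *\<^sub>R (q - p))"
  unfolding closed_segment_def by (auto simp: algebra_simps)

lemma aff_dim_insert_le: "aff_dim (insert a X) \<le> aff_dim X + 1"
  by (simp add: aff_dim_insert)

locale balanced_complex = convex_complex +
  fixes E :: "'a set set set"
  assumes E_subset: "E \<subseteq> adjacency_edges C"
    and balanced: "F \<in> interior_codim2_faces C \<Longrightarrow> balanced_at C E F"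
begin

abbreviation "kept \<equiv> kept_walls C E"

lemma codim2_dims:
  assumes "F \<in> codim_faces C 2"
  shows "F \<in> C" "F \<noteq> {}" "dim (dirs S) = dim (dirs F) + 2" "dirs F \<subseteq> dirs S"
proof -
  show F: "F \<in> C" "F \<noteq> {}" using assms by (auto simp: codim_faces_def)
  show "dim (dirs S) = dim (dirs F) + 2"
    using dim_dirs[of S] dim_dirs[of F] F S_nonempty assms by (auto simp: codim_faces_def)
  show "dirs F \<subseteq> dirs S" using F C_subset dirs_mono by blast
qed

text \<open>Suppose a line in direction \<open>d\<close>, swept in direction \<open>e\<close>, meets the walls outside \<open>E\<close> for the
  first time at \<open>z\<close>.  If \<open>z\<close> lies in the relative interior of a wall, then the line met that wall
  before.  Otherwise \<open>z\<close> lies on a codimension-2 face, all of whose walls outside \<open>E\<close> are ahead of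
  the line, against the balancing condition.\<close>

lemma no_first_hit:
  assumes W: "W \<in> kept" "z \<in> W" and z: "z \<in> rel_interior S"
    and de: "d \<in> dirs S" "e \<in> dirs S"
    and dims: "\<And>A. A \<in> C \<Longrightarrow> z \<in> A \<Longrightarrow> aff_dim A \<ge> aff_dim S - 2"
    and indep: "\<And>F a b. F \<in> codim_faces C 2 \<Longrightarrow> z \<in> F \<Longrightarrow> a *\<^sub>R d + b *\<^sub>R e \<in> dirs F \<Longrightarrow> a = 0 \<and> b = 0"
    and dW: "d \<notin> dirs W"
    and first: "\<And>W' a b. W' \<in> kept \<Longrightarrow> z \<in> W' \<Longrightarrow> d \<notin> dirs W' \<Longrightarrow> b > 0 \<Longrightarrow>
        \<not> (\<forall>\<^sub>F \<delta> in at_right 0. z + \<delta> *\<^sub>R (a *\<^sub>R d - b *\<^sub>R e) \<in> W')"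
  shows False
proof -
  note Wc = kept_walls_codim[OF W(1)]
  obtain a where a: "e - a *\<^sub>R d \<in> dirs W" using wall_split[OF Wc de(1) dW de(2)] .
  obtain G where G: "G \<in> C" "G face_of W" "z \<in> rel_interior G"
    using minimal_face[OF W(2) wall_dims(1)[OF Wc]] .
  have zG: "z \<in> G" using G(3) rel_interior_subset by blast
  show False
  proof (cases "G = W")
    case True
    \<comment> \<open>A step back in time inside the wall: \<open>a\<close> was chosen so that this
      vector is tangent to \<open>W\<close>.\<close>
    have "a *\<^sub>R d - 1 *\<^sub>R e \<in> dirs W" using dirs_minus[OF a] by simp
    then have "\<forall>\<^sub>F \<delta> in at_right 0. z + \<delta> *\<^sub>R (a *\<^sub>R d - 1 *\<^sub>R e) \<in> rel_interior W"
      using rel_interior_move_eventually G(3) True by blast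
    then have "\<forall>\<^sub>F \<delta> in at_right 0. z + \<delta> *\<^sub>R (a *\<^sub>R d - 1 *\<^sub>R e) \<in> W"
      by (rule eventually_mono) (use rel_interior_subset in blast)
    then show False using first[OF W dW, of 1 a] by simp
  next
    case False
    have "aff_dim G < aff_dim W" using face_of_aff_dim_lt[OF wall_dims(3)[OF Wc] G(2) False] .
    then have "aff_dim G = aff_dim S - 2"
      using dims[OF G(1) zG] Wc by (auto simp: codim_faces_def)
    then have G2: "G \<in> codim_faces C 2" using G zG by (auto simp: codim_faces_def)
    moreover have "\<not> G \<subseteq> rel_frontier S" using z zG by (auto simp: rel_frontier_def)
    ultimately have bal: "balanced_at C E G" by (intro balanced) (simp add: interior_codim2_faces_def)
    \<comment> \<open>\<open>T\<close> consists of the directions of the swept line and of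
      \<open>G\<close>. The component \<open>n\<close> of \<open>e\<close> orthogonal to
      \<open>T\<close> is a clock: constant along the line and along \<open>G\<close>, increasing in
      the direction of the sweep.\<close>
    define T where "T = span (insert d (dirs G))"
    have spG: "span (dirs G) = dirs G" using subspace_dirs by (simp add: span_eq_iff)
    have dG: "d \<notin> dirs G" using indep[OF G2 zG, of 1 0] by auto
    have dimT: "dim T = dim (dirs G) + 1" unfolding T_def using dG by (simp add: dim_insert spG)
    have eT: "e \<notin> T"
    proof
      assume "e \<in> T"
      then obtain k where "e - k *\<^sub>R d \<in> dirs G" unfolding T_def using spG by (auto simp: span_breakdown_eq)
      then show False using indep[OF G2 zG, of "-k" 1] by (simp add: algebra_simps)
    qed
    obtain y n where yn: "y \<in> span T" "\<And>w. w \<in> span T \<Longrightarrow> orthogonal n w" "e = y + n"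
      using orthogonal_subspace_decomp_exists[of T e] by blast
    have spT: "span T = T" by (simp add: T_def)
    have nT: "n \<bullet> w = 0" if "w \<in> T" for w using yn(2) that spT by (simp add: orthogonal_def)
    have "n \<noteq> 0" using yn eT spT by auto
    then have ne: "n \<bullet> e > 0" using yn spT nT[of y] by (simp add: inner_add_right)
    have GT: "dirs G \<subseteq> T" and dT: "d \<in> T" unfolding T_def by (auto intro: span_base)
    have nG: "n \<bullet> (y - x) = 0" if "y \<in> G" "x \<in> G" for y x
      using nT GT diff_in_dirs'[OF that] by blast
    have nonneg: "0 \<le> n \<bullet> (w - x)" if W': "W' \<in> kept" "G \<subseteq> W'" and wx: "w \<in> W'" "x \<in> G" for W' w x
    proof -
      note W'c = kept_walls_codim[OF W'(1)]
      have zW': "z \<in> W'" using zG W' by blast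
      have "0 \<le> n \<bullet> (w - z)"
      proof (cases "d \<in> dirs W'")
        case True
        \<comment> \<open>\<open>first\<close> says nothing about a wall parallel to the line, but
          the directions of such a wall are exactly \<open>T\<close>, where the clock stands
          still.\<close>
        have "T = dirs W'"
        proof (rule subspace_dim_equal)
          show "T \<subseteq> dirs W'" unfolding T_def
            using True dirs_mono[OF W'(2)] subspace_dirs by (intro span_minimal) auto
          show "dim (dirs W') \<le> dim T"
            using dimT wall_dims(6)[OF W'c] codim2_dims(3)[OF G2] by simp
        qed (auto simp: T_def subspace_dirs)
        then show ?thesis using nT diff_in_dirs'[OF wx(1) zW'] by simp
      next
        case False
        have wz: "w - z \<in> dirs S"
          using diff_in_dirs'[OF wx(1) zW'] wall_dims(7)[OF W'c] by blast
        \<comment> \<open>The clock reads \<open>\<beta>\<close>, up to a positive factor. If it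
          were negative, \<open>W'\<close> would have been met at an earlier time.\<close>
        obtain \<alpha> \<beta> where f: "w - z - \<alpha> *\<^sub>R d - \<beta> *\<^sub>R e \<in> dirs G"
          using subspace_complement_2[OF subspace_dirs subspace_dirs codim2_dims(4,3)[OF G2] de wz
              indep[OF G2 zG]] by blast
        define f where "f = \<alpha> *\<^sub>R d + \<beta> *\<^sub>R e - (w - z)"
        have fG: "f \<in> dirs G" using dirs_minus[OF f] by (simp add: f_def algebra_simps)
        have fe: "(w - z) + f = \<alpha> *\<^sub>R d - (- \<beta>) *\<^sub>R e" by (simp add: f_def)
        have "\<forall>\<^sub>F \<delta> in at_right 0. z + \<delta> *\<^sub>R (\<alpha> *\<^sub>R d - (- \<beta>) *\<^sub>R e) \<in> W'"
          using convex_move[OF wall_dims(3)[OF W'c] W'(2) G(3) fG wx(1)] unfolding fe .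
        then have "\<beta> \<ge> 0" using first[OF W'(1) zW' False, of "-\<beta>" \<alpha>] by force
        moreover have "n \<bullet> (w - z) = \<beta> * (n \<bullet> e)"
        proof -
          have "n \<bullet> (w - z) = n \<bullet> (\<alpha> *\<^sub>R d + \<beta> *\<^sub>R e) - n \<bullet> f"
            by (simp add: f_def inner_diff_right)
          then show ?thesis using nT[OF dT] nT[of f] fG GT by (simp add: inner_add_right subset_iff)
        qed
        ultimately show ?thesis using ne by simp
      qed
      moreover have "n \<bullet> (w - x) = n \<bullet> (w - z) + n \<bullet> (z - x)" by (simp add: inner_diff_right)
      ultimately show ?thesis using nG[OF zG wx(2)] by simp
    qed
    have GW: "G \<subseteq> W" using G(2) face_of_imp_subset by blast
    have zero: "\<forall>w\<in>W. \<forall>x\<in>G. n \<bullet> (w - x) = 0"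
      using bal nG nonneg W(1) GW unfolding balanced_at_def by blast
    \<comment> \<open>Balancing stops the clock along \<open>W\<close>, yet \<open>W\<close> has the
      tangent vector \<open>e - a *\<^sub>R d\<close>, along which the clock advances.\<close>
    have "dirs W \<subseteq> {v. n \<bullet> v = 0}"
      unfolding dirs_eq_span[OF W(2)]
      using zero zG by (intro span_minimal subspace_hyperplane) auto
    then have "n \<bullet> (e - a *\<^sub>R d) = 0" using a by blast
    then show False using ne nT[OF dT] by (simp add: inner_diff_right)
  qed
qed

text \<open>The order of the quantifiers is the point: \<open>XX\<close> comes after
  \<open>q'\<close>, because the exceptional sets will be built from \<open>q'\<close>. Both ends
  are moved slightly until the segment crosses \<open>W\<close> transversally in its relative
  interior; then the points of \<open>M\<close> that see \<open>q'\<close> through \<open>W\<close>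
  surround the moved end.\<close>

lemma segment_perturb:
  assumes MN: "M \<in> cells" "N \<in> cells" and W: "W \<in> codim_faces C 1"
    and pq: "p \<in> rel_interior M" "q \<in> rel_interior N" and hit: "z \<in> closed_segment p q" "z \<in> W"
  obtains q' where "q' \<in> rel_interior N"
    "\<And>XX. finite XX \<Longrightarrow> (\<And>X. X \<in> XX \<Longrightarrow> affine X \<and> aff_dim X < aff_dim S) \<Longrightarrow>
       \<exists>p'\<in>rel_interior M. p' \<notin> \<Union>XX \<and> closed_segment p' q' \<inter> W \<noteq> {}"
proof -
  obtain l where l: "0 \<le> l" "l \<le> 1" "z = p + l *\<^sub>R (q - p)"
    using hit(1) unfolding closed_segment_param by auto
  have "l \<noteq> 0" using l(3) pq(1) hit(2) wall_disjoint_rel_interior[OF W MN(1)] by auto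
  moreover have "l \<noteq> 1" using l(3) pq(2) hit(2) wall_disjoint_rel_interior[OF W MN(2)] by auto
  ultimately have l01: "0 < l" "l < 1" using l by auto
  obtain w where w: "w \<in> rel_interior W" using wall_rel_interior_obtains[OF W] .
  have wW: "w \<in> W" using w rel_interior_subset by blast
  have wz: "w - z \<in> dirs W" using diff_in_dirs'[OF wW hit(2)] .
  have "\<not> dirs S \<subseteq> dirs W" using wall_dims(6)[OF W] dim_subset[of "dirs S" "dirs W"] by auto
  then obtain k where k: "k \<in> dirs S" "k \<notin> dirs W" by blast
  \<comment> \<open>A tilt by \<open>k\<close> is added only if the segment lies in the affine hull
    of the wall.\<close>
  define \<kappa> :: real where "\<kappa> = (if q - z \<in> dirs W then 1 else 0)"
  define v where "v = (w - z) + \<kappa> *\<^sub>R k"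
  \<comment> \<open>The opposite tilt of the other end has this coefficient so that
    \<open>(1 - l) *\<^sub>R v' + l *\<^sub>R v = w - z\<close>: the crossing point then moves
    within \<open>W\<close> towards \<open>w\<close>.\<close>
  define v' where "v' = (w - z) - ((l / (1 - l)) * \<kappa>) *\<^sub>R k"
  have vS: "v \<in> dirs S" "v' \<in> dirs S"
  proof -
    have "w - z \<in> dirs S" using wz wall_dims(7)[OF W] by blast
    then show "v \<in> dirs S" "v' \<in> dirs S"
      unfolding v_def v'_def using dirs_scale[OF k(1)] by (blast intro: dirs_add dirs_diff)+
  qed
  have "\<forall>\<^sub>F \<eta> in at_right 0. q + \<eta> *\<^sub>R v \<in> rel_interior N"
    using rel_interior_move_eventually[OF pq(2)] vS cellsD(5)[OF MN(2)] by simp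
  moreover have "\<forall>\<^sub>F \<eta> in at_right 0. p + \<eta> *\<^sub>R v' \<in> rel_interior M"
    using rel_interior_move_eventually[OF pq(1)] vS cellsD(5)[OF MN(1)] by simp
  moreover have "\<forall>\<^sub>F \<eta> in at_right 0. \<eta> < (1::real)" by (rule eventually_at_right_0_less) simp
  ultimately have "\<forall>\<^sub>F \<eta> in at_right 0. q + \<eta> *\<^sub>R v \<in> rel_interior N \<and> p + \<eta> *\<^sub>R v' \<in> rel_interior M \<and> \<eta> < 1"
    by (intro eventually_conj)
  then obtain \<eta> where \<eta>: "\<eta> > 0" "q + \<eta> *\<^sub>R v \<in> rel_interior N" "p + \<eta> *\<^sub>R v' \<in> rel_interior M" "\<eta> < 1"
    using eventually_at_right_0_obtains by (metis (mono_tags, lifting))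
  define q1 where "q1 = q + \<eta> *\<^sub>R v"
  define p1 where "p1 = p + \<eta> *\<^sub>R v'"
  define w1 where "w1 = z - \<eta> *\<^sub>R (z - w)"
  have q1: "q1 \<in> rel_interior N" and p1: "p1 \<in> rel_interior M" using \<eta> by (auto simp: q1_def p1_def)
  have w1: "w1 \<in> rel_interior W" unfolding w1_def
    using wall_dims(3)[OF W] w hit(2) \<eta> by (intro rel_interior_convex_shrink) auto
  have w1W: "w1 \<in> W" using w1 rel_interior_subset by blast
  have "(1 - l) *\<^sub>R v' + l *\<^sub>R v = w - z"
  proof -
    have "(1 - l) *\<^sub>R v' = (1 - l) *\<^sub>R (w - z) - (((1 - l) * (l / (1 - l))) * \<kappa>) *\<^sub>R k"
      by (simp add: v'_def scaleR_right_diff_distrib mult.assoc)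
    also have "(1 - l) * (l / (1 - l)) = l" using l01 by simp
    finally show ?thesis by (simp add: v_def algebra_simps)
  qed
  then have e1: "\<eta> *\<^sub>R (1 - l) *\<^sub>R v' + \<eta> *\<^sub>R l *\<^sub>R v = \<eta> *\<^sub>R (w - z)"
    by (metis scaleR_right_distrib)
  have w1eq: "w1 = p1 + l *\<^sub>R (q1 - p1)"
  proof -
    have "p1 + l *\<^sub>R (q1 - p1) = z + (\<eta> *\<^sub>R (1 - l) *\<^sub>R v' + \<eta> *\<^sub>R l *\<^sub>R v)"
      unfolding p1_def q1_def l(3) by (simp add: algebra_simps)
    also have "\<dots> = w1" unfolding e1 w1_def by (simp add: algebra_simps)
    finally show ?thesis by simp
  qed
  have q1w1: "q1 - w1 \<notin> dirs W"
  proof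
    assume "q1 - w1 \<in> dirs W"
    moreover have "q1 - w1 = (q - z) + (\<eta> * \<kappa>) *\<^sub>R k"
      by (simp add: q1_def w1_def v_def algebra_simps)
    ultimately have *: "(q - z) + (\<eta> * \<kappa>) *\<^sub>R k \<in> dirs W" by simp
    show False
    proof (cases "q - z \<in> dirs W")
      case True
      then have "\<eta> *\<^sub>R k \<in> dirs W" using dirs_diff[OF * True] by (simp add: \<kappa>_def)
      then show False using k \<eta>(1) by (simp add: dirs_scale_iff)
    next
      case False
      then show False using * by (simp add: \<kappa>_def)
    qed
  qed
  \<comment> \<open>\<open>K\<close> is the shadow that \<open>W\<close> casts when lit from
    \<open>q1\<close>.\<close>
  define K where "K = {q1 + \<sigma> *\<^sub>R (w - q1) | \<sigma> w. \<sigma> \<ge> 1 \<and> w \<in> W}"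
  have KI: "q1 + \<sigma> *\<^sub>R (w - q1) \<in> K" if "\<sigma> \<ge> 1" "w \<in> W" for \<sigma> w
    using that by (auto simp: K_def)
  have "convex K"
    unfolding convex_def
  proof (intro ballI allI impI)
    fix x y :: 'a and u v :: real
    assume xy: "x \<in> K" "y \<in> K" and uv: "0 \<le> u" "0 \<le> v" "u + v = 1"
    obtain \<sigma> a where a: "x = q1 + \<sigma> *\<^sub>R (a - q1)" "\<sigma> \<ge> 1" "a \<in> W" using xy by (auto simp: K_def)
    obtain \<tau> b where b: "y = q1 + \<tau> *\<^sub>R (b - q1)" "\<tau> \<ge> 1" "b \<in> W" using xy by (auto simp: K_def)
    \<comment> \<open>The rays to \<open>a\<close> and \<open>b\<close> are stretched by different
      factors, so the weights of \<open>a\<close> and \<open>b\<close> have to be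
      renormalised.\<close>
    define \<rho> where "\<rho> = u * \<sigma> + v * \<tau>"
    have "u * 1 + v * 1 \<le> \<rho>" unfolding \<rho>_def using uv a b by (intro add_mono mult_left_mono) auto
    then have \<rho>: "\<rho> \<ge> 1" using uv by simp
    define c where "c = (u * \<sigma> / \<rho>) *\<^sub>R a + (v * \<tau> / \<rho>) *\<^sub>R b"
    have "c \<in> W" unfolding c_def
    proof (rule convexD[OF wall_dims(3)[OF W] a(3) b(3)])
      show "u * \<sigma> / \<rho> + v * \<tau> / \<rho> = 1" using \<rho> by (simp add: \<rho>_def add_divide_distrib[symmetric])
    qed (use uv a b \<rho> in auto)
    moreover have "u *\<^sub>R x + v *\<^sub>R y = q1 + \<rho> *\<^sub>R (c - q1)"
    proof -
      have "\<rho> *\<^sub>R c = (u * \<sigma>) *\<^sub>R a + (v * \<tau>) *\<^sub>R b"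
        using \<rho> by (simp add: c_def scaleR_right_distrib)
      moreover have "u *\<^sub>R x + v *\<^sub>R y = (u + v) *\<^sub>R q1 + ((u * \<sigma>) *\<^sub>R a + (v * \<tau>) *\<^sub>R b) - \<rho> *\<^sub>R q1"
        unfolding a(1) b(1) \<rho>_def by (simp add: algebra_simps)
      ultimately show ?thesis using uv by (simp add: algebra_simps)
    qed
    ultimately show "u *\<^sub>R x + v *\<^sub>R y \<in> K" using KI[OF \<rho>] by simp
  qed
  define O' where "O' = rel_interior M \<inter> K"
  have cO: "convex O'" unfolding O'_def
    using \<open>convex K\<close> cellsD(6)[OF MN(1)] by (intro convex_Int convex_rel_interior)
  define \<sigma>1 where "\<sigma>1 = 1 / (1 - l)"
  have \<sigma>1: "\<sigma>1 > 1" using l01 by (simp add: \<sigma>1_def)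
  have p1eq: "p1 = q1 + \<sigma>1 *\<^sub>R (w1 - q1)"
  proof -
    have "w1 - q1 = (1 - l) *\<^sub>R (p1 - q1)" unfolding w1eq by (simp add: algebra_simps)
    then show ?thesis using l01 by (simp add: \<sigma>1_def)
  qed
  have p1O: "p1 \<in> O'" using p1 KI[of \<sigma>1 w1] \<sigma>1 w1W unfolding O'_def p1eq[symmetric] by simp
  have q1S: "q1 - w1 \<in> dirs S"
    using diff_in_dirs'[of q1 S w1] q1 w1W rel_interior_subset cellsD(8)[OF MN(2)] wall_dims(5)[OF W] by blast
  have open_O: "\<forall>\<^sub>F \<eta> in at_right 0. p1 + \<eta> *\<^sub>R v \<in> O'" if v: "v \<in> dirs S" for v
  proof -
    \<comment> \<open>The move by \<open>v\<close> splits into a change of the stretching factor, by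
      the component \<open>a\<close> along \<open>q1 - w1\<close>, and a shift of the shading point
      within \<open>W\<close>.\<close>
    obtain a where a: "v - a *\<^sub>R (q1 - w1) \<in> dirs W" using wall_split[OF W q1S q1w1 v] .
    obtain \<epsilon> where \<epsilon>: "\<epsilon> > 0" "\<forall>\<delta>. \<bar>\<delta>\<bar> \<le> \<epsilon> \<longrightarrow> w1 + \<delta> *\<^sub>R (v - a *\<^sub>R (q1 - w1)) \<in> rel_interior W"
      using rel_interior_move[OF w1 a] by blast
    have "\<forall>\<^sub>F \<eta> in at_right 0. p1 + \<eta> *\<^sub>R v \<in> rel_interior M"
      using rel_interior_move_eventually[OF p1] v cellsD(5)[OF MN(1)] by simp
    moreover have "\<forall>\<^sub>F \<eta> in at_right 0. \<eta> < \<epsilon>" using \<epsilon>(1) by (rule eventually_at_right_0_less)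
    moreover have "\<forall>\<^sub>F \<eta> in at_right 0. \<eta> < (\<sigma>1 - 1) / (\<bar>a\<bar> + 1)"
      using \<sigma>1 by (intro eventually_at_right_0_less) (simp add: add_nonneg_pos)
    ultimately show ?thesis using eventually_at_right_0_pos
    proof eventually_elim
      case (elim \<eta>)
      define \<sigma> where "\<sigma> = \<sigma>1 - \<eta> * a"
      have "\<eta> * \<bar>a\<bar> \<le> \<eta> * (\<bar>a\<bar> + 1)" using elim by simp
      also have "\<dots> < \<sigma>1 - 1" using elim(3) by (simp add: pos_less_divide_eq add_nonneg_pos)
      finally have "\<eta> * \<bar>a\<bar> < \<sigma>1 - 1" .
      moreover have "\<eta> * a \<le> \<eta> * \<bar>a\<bar>" using elim by (intro mult_left_mono) auto
      ultimately have \<sigma>: "\<sigma> \<ge> 1" by (simp add: \<sigma>_def)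
      define x where "x = w1 + (\<eta> / \<sigma>) *\<^sub>R (v - a *\<^sub>R (q1 - w1))"
      have "\<eta> / \<sigma> \<le> \<eta> / 1" using elim \<sigma> by (intro divide_left_mono) auto
      then have "\<bar>\<eta> / \<sigma>\<bar> \<le> \<epsilon>" using elim \<sigma> by simp
      then have "x \<in> W" unfolding x_def using \<epsilon>(2) rel_interior_subset by blast
      moreover have "p1 + \<eta> *\<^sub>R v = q1 + \<sigma> *\<^sub>R (x - q1)"
      proof -
        have "\<sigma> *\<^sub>R (x - q1) = \<sigma> *\<^sub>R (w1 - q1) + \<eta> *\<^sub>R (v - a *\<^sub>R (q1 - w1))"
          using \<sigma> by (simp add: x_def algebra_simps)
        then show ?thesis unfolding p1eq by (simp add: \<sigma>_def algebra_simps)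
      qed
      ultimately show ?case using KI[OF \<sigma>, of x] elim by (simp add: O'_def)
    qed
  qed
  have "\<exists>p'\<in>rel_interior M. p' \<notin> \<Union>XX \<and> closed_segment p' q1 \<inter> W \<noteq> {}"
    if XX: "finite XX" "\<And>X. X \<in> XX \<Longrightarrow> affine X \<and> aff_dim X < aff_dim S" for XX
  proof -
    \<comment> \<open>An affine set containing \<open>O'\<close> would contain two points of every
      line from \<open>p1\<close> to another point of \<open>S\<close>, hence all of
      \<open>S\<close>.\<close>
    have "\<not> O' \<subseteq> X" if X: "X \<in> XX" for X
    proof
      assume sub: "O' \<subseteq> X"
      have aX: "affine X" and dX: "aff_dim X < aff_dim S" using XX(2)[OF X] by auto
      have "S \<subseteq> X"
      proof
        fix y assume "y \<in> S"
        moreover have "p1 \<in> S" using p1 rel_interior_subset cellsD(8)[OF MN(1)] by blast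
        ultimately have "y - p1 \<in> dirs S" by (rule diff_in_dirs')
        then obtain \<eta> where \<eta>: "\<eta> > 0" "p1 + \<eta> *\<^sub>R (y - p1) \<in> O'"
          using open_O eventually_at_right_0_obtains by blast
        have "(1 - 1/\<eta>) *\<^sub>R p1 + (1/\<eta>) *\<^sub>R (p1 + \<eta> *\<^sub>R (y - p1)) \<in> X"
          using sub p1O \<eta>(2) by (intro mem_affine[OF aX]) auto
        moreover have "(1 - 1/\<eta>) *\<^sub>R p1 + (1/\<eta>) *\<^sub>R (p1 + \<eta> *\<^sub>R (y - p1)) = y"
          using \<eta>(1) by (simp add: algebra_simps)
        ultimately show "y \<in> X" by simp
      qed
      then show False using aff_dim_subset[of S X] dX by simp
    qed
    then obtain p' where p': "p' \<in> O'" "p' \<notin> \<Union>XX"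
      using convex_avoid_affine[OF XX(1) cO] p1O XX(2) by blast
    then obtain \<sigma> a where a: "p' = q1 + \<sigma> *\<^sub>R (a - q1)" "\<sigma> \<ge> 1" "a \<in> W" by (auto simp: O'_def K_def)
    have "a \<in> closed_segment p' q1"
      unfolding closed_segment_commute[of p'] closed_segment_param
      using a by (intro bexI[of _ "1/\<sigma>"]) auto
    then show ?thesis using p' a(3) by (auto simp: O'_def)
  qed
  then show ?thesis using that[OF q1] by blast
qed

end

section \<open>Convex regions\<close>

context balanced_complex
begin

lemma kept_wallsI:
  assumes "{M, N} \<in> adjacency_edges C" "{M, N} \<notin> E"
  shows "M \<inter> N \<in> kept"
proof -
  have "M \<inter> N = \<Inter>{M, N}" by simp
  then show ?thesis using assms unfolding kept_walls_def by (metis DiffI imageI)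
qed

lemma edge_cells:
  assumes "{M, N} \<in> E"
  shows "{M, N} \<in> adjacency_edges C" "M \<in> cells" "N \<in> cells"
  using assms E_subset by (auto simp: adjacency_edges_iff)

lemma rel_interior_cell_avoids_kept:
  assumes "M \<in> cells" "W \<in> kept"
  shows "rel_interior M \<inter> W = {}"
  using wall_disjoint_rel_interior[OF kept_walls_codim[OF assms(2)] assms(1)] .

text \<open>Away from \<open>z0\<close> the path runs in the interiors of \<open>N\<close> and
  \<open>N'\<close>. At \<open>z0\<close> it is in the relative interior of a wall whose edge is in
  \<open>E\<close>, and such a point lies on no kept wall.\<close>

lemma crossing_avoids_kept:
  assumes NN: "{N, N'} \<in> E" and z0: "z0 \<in> rel_interior (N \<inter> N')"
    and q1: "q1 \<in> rel_interior N'" and q0: "z0 + \<delta> *\<^sub>R (z0 - q1) \<in> rel_interior N" "\<delta> > 0"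
    and r: "- \<delta> \<le> r" "r \<le> 1"
  shows "z0 + r *\<^sub>R (q1 - z0) \<notin> \<Union>kept"
proof -
  note c = edge_cells[OF NN]
  have z0NN: "z0 \<in> N" "z0 \<in> N'" using z0 rel_interior_subset by blast+
  consider "r > 0" | "r = 0" | "r < 0" by linarith
  then show ?thesis
  proof cases
    case 1
    have "z0 - r *\<^sub>R (z0 - q1) \<in> rel_interior N'"
      using cellsD(6)[OF c(3)] z0NN q1 1 r by (intro rel_interior_convex_shrink) auto
    then show ?thesis using rel_interior_cell_avoids_kept[OF c(3)] by (auto simp: algebra_simps)
  next
    case 2
    then show ?thesis using kept_wall_at_wall[OF _ c(1) z0] NN by auto
  next
    case 3
    have "z0 - (- r / \<delta>) *\<^sub>R (z0 - (z0 + \<delta> *\<^sub>R (z0 - q1))) \<in> rel_interior N"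
      using cellsD(6)[OF c(2)] z0NN q0 3 r
      by (intro rel_interior_convex_shrink) (auto simp: field_simps)
    then have "z0 + r *\<^sub>R (q1 - z0) \<in> rel_interior N" using q0(2) by (simp add: algebra_simps)
    then show ?thesis using rel_interior_cell_avoids_kept[OF c(2)] by auto
  qed
qed

text \<open>The end point of a segment from a generic \<open>p\<close> moves along an edge of \<open>E\<close>.\<close>

lemma segment_avoids_kept_generic:
  assumes NN: "{N, N'} \<in> E" and z0: "z0 \<in> rel_interior (N \<inter> N')"
    and q1: "q1 \<in> rel_interior N'" and \<delta>: "\<delta> > 0"
    and q0def: "q0 = z0 + \<delta> *\<^sub>R (z0 - q1)" and q0: "q0 \<in> rel_interior N"
    and M: "M \<in> cells" "p \<in> rel_interior M"
    and IH: "closed_segment p q0 \<inter> \<Union>kept = {}"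
    and gen1: "\<And>A. A \<in> C \<Longrightarrow> aff_dim A < aff_dim S - 2 \<Longrightarrow> p \<notin> affine hull (insert q0 (insert q1 A))"
    and gen2: "\<And>F. F \<in> codim_faces C 2 \<Longrightarrow> \<exists>f\<in>F. p \<notin> affine hull (insert (f + (q1 - q0)) F)"
    and gen3: "\<And>F. F \<in> codim_faces C 2 \<Longrightarrow> p \<notin> affine hull (insert q0 F)"
    and gen4: "\<And>W. W \<in> kept \<Longrightarrow> p \<notin> affine hull W"
  shows "closed_segment p q1 \<inter> \<Union>kept = {}"
proof (rule ccontr)
  assume "closed_segment p q1 \<inter> \<Union>kept \<noteq> {}"
  then obtain s1 where s1: "s1 \<in> {0..1}" "p + s1 *\<^sub>R (q1 - p) \<in> \<Union>kept"
    unfolding disjoint_iff closed_segment_param by blast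
  note c = edge_cells[OF NN]
  define q where "q t = q0 + t *\<^sub>R (q1 - q0)" for t
  define g where "g t s = p + s *\<^sub>R (q t - p)" for t s
  have qS: "q t \<in> S" if "t \<in> {0..1}" for t
  proof -
    have "q0 \<in> S" "q1 \<in> S" using q0 q1 rel_interior_subset cellsD(8) c by blast+
    moreover have "q t = (1 - t) *\<^sub>R q0 + t *\<^sub>R q1" by (simp add: q_def algebra_simps)
    ultimately show ?thesis using convex_Supp that by (simp add: convex_alt)
  qed
  have q_kept: "q t \<notin> \<Union>kept" if t: "t \<in> {0..1}" for t
  proof -
    \<comment> \<open>\<open>z0\<close> divides the path from \<open>q0\<close> to \<open>q1\<close>
      in the ratio \<open>\<delta> : 1\<close>, whence this change of parameter.\<close>
    have "q t = z0 + (t * (1 + \<delta>) - \<delta>) *\<^sub>R (q1 - z0)"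
      by (simp add: q_def q0def algebra_simps)
    moreover have "- \<delta> \<le> t * (1 + \<delta>) - \<delta>" using t \<delta> by simp
    moreover have "t * (1 + \<delta>) \<le> 1 * (1 + \<delta>)" using t \<delta> by (intro mult_right_mono) auto
    ultimately show ?thesis
      using crossing_avoids_kept[OF NN z0 q1 q0[unfolded q0def] \<delta>, of "t * (1 + \<delta>) - \<delta>"] by simp
  qed
  have "continuous_on ({0..1} \<times> {0..1}) (\<lambda>(t, s). g t s)"
    unfolding g_def q_def case_prod_unfold by (intro continuous_intros)
  moreover have "g 1 s1 \<in> \<Union>kept" using s1 by (simp add: g_def q_def)
  ultimately obtain t s where ts: "t \<in> {0..1}" "s \<in> {0..1}" "g t s \<in> \<Union>kept"
    and min: "\<And>t' s'. 0 \<le> t' \<Longrightarrow> t' < t \<Longrightarrow> s' \<in> {0..1} \<Longrightarrow> g t' s' \<notin> \<Union>kept"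
    using first_hit[OF _ closed_Union_kept_walls, of 1 0 1 g 1 s1] s1(1)
    by (metis atLeastAtMost_iff order_refl zero_le_one)
  define z where "z = g t s"
  obtain W where W: "W \<in> kept" "z \<in> W" using ts(3) by (auto simp: z_def)
  have pM: "p \<in> M" using M(2) rel_interior_subset by blast
  have t0: "t > 0"
  proof (rule ccontr)
    assume "\<not> t > 0"
    then have "t = 0" using ts by auto
    then have "z \<in> closed_segment p q0"
      using ts(2) by (auto simp: z_def g_def q_def closed_segment_param)
    then show False using IH W by blast
  qed
  \<comment> \<open>Neither end of the segment can be the hit: \<open>p\<close> is inside a cell,
    and the path of the moving end avoids the kept walls.\<close>
  have "s \<noteq> 0" using W rel_interior_cell_avoids_kept[OF M(1) W(1)] M(2) by (auto simp: z_def g_def)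
  moreover have "s \<noteq> 1" using W q_kept[OF ts(1)] by (auto simp: z_def g_def)
  ultimately have s: "0 < s" "s < 1" using ts(2) by auto
  define d where "d = z - p"
  define e where "e = q1 - q0"
  have dq: "d = s *\<^sub>R (q t - p)" by (simp add: d_def z_def g_def)
  have pz: "(1 - s) *\<^sub>R (p - z) = - (s *\<^sub>R (q t - z))"
    by (simp add: z_def g_def algebra_simps)
  show False
  proof (rule no_first_hit[OF W, of d e])
    have "q t - (1 - s) *\<^sub>R (q t - p) \<in> rel_interior S"
      using convex_Supp M rel_interior_cell_subset[OF M(1)] qS[OF ts(1)] s
      by (intro rel_interior_convex_shrink) auto
    moreover have "q t - (1 - s) *\<^sub>R (q t - p) = z" by (simp add: z_def g_def algebra_simps)
    ultimately show zS: "z \<in> rel_interior S" by simp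
    have "z \<in> S" using zS rel_interior_subset by blast
    moreover have "p \<in> S" using pM cellsD(8)[OF M(1)] by blast
    ultimately show "d \<in> dirs S" unfolding d_def by (rule diff_in_dirs')
    have "q0 \<in> S" "q1 \<in> S" using qS[of 0] qS[of 1] by (auto simp: q_def)
    then show "e \<in> dirs S" unfolding e_def by (intro diff_in_dirs')
  next
    fix A assume A: "A \<in> C" "z \<in> A"
    \<comment> \<open>As \<open>p\<close> lies on the line through \<open>z\<close> and
      \<open>q t\<close>, it is in the hull of \<open>q0\<close>, \<open>q1\<close> and any face
      through \<open>z\<close>; genericity forbids this for small faces.\<close>
    let ?H = "insert q0 (insert q1 A)"
    have "q t - z \<in> dirs ?H"
    proof -
      have "q0 - z \<in> dirs ?H" "q1 - q0 \<in> dirs ?H" using A by (auto intro!: diff_in_dirs')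
      then have "(q0 - z) + t *\<^sub>R (q1 - q0) \<in> dirs ?H" by (intro dirs_add dirs_scale)
      then show ?thesis by (simp add: q_def algebra_simps)
    qed
    then have "(1 - s) *\<^sub>R (p - z) \<in> dirs ?H" unfolding pz by (intro dirs_minus dirs_scale)
    then have "p - z \<in> dirs ?H" using s by (simp add: dirs_scale_iff)
    then have "p \<in> affine hull ?H" using A affine_hull_iff_dirs[of z ?H p] by simp
    then show "aff_dim S - 2 \<le> aff_dim A" using gen1[OF A(1)] by force
  next
    fix F a b assume F: "F \<in> codim_faces C 2" "z \<in> F" and ab: "a *\<^sub>R d + b *\<^sub>R e \<in> dirs F"
    obtain f where f: "f \<in> F" "p \<notin> affine hull (insert (f + (q1 - q0)) F)" using gen2[OF F(1)] by blast
    have a0: "a = 0"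
    proof (rule ccontr)
      assume "a \<noteq> 0"
      \<comment> \<open>The extra point adjoins \<open>e\<close> to the directions of
        \<open>F\<close>, so \<open>d\<close>, and with it \<open>p\<close>, would lie in the
        excluded hull.\<close>
      let ?H = "insert (f + (q1 - q0)) F"
      have "(f + (q1 - q0)) - f \<in> dirs ?H" using f(1) by (intro diff_in_dirs') auto
      then have "e \<in> dirs ?H" by (simp add: e_def)
      moreover have "a *\<^sub>R d + b *\<^sub>R e \<in> dirs ?H" using ab dirs_mono[of F ?H] by blast
      ultimately have "a *\<^sub>R d + b *\<^sub>R e - b *\<^sub>R e \<in> dirs ?H" by (intro dirs_diff dirs_scale)
      then have "d \<in> dirs ?H" using \<open>a \<noteq> 0\<close> by (simp add: dirs_scale_iff)
      then have "p - z \<in> dirs ?H" using dirs_minus[of d ?H] by (simp add: d_def)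
      then show False using f(2) F(2) affine_hull_iff_dirs[of z ?H p] by simp
    qed
    moreover have "b = 0"
    proof (rule ccontr)
      assume "b \<noteq> 0"
      \<comment> \<open>Here \<open>e\<close> is a direction of \<open>F\<close> itself, so the hull
        of \<open>F\<close> and \<open>q0\<close> contains \<open>q t\<close>, and with it
        \<open>p\<close>.\<close>
      let ?H = "insert q0 F"
      have "e \<in> dirs F" using ab a0 \<open>b \<noteq> 0\<close> by (simp add: dirs_scale_iff)
      then have "e \<in> dirs ?H" using dirs_mono[of F ?H] by blast
      moreover have "q0 - z \<in> dirs ?H" using F(2) by (intro diff_in_dirs') auto
      ultimately have "(q0 - z) + t *\<^sub>R e \<in> dirs ?H" by (intro dirs_add dirs_scale)
      then have "q t - z \<in> dirs ?H" by (simp add: q_def e_def algebra_simps)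
      then have "(1 - s) *\<^sub>R (p - z) \<in> dirs ?H" unfolding pz by (intro dirs_minus dirs_scale)
      then have "p - z \<in> dirs ?H" using s by (simp add: dirs_scale_iff)
      then show False using gen3[OF F(1)] F(2) affine_hull_iff_dirs[of z ?H p] by simp
    qed
    ultimately show "a = 0 \<and> b = 0" by simp
  next
    show "d \<notin> dirs W"
      using gen4[OF W(1)] affine_hull_iff_dirs[OF W(2), of p] dirs_minus[of d W] by (auto simp: d_def)
  next
    fix W' a b
    assume W': "W' \<in> kept" and b: "(b::real) > 0"
    show "\<not> (\<forall>\<^sub>F \<delta> in at_right 0. z + \<delta> *\<^sub>R (a *\<^sub>R d - b *\<^sub>R e) \<in> W')"
    proof
      assume ev: "\<forall>\<^sub>F \<delta> in at_right 0. z + \<delta> *\<^sub>R (a *\<^sub>R d - b *\<^sub>R e) \<in> W'"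
      have lim: "((\<lambda>\<delta>. s * (1 + \<delta> * a)) \<longlongrightarrow> s * (1 + 0 * a)) (at_right 0)"
        by (intro tendsto_intros)
      have "\<forall>\<^sub>F \<delta> in at_right 0. s / 2 < s * (1 + \<delta> * a)"
        using order_tendstoD(1)[OF lim, of "s/2"] s by simp
      moreover have "\<forall>\<^sub>F \<delta> in at_right 0. s * (1 + \<delta> * a) < 1"
        using order_tendstoD(2)[OF lim, of 1] s by simp
      moreover have "\<forall>\<^sub>F \<delta> in at_right 0. \<delta> < t * (s / 2) / b"
        using t0 s b by (intro eventually_at_right_0_less) simp
      ultimately have "\<forall>\<^sub>F \<delta> in at_right (0::real). False"
        using ev eventually_at_right_0_pos
      proof eventually_elim
        case (elim \<eta>)
        \<comment> \<open>At parameter \<open>s'\<close> a displacement of the end counts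
          \<open>s'\<close> times. So the ray is stretched by \<open>1 + \<eta> * a\<close> and time
          is set back by \<open>\<eta> * b / s'\<close>; keeping \<open>s'\<close> above
          \<open>s / 2\<close> keeps the time nonnegative.\<close>
        define s' where "s' = s * (1 + \<eta> * a)"
        define t' where "t' = t - \<eta> * b / s'"
        have s': "s' > s / 2" "s' < 1" "s' > 0" using elim s by (auto simp: s'_def)
        have "\<eta> * b / s' > 0" using elim b s' by simp
        moreover have "\<eta> * b / s' \<le> t"
        proof -
          have "\<eta> * b \<le> t * (s / 2)" using elim(3) b by (simp add: pos_less_divide_eq)
          also have "\<dots> \<le> t * s'" using t0 s' by simp
          finally show ?thesis using s' by (simp add: pos_divide_le_eq)
        qed
        ultimately have "0 \<le> t'" "t' < t" by (auto simp: t'_def)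
        then have "g t' s' \<notin> \<Union>kept" using min s' by simp
        moreover have "g t' s' = z + \<eta> *\<^sub>R (a *\<^sub>R d - b *\<^sub>R e)"
        proof -
          have "g t' s' = p + s' *\<^sub>R (q t - p) - (s' * (\<eta> * b / s')) *\<^sub>R e"
            by (simp add: g_def t'_def q_def e_def algebra_simps)
          also have "s' * (\<eta> * b / s') = \<eta> * b" using s' by simp
          also have "p + s' *\<^sub>R (q t - p) = z + (\<eta> * a) *\<^sub>R d"
            unfolding dq by (simp add: s'_def z_def g_def algebra_simps)
          finally show ?thesis by (simp add: algebra_simps)
        qed
        ultimately show ?case using elim W' by auto
      qed
      then show False by simp
    qed
  qed
qed

text \<open>Induction along a path of \<open>E\<close>. The end points stay arbitrary, because the
  previous end \<open>q0\<close> is constructed from the new end \<open>q1\<close> and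
  \<open>p\<close> is replaced by a generic point; the hypothesis for that pair starts the
  pivot.\<close>

lemma segment_avoids_kept:
  assumes "M \<in> cells" "linked E M N" "p \<in> rel_interior M" "q \<in> rel_interior N"
  shows "closed_segment p q \<inter> \<Union>kept = {}"
  using assms(2-4) unfolding linked_def
proof (induction arbitrary: p q rule: rtranclp_induct)
  case base
  then have "closed_segment p q \<subseteq> rel_interior M"
    using convex_rel_interior cellsD(6)[OF assms(1)] by (intro closed_segment_subset) auto
  then show ?case using rel_interior_cell_avoids_kept[OF assms(1)] by blast
next
  case (step N N')
  note c = edge_cells[OF step.hyps(2)]
  show ?case
  proof (rule ccontr)
    assume "closed_segment p q \<inter> \<Union>kept \<noteq> {}"
    then obtain W z where W: "W \<in> kept" "z \<in> closed_segment p q" "z \<in> W" by blast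
    obtain q1 where q1: "q1 \<in> rel_interior N'"
      and gen: "\<And>XX. finite XX \<Longrightarrow> (\<And>X. X \<in> XX \<Longrightarrow> affine X \<and> aff_dim X < aff_dim S) \<Longrightarrow>
       \<exists>p'\<in>rel_interior M. p' \<notin> \<Union>XX \<and> closed_segment p' q1 \<inter> W \<noteq> {}"
      using segment_perturb[OF assms(1) c(3) kept_walls_codim[OF W(1)] step.prems W(2,3)] by blast
    obtain z0 where z0: "z0 \<in> rel_interior (N \<inter> N')"
      using wall_rel_interior_obtains c(1) by (auto simp: adjacency_edges_iff)
    obtain \<delta> where \<delta>: "\<delta> > 0" "z0 + \<delta> *\<^sub>R (z0 - q1) \<in> rel_interior N"
      using eventually_at_right_0_obtains[OF opposite_sides[OF c(1) z0 q1]] .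
    define q0 where "q0 = z0 + \<delta> *\<^sub>R (z0 - q1)"
    \<comment> \<open>All these hulls have smaller dimension than \<open>S\<close>: two points are
      added to faces of codimension above 2, one to faces of codimension 2, none to walls. The
      chosen base point of \<open>F\<close> is arbitrary, as only the direction
      \<open>q1 - q0\<close> counts.\<close>
    define XX where "XX = (\<lambda>A. affine hull (insert q0 (insert q1 A))) ` {A \<in> C. aff_dim A < aff_dim S - 2}
      \<union> (\<lambda>F. affine hull (insert ((SOME f. f \<in> F) + (q1 - q0)) F)) ` codim_faces C 2
      \<union> (\<lambda>F. affine hull (insert q0 F)) ` codim_faces C 2 \<union> (\<lambda>W. affine hull W) ` kept"
    have "finite XX" unfolding XX_def using finite_C finite_codim finite_kept_walls by simp
    moreover have "affine X \<and> aff_dim X < aff_dim S" if X: "X \<in> XX" for X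
    proof -
      have i: "aff_dim (insert a F) < aff_dim S" if "F \<in> codim_faces C 2" for a F
        using aff_dim_insert_le[of a F] that by (simp add: codim_faces_def)
      have ii: "aff_dim (insert q0 (insert q1 A)) < aff_dim S" if "aff_dim A < aff_dim S - 2" for A
        using aff_dim_insert_le[of q0 "insert q1 A"] aff_dim_insert_le[of q1 A] that by linarith
      have iii: "aff_dim W < aff_dim S" if "W \<in> kept" for W
        using kept_walls_codim[OF that] by (simp add: codim_faces_def)
      show ?thesis using X i ii iii unfolding XX_def by (auto simp: aff_dim_affine_hull)
    qed
    ultimately obtain p1 where p1: "p1 \<in> rel_interior M" "p1 \<notin> \<Union>XX" "closed_segment p1 q1 \<inter> W \<noteq> {}"
      using gen by blast
    have "closed_segment p1 q1 \<inter> \<Union>kept = {}"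
    proof (rule segment_avoids_kept_generic[OF step.hyps(2) z0 q1 \<delta>(1) q0_def _ assms(1) p1(1)])
      show "q0 \<in> rel_interior N" using \<delta> by (simp add: q0_def)
      then show "closed_segment p1 q0 \<inter> \<Union>kept = {}" using step.IH p1(1) by blast
      show "\<exists>f\<in>F. p1 \<notin> affine hull (insert (f + (q1 - q0)) F)" if F: "F \<in> codim_faces C 2" for F
      proof (rule bexI)
        show "(SOME f. f \<in> F) \<in> F" using codim2_dims(2)[OF F] by (simp add: some_in_eq)
        show "p1 \<notin> affine hull (insert ((SOME f. f \<in> F) + (q1 - q0)) F)"
          using p1(2) F unfolding XX_def by blast
      qed
    qed (use p1(2) in \<open>unfold XX_def, blast\<close>)+
    then show False using p1(3) W(1) by blast
  qed
qed

text \<open>The end in the region may lie on the boundary of its cell. It is pushed inside, and the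
  other end moves along so that the point at parameter \<open>s\<close> stays where it is.\<close>

lemma segment_region_avoids_kept:
  assumes M: "M \<in> cells" "m \<in> rel_interior M" and z: "z \<in> region C E M" and s: "0 \<le> s" "s < 1"
  shows "m + s *\<^sub>R (z - m) \<notin> \<Union>kept"
proof
  assume "m + s *\<^sub>R (z - m) \<in> \<Union>kept"
  then obtain W where W: "W \<in> kept" "m + s *\<^sub>R (z - m) \<in> W" by blast
  obtain N where N: "N \<in> cells" "linked E M N" "z \<in> N" using z by (auto simp: region_def)
  obtain n where n: "n \<in> rel_interior N" using rel_interior_cell_nonempty[OF N(1)] by blast
  have nN: "n \<in> N" using n rel_interior_subset by blast
  have v: "n - z \<in> dirs S" using diff_in_dirs'[OF nN N(3)] cellsD(5)[OF N(1)] by simp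
  \<comment> \<open>The coefficient \<open>c = - (s / (1 - s))\<close> solves
    \<open>(1 - s) * c + s = 0\<close>, which keeps the point at parameter \<open>s\<close>
    fixed.\<close>
  have "\<forall>\<^sub>F \<eta> in at_right 0. m + \<eta> *\<^sub>R (- (s / (1 - s)) *\<^sub>R (n - z)) \<in> rel_interior M"
    using rel_interior_move_eventually[OF M(2), of "- (s / (1 - s)) *\<^sub>R (n - z)"]
      cellsD(5)[OF M(1)] dirs_scale[OF v] by blast
  moreover have "\<forall>\<^sub>F \<eta> in at_right 0. \<eta> < (1::real)" by (rule eventually_at_right_0_less) simp
  ultimately have "\<forall>\<^sub>F \<eta> in at_right (0::real). False"
    using eventually_at_right_0_pos
  proof eventually_elim
    case (elim \<eta>)
    define m' where "m' = m + \<eta> *\<^sub>R (- (s / (1 - s)) *\<^sub>R (n - z))"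
    define z' where "z' = z - \<eta> *\<^sub>R (z - n)"
    have "z' \<in> rel_interior N" unfolding z'_def
      using cellsD(6)[OF N(1)] n N(3) elim by (intro rel_interior_convex_shrink) auto
    then have "closed_segment m' z' \<inter> \<Union>kept = {}"
      using segment_avoids_kept[OF M(1) N(2)] elim(1) by (simp add: m'_def)
    moreover have "m' + s *\<^sub>R (z' - m') = m + s *\<^sub>R (z - m)"
    proof -
      define k where "k = s / (1 - s)"
      have "m' + s *\<^sub>R (z' - m') = m + s *\<^sub>R (z - m) + (s * \<eta>) *\<^sub>R (n - z) - (\<eta> * ((1 - s) * k)) *\<^sub>R (n - z)"
        unfolding m'_def z'_def k_def[symmetric] by (simp add: algebra_simps)
      also have "(1 - s) * k = s" using s by (simp add: k_def)
      finally show ?thesis by (simp add: algebra_simps)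
    qed
    then have "m + s *\<^sub>R (z - m) \<in> closed_segment m' z'"
      unfolding closed_segment_param using s by (intro bexI[of _ s]) auto
    ultimately show ?case using W by blast
  qed
  then show False by simp
qed

lemma closed_region: "closed (region C E M)"
  unfolding region_def using finite_codim[of 0] cellsD(7) by (intro closed_Union) auto

lemma region_subset: "region C E M \<subseteq> S"
  using cellsD(8) by (auto simp: region_def)

lemma cell_subset_region:
  assumes "N \<in> cells" "linked E M N"
  shows "N \<subseteq> region C E M"
  using assms by (auto simp: region_def)

text \<open>After a small generic move of its end, the segment meets no face of codimension 2 or
  more. It can then leave the class of \<open>M\<close> only through a wall whose edge is not in
  \<open>E\<close>, that is, through a kept wall.\<close>

lemma segment_in_region:
  assumes M: "M \<in> cells" "p \<in> rel_interior M" and z: "z \<in> S"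
    and avoid: "closed_segment p z \<inter> \<Union>kept = {}"
  shows "z \<in> region C E M"
proof -
  obtain N where N: "N \<in> cells" "z \<in> N" using cell_at[OF z] .
  \<comment> \<open>Moving the end \<open>z\<close> by less than this distance keeps the segment off
    the kept walls.\<close>
  obtain e where e: "e > 0" "\<And>x y. x \<in> closed_segment p z \<Longrightarrow> y \<in> \<Union>kept \<Longrightarrow> e \<le> dist x y"
    using separate_compact_closed[OF compact_segment closed_Union_kept_walls avoid] by blast
  let ?O = "rel_interior N \<inter> ball z e"
  let ?XX = "(\<lambda>A. affine hull (insert p A)) ` {A \<in> C. aff_dim A \<le> aff_dim S - 2}"
  have "affine X \<and> aff_dim X < aff_dim S" if X: "X \<in> ?XX" for X
  proof -
    have "aff_dim (insert p A) < aff_dim S" if "aff_dim A \<le> aff_dim S - 2" for A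
      using aff_dim_insert_le[of p A] that by linarith
    then show ?thesis using X by (auto simp: aff_dim_affine_hull)
  qed
  then obtain z' where z': "z' \<in> ?O" "z' \<notin> \<Union>?XX"
    using generic_point[OF openin_rel_interior_cell_ball[OF N e(1)], of ?XX] finite_C by auto
  have z'N: "z' \<in> N" using z' rel_interior_subset by blast
  have avoid': "x \<notin> \<Union>kept" if x: "x \<in> closed_segment p z'" for x
  proof
    assume k: "x \<in> \<Union>kept"
    obtain s where s: "s \<in> {0..1}" "x = p + s *\<^sub>R (z' - p)" using x by (auto simp: closed_segment_param)
    define y where "y = p + s *\<^sub>R (z - p)"
    have "y \<in> closed_segment p z" using s by (auto simp: y_def closed_segment_param)
    then have "e \<le> dist y x" using e(2) k by blast
    also have "dist y x = s * dist z z'"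
    proof -
      have "y - x = s *\<^sub>R (z - z')" by (simp add: y_def s(2) algebra_simps)
      then show ?thesis using s(1) by (simp add: dist_norm)
    qed
    also have "\<dots> \<le> 1 * dist z z'" using s(1) by (intro mult_right_mono) auto
    also have "\<dots> < e" using z' by simp
    finally show False by simp
  qed
  have avoid2: "x \<notin> A" if x: "x \<in> closed_segment p z'" and A: "A \<in> C" "aff_dim A \<le> aff_dim S - 2" for x A
  proof
    assume xA: "x \<in> A"
    obtain s where s: "s \<in> {0..1}" "x = p + s *\<^sub>R (z' - p)" using x by (auto simp: closed_segment_param)
    show False
    proof (cases "s = 0")
      case True
      then have "M = A" using cell_rel_interior[OF M(1) A(1) M(2)] xA s by simp
      then show False using A(2) cellsD(3)[OF M(1)] by simp
    next
      case False
      let ?H = "insert p A"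
      have "x - p \<in> dirs ?H" using xA by (intro diff_in_dirs') auto
      then have "z' - p \<in> dirs ?H" using False s(2) by (simp add: dirs_scale_iff)
      then have "z' \<in> affine hull ?H" using affine_hull_iff_dirs[of p ?H z'] by simp
      then show False using z'(2) A by blast
    qed
  qed
  have "linked E M N"
  proof (rule ccontr)
    assume nl: "\<not> linked E M N"
    \<comment> \<open>Two closed sets that cover the connected segment and both meet it have a
      common point on it; there two cells of different classes share a wall.\<close>
    define U where "U = region C E M"
    define V where "V = \<Union>{K \<in> cells. \<not> linked E M K}"
    have "closed V" unfolding V_def using finite_codim[of 0] cellsD(7) by (intro closed_Union) auto
    moreover have "closed U" unfolding U_def by (rule closed_region)
    moreover have "closed_segment p z' \<subseteq> U \<union> V"
    proof -
      have "p \<in> S" "z' \<in> S" using M N z'N rel_interior_subset cellsD(8) by blast+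
      then have "closed_segment p z' \<subseteq> S" using convex_Supp by (simp add: closed_segment_subset)
      also have "S \<subseteq> U \<union> V" unfolding S_eq_Union_cells U_def V_def region_def by blast
      finally show ?thesis .
    qed
    moreover have "p \<in> U" using M rel_interior_subset linked_refl unfolding U_def region_def by blast
    moreover have "z' \<in> V" using N z'N nl by (auto simp: V_def)
    moreover have "p \<in> closed_segment p z'" "z' \<in> closed_segment p z'" by auto
    moreover have "connected (closed_segment p z')" by simp
    ultimately obtain x where x: "x \<in> closed_segment p z'" "x \<in> U" "x \<in> V"
      unfolding connected_closed by blast
    obtain K L where KL: "K \<in> cells" "linked E M K" "x \<in> K" "L \<in> cells" "\<not> linked E M L" "x \<in> L"
      using x unfolding U_def V_def region_def by blast
    have f: "K \<inter> L face_of K" using Int_face_C(1) KL cellsD(1) by blast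
    have "K \<inter> L \<in> C" using face_C[OF cellsD(1)[OF KL(1)] f] KL by blast
    have "K \<inter> L \<noteq> K" using cell_subset[OF KL(1) cellsD(1)[OF KL(4)]] KL by blast
    then have "aff_dim (K \<inter> L) < aff_dim S"
      using face_of_aff_dim_lt[OF cellsD(6)[OF KL(1)] f] cellsD(3)[OF KL(1)] by simp
    moreover have "\<not> aff_dim (K \<inter> L) \<le> aff_dim S - 2" using avoid2[OF x(1) \<open>K \<inter> L \<in> C\<close>] KL by blast
    ultimately have "K \<inter> L \<in> codim_faces C 1" using \<open>K \<inter> L \<in> C\<close> KL by (auto simp: codim_faces_def)
    then have "{K, L} \<in> adjacency_edges C" using KL by (simp add: adjacency_edges_iff)
    moreover have "{K, L} \<notin> E" using KL linked_trans linked_edge by metis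
    ultimately have "K \<inter> L \<in> kept" by (intro kept_wallsI)
    then show False using avoid'[OF x(1)] KL by blast
  qed
  then show ?thesis using N by (auto simp: region_def)
qed

text \<open>Both points are pushed into the interiors of linked cells. The segment between the new
  points avoids the kept walls and so stays in the region, and closedness gives the limit.\<close>

lemma convex_region:
  assumes M: "M \<in> cells"
  shows "convex (region C E M)"
proof (rule convexI)
  fix x y and u v :: real
  assume xy: "x \<in> region C E M" "y \<in> region C E M" and uv: "0 \<le> u" "0 \<le> v" "u + v = 1"
  obtain K where K: "K \<in> cells" "linked E M K" "x \<in> K" using xy by (auto simp: region_def)
  obtain L where L: "L \<in> cells" "linked E M L" "y \<in> L" using xy by (auto simp: region_def)
  have KL: "linked E K L" using K L linked_sym linked_trans by metis
  obtain k where k: "k \<in> rel_interior K" using rel_interior_cell_nonempty[OF K(1)] by blast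
  obtain l where l: "l \<in> rel_interior L" using rel_interior_cell_nonempty[OF L(1)] by blast
  define h where "h \<eta> = u *\<^sub>R (x - \<eta> *\<^sub>R (x - k)) + v *\<^sub>R (y - \<eta> *\<^sub>R (y - l))" for \<eta>
  have "\<forall>\<^sub>F \<eta> in at_right 0. \<eta> < (1::real)" by (rule eventually_at_right_0_less) simp
  then have "\<forall>\<^sub>F \<eta> in at_right 0. h \<eta> \<in> region C E M" using eventually_at_right_0_pos
  proof eventually_elim
    case (elim \<eta>)
    have x': "x - \<eta> *\<^sub>R (x - k) \<in> rel_interior K"
      using cellsD(6)[OF K(1)] k K(3) elim by (intro rel_interior_convex_shrink) auto
    have y': "y - \<eta> *\<^sub>R (y - l) \<in> rel_interior L"
      using cellsD(6)[OF L(1)] l L(3) elim by (intro rel_interior_convex_shrink) auto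
    have hseg: "h \<eta> \<in> closed_segment (x - \<eta> *\<^sub>R (x - k)) (y - \<eta> *\<^sub>R (y - l))"
    proof -
      have u: "u = 1 - v" using uv by simp
      show ?thesis unfolding in_segment(1) h_def u using uv by (intro exI[of _ v]) simp
    qed
    then have sub: "closed_segment (x - \<eta> *\<^sub>R (x - k)) (h \<eta>) \<subseteq> closed_segment (x - \<eta> *\<^sub>R (x - k)) (y - \<eta> *\<^sub>R (y - l))"
      by (intro closed_segment_subset convex_closed_segment) simp_all
    have "h \<eta> \<in> S"
    proof -
      have "x - \<eta> *\<^sub>R (x - k) \<in> S" "y - \<eta> *\<^sub>R (y - l) \<in> S"
        using x' y' rel_interior_subset cellsD(8) K L by blast+
      then show ?thesis using hseg convex_Supp closed_segment_subset by blast
    qed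
    moreover have "closed_segment (x - \<eta> *\<^sub>R (x - k)) (h \<eta>) \<inter> \<Union>kept = {}"
      using segment_avoids_kept[OF K(1) KL x' y'] sub by blast
    ultimately have "h \<eta> \<in> region C E K" using segment_in_region[OF K(1) x'] by blast
    then show ?case using region_eq[OF K(2)] by metis
  qed
  moreover have "(h \<longlongrightarrow> h 0) (at_right 0)"
    unfolding h_def by (intro tendsto_intros)
  ultimately have "h 0 \<in> region C E M"
    using Lim_in_closed_set[OF closed_region] trivial_limit_at_right_real by blast
  then show "u *\<^sub>R x + v *\<^sub>R y \<in> region C E M" by (simp add: h_def)
qed

lemma cell_in_region:
  assumes "N \<in> cells" "N \<subseteq> region C E M"
  shows "linked E M N"
proof -
  obtain n where n: "n \<in> rel_interior N" using rel_interior_cell_nonempty[OF assms(1)] by blast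
  then have "n \<in> region C E M" using assms(2) rel_interior_subset by blast
  then obtain K where K: "K \<in> cells" "linked E M K" "n \<in> K" by (auto simp: region_def)
  then have "N = K" using cell_rel_interior[OF assms(1) cellsD(1)[OF K(1)] n] by simp
  then show ?thesis using K by simp
qed

text \<open>A kept wall cannot separate linked cells, since a segment straight through its relative
  interior would hit it. Hence the coarsening acquires no edges beyond \<open>E\<close>.\<close>

lemma linked_adjacent:
  assumes adj: "{M, N} \<in> adjacency_edges C" and "linked E M N"
  shows "{M, N} \<in> E"
proof (rule ccontr)
  assume "{M, N} \<notin> E"
  then have kW: "M \<inter> N \<in> kept" using adj by (intro kept_wallsI)
  have c: "M \<in> cells" "N \<in> cells" "M \<inter> N \<in> codim_faces C 1" using adj by (auto simp: adjacency_edges_iff)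
  obtain z where z: "z \<in> rel_interior (M \<inter> N)" using wall_rel_interior_obtains[OF c(3)] .
  obtain q where q: "q \<in> rel_interior N" using rel_interior_cell_nonempty[OF c(2)] by blast
  obtain \<delta> where \<delta>: "\<delta> > 0" "z + \<delta> *\<^sub>R (z - q) \<in> rel_interior M"
    using eventually_at_right_0_obtains[OF opposite_sides[OF adj z q]] .
  \<comment> \<open>\<open>z\<close> divides the segment in the ratio
    \<open>\<delta> : 1\<close>.\<close>
  have "z = (z + \<delta> *\<^sub>R (z - q)) + (\<delta> / (1 + \<delta>)) *\<^sub>R (q - (z + \<delta> *\<^sub>R (z - q)))"
  proof -
    have "q - (z + \<delta> *\<^sub>R (z - q)) = (1 + \<delta>) *\<^sub>R (q - z)" by (simp add: algebra_simps)
    moreover have "(\<delta> / (1 + \<delta>)) *\<^sub>R (1 + \<delta>) *\<^sub>R (q - z) = \<delta> *\<^sub>R (q - z)" using \<delta>(1) by simp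
    ultimately show ?thesis by (simp add: algebra_simps)
  qed
  moreover have "\<delta> / (1 + \<delta>) \<in> {0..1}" using \<delta>(1) by (simp add: field_simps)
  ultimately have "z \<in> closed_segment (z + \<delta> *\<^sub>R (z - q)) q" unfolding closed_segment_param by blast
  moreover have "z \<in> M \<inter> N" using z rel_interior_subset by blast
  ultimately show False using segment_avoids_kept[OF c(1) assms(2) \<delta>(2) q] kW by blast
qed

end

section \<open>Intersections of regions\<close>

lemma closed_half_open_segment:
  fixes R :: "'a::euclidean_space set"
  assumes "closed R" "\<And>s. 0 < s \<Longrightarrow> s < 1 \<Longrightarrow> y + s *\<^sub>R (z - y) \<in> R"
  shows "z \<in> R"
proof -
  define h where "h \<eta> = y + (1 - \<eta>) *\<^sub>R (z - y)" for \<eta> :: real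
  have "\<forall>\<^sub>F \<eta> in at_right 0. \<eta> < (1::real)" by (rule eventually_at_right_0_less) simp
  then have "\<forall>\<^sub>F \<eta> in at_right 0. h \<eta> \<in> R" using eventually_at_right_0_pos
  proof eventually_elim
    case (elim \<eta>)
    then show ?case unfolding h_def by (intro assms(2)) auto
  qed
  moreover have "(h \<longlongrightarrow> h 0) (at_right 0)"
    unfolding h_def by (intro tendsto_intros)
  ultimately have "h 0 \<in> R"
    using Lim_in_closed_set[OF assms(1)] trivial_limit_at_right_real by blast
  then show ?thesis by (simp add: h_def)
qed

text \<open>The finitely many faces that miss \<open>P\<close> are closed, so they stay at a
  positive distance from it.\<close>

lemma (in convex_complex) compact_local_radius:
  assumes "compact P"
  obtains r where "r > 0" "\<And>A x y. A \<in> C \<Longrightarrow> x \<in> P \<Longrightarrow> y \<in> A \<Longrightarrow> dist x y < r \<Longrightarrow> A \<inter> P \<noteq> {}"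
proof -
  define V where "V = \<Union>{A \<in> C. A \<inter> P = {}}"
  have "closed V" unfolding V_def using finite_C closed_C by (intro closed_Union) auto
  moreover have "P \<inter> V = {}" unfolding V_def by blast
  ultimately obtain r where r: "r > 0" "\<forall>x\<in>P. \<forall>y\<in>V. r \<le> dist x y"
    using separate_compact_closed[OF assms] by metis
  have "A \<inter> P \<noteq> {}" if A: "A \<in> C" "x \<in> P" "y \<in> A" "dist x y < r" for A x y
  proof
    assume "A \<inter> P = {}"
    then have "y \<in> V" using A unfolding V_def by blast
    then show False using r(2) A(2,4) by force
  qed
  then show ?thesis using that[OF r(1)] by metis
qed

lemma (in convex_complex) local_radius:
  obtains r where "r > 0" "\<And>A y. A \<in> C \<Longrightarrow> y \<in> A \<Longrightarrow> dist c y < r \<Longrightarrow> c \<in> A"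
proof (rule compact_local_radius[OF compact_sing[of c]])
  fix r :: real
  assume r: "r > 0" "\<And>A x y. A \<in> C \<Longrightarrow> x \<in> {c} \<Longrightarrow> y \<in> A \<Longrightarrow> dist x y < r \<Longrightarrow> A \<inter> {c} \<noteq> {}"
  show thesis
  proof (rule that[OF r(1)])
    show "c \<in> A" if "A \<in> C" "y \<in> A" "dist c y < r" for A y using r(2)[of A c y] that by simp
  qed
qed

context balanced_complex
begin

text \<open>Otherwise translate a segment parallel to \<open>b - a\<close> from the interior of the region towards
  \<open>W\<close>, through a generic point near \<open>c\<close>.  Near its two ends every face of the complex contains
  both \<open>c\<close> and a second point of the line through \<open>a\<close> and \<open>b\<close>, so no transversal wall can enter
  there.\<close>

lemma kept_wall_parallel:
  assumes M: "M \<in> cells" and ab: "a \<in> region C E M" "b \<in> region C E M"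
    and c: "c = a + l *\<^sub>R (b - a)" "0 < l" "l < 1" and W: "W \<in> kept" "c \<in> W"
  shows "b - a \<in> dirs W"
proof (rule ccontr)
  assume nW: "b - a \<notin> dirs W"
  note Wc = kept_walls_codim[OF W(1)]
  note convU = convex_region[OF M]
  obtain r where r: "r > 0" "\<And>A y. A \<in> C \<Longrightarrow> y \<in> A \<Longrightarrow> dist c y < r \<Longrightarrow> c \<in> A"
    using local_radius[of c] by blast
  \<comment> \<open>The first two bounds keep \<open>c + \<tau> *\<^sub>R u\<close> between
    \<open>a\<close> and \<open>b\<close> for \<open>\<bar>\<tau>\<bar> \<le> 2\<close>; the third
    makes \<open>u\<close> so short that every face met during the sweep contains
    \<open>c\<close>.\<close>
  define \<rho> where "\<rho> = min (min (l / 2) ((1 - l) / 2)) (r / (norm (b - a) + 1))"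
  have \<rho>: "\<rho> > 0" using c r by (simp add: \<rho>_def add_nonneg_pos)
  define u where "u = \<rho> *\<^sub>R (b - a)"
  have uW: "u \<notin> dirs W" using nW \<rho> by (simp add: u_def dirs_scale_iff)
  have u_norm: "norm u < r"
  proof -
    have "\<rho> \<le> r / (norm (b - a) + 1)" by (simp add: \<rho>_def)
    then have "\<rho> * (norm (b - a) + 1) \<le> r" by (simp add: pos_le_divide_eq add_nonneg_pos)
    moreover have "norm u = \<rho> * norm (b - a)" using \<rho> by (simp add: u_def)
    ultimately show ?thesis using \<rho> by (simp add: distrib_left)
  qed
  have lineU: "c + \<tau> *\<^sub>R u \<in> region C E M" if "\<bar>\<tau>\<bar> \<le> 2" for \<tau>
  proof -
    have "\<tau> * \<rho> \<le> 2 * \<rho>" "- 2 * \<rho> \<le> \<tau> * \<rho>" using that \<rho> by (intro mult_right_mono; simp)+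
    moreover have "\<rho> \<le> l / 2" "\<rho> \<le> (1 - l) / 2"
      unfolding \<rho>_def by (intro min.coboundedI1 min.cobounded1 min.cobounded2)+
    ultimately have "0 \<le> l + \<tau> * \<rho>" "l + \<tau> * \<rho> \<le> 1" by (auto simp: field_simps)
    then have "(1 - (l + \<tau> * \<rho>)) *\<^sub>R a + (l + \<tau> * \<rho>) *\<^sub>R b \<in> region C E M"
      using convU ab by (simp add: convex_alt)
    then show ?thesis by (simp add: c(1) u_def algebra_simps)
  qed
  have uS: "u \<in> dirs S"
  proof -
    have "b - a \<in> dirs S" using ab region_subset by (intro diff_in_dirs') blast+
    then show ?thesis unfolding u_def by (rule dirs_scale)
  qed
  obtain r1 where r1: "r1 > 0" "\<And>A y. A \<in> C \<Longrightarrow> y \<in> A \<Longrightarrow> dist (c + (1/2) *\<^sub>R u) y < r1 \<Longrightarrow> c + (1/2) *\<^sub>R u \<in> A"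
    using local_radius[of "c + (1/2) *\<^sub>R u"] by blast
  obtain r2 where r2: "r2 > 0" "\<And>A y. A \<in> C \<Longrightarrow> y \<in> A \<Longrightarrow> dist (c + (-1/2) *\<^sub>R u) y < r2 \<Longrightarrow> c + (-1/2) *\<^sub>R u \<in> A"
    using local_radius[of "c + (-1/2) *\<^sub>R u"] by blast
  define r' where "r' = min (r / 2) (min r1 r2)"
  have r': "r' > 0" using r r1 r2 by (simp add: r'_def)
  obtain y where y: "y \<in> rel_interior W" "dist c y < r'"
  proof -
    have "c \<in> closure (rel_interior W)"
      using wall_dims[OF Wc] W(2) by (simp add: convex_closure_rel_interior)
    then show ?thesis using that r' unfolding closure_approachable by (auto simp: dist_commute)
  qed
  have yW: "y \<in> W" using y rel_interior_subset by blast
  define z0 where "z0 = c - (1/2) *\<^sub>R (c - y)"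
  have z0: "z0 \<in> rel_interior W" unfolding z0_def
    using wall_dims(3)[OF Wc] y W(2) by (intro rel_interior_convex_shrink) auto
  \<comment> \<open>Three coincidences are excluded: a face of codimension above 2 at the hit,
    \<open>u\<close> tangent to a codimension-2 face there, and the direction of the sweep tangent
    to such a face modulo \<open>u\<close>. Every face met will contain \<open>c\<close>, so these
    sets can be listed before the sweep is defined.\<close>
  define HH where "HH = (\<lambda>A. insert y (insert (c + u) A)) ` {A \<in> C. c \<in> A \<and> aff_dim A < aff_dim S - 2}
      \<union> (\<lambda>F. insert y F) ` {F \<in> codim_faces C 2. c \<in> F}
      \<union> (\<lambda>F. insert (c + u) F) ` {F \<in> codim_faces C 2. c \<in> F}"
  have cHH: "c \<in> H" if "H \<in> HH" for H using that by (auto simp: HH_def)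
  obtain m where m: "m \<in> rel_interior M" "\<And>H. H \<in> HH \<Longrightarrow> m \<notin> affine hull H"
  proof -
    have dimHH: "aff_dim H < aff_dim S" if H: "H \<in> HH" for H
    proof -
      have i: "aff_dim (insert x F) < aff_dim S" if "F \<in> codim_faces C 2" for x F
        using aff_dim_insert_le[of x F] that by (simp add: codim_faces_def)
      have ii: "aff_dim (insert y (insert (c + u) A)) < aff_dim S" if "aff_dim A < aff_dim S - 2" for A
        using aff_dim_insert_le[of y "insert (c + u) A"] aff_dim_insert_le[of "c + u" A] that by linarith
      show ?thesis using H i ii unfolding HH_def by blast
    qed
    have "finite ((\<lambda>H. affine hull H) ` HH)"
      unfolding HH_def using finite_C finite_codim by simp
    moreover have "affine X \<and> aff_dim X < aff_dim S" if "X \<in> (\<lambda>H. affine hull H) ` HH" for X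
      using that dimHH by (auto simp: aff_dim_affine_hull)
    moreover have "convex (rel_interior M)" using cellsD(6)[OF M] by (rule convex_rel_interior)
    ultimately obtain m where "m \<in> rel_interior M" "m \<notin> \<Union>((\<lambda>H. affine hull H) ` HH)"
      using generic_point[OF openin_rel_interior_cell[OF M] _ rel_interior_cell_nonempty[OF M]] by metis
    then show ?thesis using that by blast
  qed
  have mM: "m \<in> M" using m(1) rel_interior_subset by blast
  have cS: "c \<in> S" using W(2) wall_dims(5)[OF Wc] by blast
  have yS: "y \<in> S" using yW wall_dims(5)[OF Wc] by blast
  have mS: "m \<in> S" using mM cellsD(8)[OF M] by blast
  have mc: "m - c \<in> dirs S" using diff_in_dirs'[OF mS cS] .
  \<comment> \<open>At half time the swept segment will contain a point of \<open>W\<close>: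
    \<open>\<alpha>\<close> tells how far along \<open>u\<close>, and \<open>\<delta>\<close> is
    small enough for this to be within its length and near \<open>c\<close>.\<close>
  obtain \<alpha> where \<alpha>: "m - c - \<alpha> *\<^sub>R u \<in> dirs W" using wall_split[OF Wc uS uW mc] .
  obtain \<delta> where \<delta>: "\<delta> > 0" "z0 + \<delta> *\<^sub>R ((1/2) *\<^sub>R (m - c - \<alpha> *\<^sub>R u)) \<in> W"
    "\<delta> < 1/2" "\<delta> * norm (m - c) < r'" "\<delta> * \<bar>\<alpha>\<bar> \<le> 1"
  proof -
    have "\<forall>\<^sub>F \<delta> in at_right 0. z0 + \<delta> *\<^sub>R ((1/2) *\<^sub>R (m - c - \<alpha> *\<^sub>R u)) \<in> rel_interior W"
      using rel_interior_move_eventually[OF z0 dirs_scale[OF \<alpha>]] .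
    moreover have "\<forall>\<^sub>F \<delta> in at_right 0. \<delta> < (1/2::real)" by (rule eventually_at_right_0_less) simp
    moreover have "\<forall>\<^sub>F \<delta> in at_right 0. \<delta> < r' / (norm (m - c) + 1)"
      using r' by (intro eventually_at_right_0_less) (simp add: add_nonneg_pos)
    moreover have "\<forall>\<^sub>F \<delta> in at_right 0. \<delta> < 1 / (\<bar>\<alpha>\<bar> + 1)"
      by (intro eventually_at_right_0_less) (simp add: add_nonneg_pos)
    ultimately have "\<forall>\<^sub>F \<delta> in at_right 0. 0 < \<delta> \<and> z0 + \<delta> *\<^sub>R ((1/2) *\<^sub>R (m - c - \<alpha> *\<^sub>R u)) \<in> W
      \<and> \<delta> < 1/2 \<and> \<delta> * norm (m - c) < r' \<and> \<delta> * \<bar>\<alpha>\<bar> \<le> 1"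
      using eventually_at_right_0_pos
    proof eventually_elim
      case (elim \<delta>)
      have "\<delta> * norm (m - c) \<le> \<delta> * (norm (m - c) + 1)" using elim by simp
      also have "\<dots> < r'" using elim(3) by (simp add: pos_less_divide_eq add_nonneg_pos)
      finally have 1: "\<delta> * norm (m - c) < r'" .
      have "\<delta> * \<bar>\<alpha>\<bar> \<le> \<delta> * (\<bar>\<alpha>\<bar> + 1)" using elim by simp
      also have "\<dots> < 1" using elim(4) by (simp add: pos_less_divide_eq add_nonneg_pos)
      finally have 2: "\<delta> * \<bar>\<alpha>\<bar> < 1" .
      show ?case using elim 1 2 rel_interior_subset by auto
    qed
    then show ?thesis using that eventually_happens[of _ "at_right (0::real)"] by auto
  qed
  define p where "p = c + \<delta> *\<^sub>R (m - c)"
  have pHH: "p - c \<notin> dirs H" if "H \<in> HH" for H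
  proof
    assume "p - c \<in> dirs H"
    then have "m - c \<in> dirs H" using \<delta>(1) by (simp add: p_def dirs_scale_iff)
    then show False using m(2)[OF that] affine_hull_iff_dirs[OF cHH[OF that], of m] by simp
  qed
  \<comment> \<open>The initial segment is a contraction, towards \<open>m\<close>, of a piece of
    the line inside the region. The factor \<open>1 - \<delta>\<close> exceeds \<open>1/2\<close>,
    so a piece with \<open>\<bar>\<tau>\<bar> \<le> 2\<close> suffices.\<close>
  have start: "p + \<tau> *\<^sub>R u \<in> rel_interior S \<and> p + \<tau> *\<^sub>R u \<notin> \<Union>kept" if \<tau>: "\<bar>\<tau>\<bar> \<le> 1" for \<tau>
  proof -
    define x where "x = c + (\<tau> / (1 - \<delta>)) *\<^sub>R u"
    have "\<bar>\<tau> / (1 - \<delta>)\<bar> \<le> 1 / (1/2)"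
      unfolding abs_divide using \<tau> \<delta> by (intro frac_le) auto
    then have xU: "x \<in> region C E M" unfolding x_def by (intro lineU) simp
    have eq: "p + \<tau> *\<^sub>R u = m + (1 - \<delta>) *\<^sub>R (x - m)" "p + \<tau> *\<^sub>R u = x - \<delta> *\<^sub>R (x - m)"
    proof -
      have "(1 - \<delta>) *\<^sub>R x = (1 - \<delta>) *\<^sub>R c + \<tau> *\<^sub>R u" using \<delta> by (simp add: x_def scaleR_right_distrib)
      then show "p + \<tau> *\<^sub>R u = m + (1 - \<delta>) *\<^sub>R (x - m)" by (simp add: p_def algebra_simps)
      then show "p + \<tau> *\<^sub>R u = x - \<delta> *\<^sub>R (x - m)" by (simp add: algebra_simps)
    qed
    have "p + \<tau> *\<^sub>R u \<notin> \<Union>kept"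
      unfolding eq(1) using \<delta> by (intro segment_region_avoids_kept[OF M m(1) xU]) auto
    moreover have "p + \<tau> *\<^sub>R u \<in> rel_interior S" unfolding eq(2)
      using convex_Supp m(1) rel_interior_cell_subset[OF M] xU region_subset \<delta>
      by (intro rel_interior_convex_shrink) auto
    ultimately show ?thesis by simp
  qed
  \<comment> \<open>The segment moves towards \<open>y\<close> but only half way, so that a hit is a
    proper combination of \<open>y\<close> and a point of the initial line and lies in the relative
    interior of \<open>S\<close>.\<close>
  define g where "g t \<tau> = p + t *\<^sub>R (y - p) + \<tau> *\<^sub>R u" for t \<tau>
  \<comment> \<open>Only walls transversal to \<open>u\<close> count as hits, as the protection of
    the two ends works for these.\<close>
  define K where "K = \<Union>{W' \<in> kept. u \<notin> dirs W'}"
  have clK: "closed K" unfolding K_def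
    using finite_kept_walls kept_walls_codim wall_dims(4) by (intro closed_Union) auto
  have cont: "continuous_on ({0..1/2} \<times> {-1/2..1/2}) (\<lambda>(t, s). g t s)"
    unfolding g_def case_prod_unfold by (intro continuous_intros)
  have hit: "g (1/2) (- (\<delta> * \<alpha>) / 2) \<in> K"
  proof -
    have "g (1/2) (- (\<delta> * \<alpha>) / 2) = z0 + \<delta> *\<^sub>R ((1/2) *\<^sub>R (m - c - \<alpha> *\<^sub>R u))"
    proof -
      have "p + k *\<^sub>R (y - p) = (c - k *\<^sub>R (c - y)) + ((1 - k) * \<delta>) *\<^sub>R (m - c)" for k
        by (simp add: p_def algebra_simps)
      from this[of "1/2"] have "p + (1/2) *\<^sub>R (y - p) = z0 + (\<delta> / 2) *\<^sub>R (m - c)" by (simp add: z0_def)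
      moreover have "\<delta> *\<^sub>R ((1/2) *\<^sub>R (m - c - \<alpha> *\<^sub>R u)) = (\<delta> / 2) *\<^sub>R (m - c) - (\<delta> * \<alpha> / 2) *\<^sub>R u"
        unfolding scaleR_right_diff_distrib[of _ "m - c"] by (simp add: scaleR_right_diff_distrib[of \<delta>])
      ultimately show ?thesis by (simp add: g_def)
    qed
    then show ?thesis using \<delta>(2) W(1) uW by (auto simp: K_def)
  qed
  have hit_s: "- (\<delta> * \<alpha>) / 2 \<in> {-1/2..1/2}"
  proof -
    have "\<bar>\<delta> * \<alpha>\<bar> \<le> 1" using \<delta> by (simp add: abs_mult)
    then show ?thesis by auto
  qed
  have hit_t: "(1/2::real) \<in> {0..1/2}" by simp
  obtain t \<tau> where t\<tau>: "t \<in> {0..1/2}" "\<tau> \<in> {-1/2..1/2}" "g t \<tau> \<in> K"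
    and min: "\<And>t' s'. 0 \<le> t' \<Longrightarrow> t' < t \<Longrightarrow> s' \<in> {-1/2..1/2} \<Longrightarrow> g t' s' \<notin> K"
    by (rule first_hit[OF cont clK hit_t hit_s hit]) (rule that)
  define z where "z = g t \<tau>"
  obtain W' where W': "W' \<in> kept" "u \<notin> dirs W'" "z \<in> W'" using t\<tau>(3) by (auto simp: z_def K_def)
  have W'C: "W' \<in> C" using wall_dims(1)[OF kept_walls_codim[OF W'(1)]] .
  have zc: "norm (z - (c + \<tau> *\<^sub>R u)) < r'"
  proof -
    have "z - (c + \<tau> *\<^sub>R u) = (1 - t) *\<^sub>R (p - c) + t *\<^sub>R (y - c)"
      by (simp add: z_def g_def algebra_simps)
    also have "norm \<dots> \<le> norm ((1 - t) *\<^sub>R (p - c)) + norm (t *\<^sub>R (y - c))" by (rule norm_triangle_ineq)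
    also have "\<dots> = (1 - t) * norm (p - c) + t * norm (y - c)" using t\<tau>(1) by simp
    also have "\<dots> < r'"
    proof (rule convex_bound_lt)
      show "norm (p - c) < r'" using \<delta> by (simp add: p_def)
      show "norm (y - c) < r'" using y(2) by (simp add: dist_norm norm_minus_commute)
    qed (use t\<tau>(1) in auto)
    finally show ?thesis .
  qed
  have cA: "c \<in> A" if "A \<in> C" "z \<in> A" for A
  proof (rule r(2)[OF that])
    have "z - c = (z - (c + \<tau> *\<^sub>R u)) + \<tau> *\<^sub>R u" by simp
    then have "norm (z - c) \<le> norm (z - (c + \<tau> *\<^sub>R u)) + norm (\<tau> *\<^sub>R u)"
      by (metis norm_triangle_ineq)
    moreover have "norm (\<tau> *\<^sub>R u) \<le> (1/2) * norm u"
      unfolding norm_scaleR using t\<tau>(2) by (intro mult_right_mono) auto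
    moreover have "r' \<le> r / 2" by (simp add: r'_def)
    ultimately have "norm (z - c) < r" using zc u_norm by linarith
    then show "dist c z < r" by (simp add: dist_norm norm_minus_commute)
  qed
  \<comment> \<open>A hit at this end would make \<open>W'\<close> contain both \<open>c\<close> and
    \<open>c + (1/2) *\<^sub>R u\<close>, so that \<open>u\<close> is one of its directions.\<close>
  have "\<tau> \<noteq> 1/2"
  proof
    assume \<tau>: "\<tau> = 1/2"
    have "c + (1/2) *\<^sub>R u \<in> W'"
      using zc by (intro r1(2)[OF W'C W'(3)]) (simp add: \<tau> dist_norm norm_minus_commute r'_def)
    then have "(c + (1/2) *\<^sub>R u) - c \<in> dirs W'" using cA[OF W'C W'(3)] by (intro diff_in_dirs')
    then show False using W'(2) by (simp add: dirs_scale_iff)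
  qed
  moreover have "\<tau> \<noteq> -1/2"
  proof
    assume \<tau>: "\<tau> = -1/2"
    have "c + (-1/2) *\<^sub>R u \<in> W'"
      using zc by (intro r2(2)[OF W'C W'(3)]) (simp add: \<tau> dist_norm norm_minus_commute r'_def)
    then have "(c + (-1/2) *\<^sub>R u) - c \<in> dirs W'" using cA[OF W'C W'(3)] by (intro diff_in_dirs')
    then show False using W'(2) dirs_scale_iff[of "-1/2" u W'] by simp
  qed
  ultimately have \<tau>: "-1/2 < \<tau>" "\<tau> < 1/2" using t\<tau>(2) by auto
  have t0: "t > 0"
  proof (rule ccontr)
    assume "\<not> t > 0"
    then have "z = p + \<tau> *\<^sub>R u" using t\<tau>(1) by (simp add: z_def g_def)
    moreover have "\<bar>\<tau>\<bar> \<le> 1" using \<tau> by auto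
    ultimately show False using start[of \<tau>] W' by auto
  qed
  define e where "e = y - p"
  have zp: "z - p = t *\<^sub>R e + \<tau> *\<^sub>R u" by (simp add: z_def g_def e_def)
  have zp': "(1 - t) *\<^sub>R (p - z) = - (t *\<^sub>R (y - z) + \<tau> *\<^sub>R u)"
    by (simp add: z_def g_def algebra_simps)
  \<comment> \<open>Since \<open>c\<close> and \<open>z\<close> both lie in \<open>H\<close>, it
    does not matter from which of them \<open>p\<close> is seen.\<close>
  have gen: False if H: "H \<in> HH" "z \<in> H" "p - z \<in> dirs H" for H
  proof -
    have "z - c \<in> dirs H" using H(2) cHH[OF H(1)] by (rule diff_in_dirs')
    with H(3) have "(p - z) + (z - c) \<in> dirs H" by (rule dirs_add)
    then show False using pHH[OF H(1)] by simp
  qed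
  have gen_y: False if H: "H \<in> HH" "z \<in> H" "y \<in> H" "u \<in> dirs H" for H
  proof (rule gen[OF H(1,2)])
    have "y - z \<in> dirs H" using H by (intro diff_in_dirs')
    then have "(1 - t) *\<^sub>R (p - z) \<in> dirs H" unfolding zp' using H(4) by (intro dirs_minus dirs_add dirs_scale)
    then show "p - z \<in> dirs H" using t\<tau>(1) by (simp add: dirs_scale_iff)
  qed
  show False
  proof (rule no_first_hit[OF W'(1,3), of u e])
    \<comment> \<open>\<open>z\<close> lies between \<open>y\<close> and the initial point with this
      offset; as \<open>1 - t\<close> is at least \<open>1/2\<close>, the offset stays within the
      range of \<open>start\<close>.\<close>
    define \<tau>' where "\<tau>' = \<tau> / (1 - t)"
    have "\<bar>\<tau>'\<bar> \<le> (1/2) / (1/2)" unfolding \<tau>'_def abs_divide using \<tau> t\<tau>(1) by (intro frac_le) auto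
    then have s: "p + \<tau>' *\<^sub>R u \<in> rel_interior S" using start[of \<tau>'] by simp
    have "y - (1 - t) *\<^sub>R (y - (p + \<tau>' *\<^sub>R u)) \<in> rel_interior S"
      using convex_Supp s yS t\<tau>(1) by (intro rel_interior_convex_shrink) auto
    moreover have "y - (1 - t) *\<^sub>R (y - (p + \<tau>' *\<^sub>R u)) = z"
    proof -
      have eq1: "(1 - t) *\<^sub>R (p + \<tau>' *\<^sub>R u) = (1 - t) *\<^sub>R p + \<tau> *\<^sub>R u"
        using t\<tau>(1) by (simp add: \<tau>'_def scaleR_right_distrib)
      have eq2: "y - (1 - t) *\<^sub>R (y - k) = t *\<^sub>R y + (1 - t) *\<^sub>R k" for k
        by (simp add: algebra_simps)
      show ?thesis unfolding eq2 eq1 z_def g_def by (simp add: algebra_simps)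
    qed
    ultimately show "z \<in> rel_interior S" by simp
    show "u \<in> dirs S" by (rule uS)
    have "p \<in> S" using start[of 0] rel_interior_subset by auto
    then show "e \<in> dirs S" unfolding e_def using yS by (intro diff_in_dirs')
  next
    fix A assume A: "A \<in> C" "z \<in> A"
    show "aff_dim S - 2 \<le> aff_dim A"
    proof (rule ccontr)
      assume "\<not> aff_dim S - 2 \<le> aff_dim A"
      let ?H = "insert y (insert (c + u) A)"
      have "?H \<in> HH" using A cA[OF A] \<open>\<not> aff_dim S - 2 \<le> aff_dim A\<close> by (auto simp: HH_def)
      moreover have "(c + u) - c \<in> dirs ?H" using cA[OF A] by (intro diff_in_dirs') auto
      ultimately show False using gen_y[of ?H] A by simp
    qed
  next
    fix F a' b' assume F: "F \<in> codim_faces C 2" "z \<in> F" and ab': "a' *\<^sub>R u + b' *\<^sub>R e \<in> dirs F"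
    have cF: "c \<in> F" using cA codim2_dims(1) F by blast
    have b0: "b' = 0"
    proof (rule ccontr)
      assume "b' \<noteq> 0"
      let ?H = "insert (c + u) F"
      have H: "?H \<in> HH" using F cF by (auto simp: HH_def)
      have "(c + u) - c \<in> dirs ?H" using cF by (intro diff_in_dirs') auto
      then have u: "u \<in> dirs ?H" by simp
      moreover have "a' *\<^sub>R u + b' *\<^sub>R e \<in> dirs ?H" using ab' dirs_mono[of F ?H] by blast
      ultimately have "a' *\<^sub>R u + b' *\<^sub>R e - a' *\<^sub>R u \<in> dirs ?H" by (intro dirs_diff dirs_scale)
      then have "e \<in> dirs ?H" using \<open>b' \<noteq> 0\<close> by (simp add: dirs_scale_iff)
      then have "z - p \<in> dirs ?H" unfolding zp using u by (intro dirs_add dirs_scale)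
      then have "p - z \<in> dirs ?H" using dirs_minus[of "z - p" ?H] by simp
      then show False using gen[OF H] F by simp
    qed
    moreover have "a' = 0"
    proof (rule ccontr)
      assume "a' \<noteq> 0"
      let ?H = "insert y F"
      have "u \<in> dirs F" using ab' b0 \<open>a' \<noteq> 0\<close> by (simp add: dirs_scale_iff)
      then have "u \<in> dirs ?H" using dirs_mono[of F ?H] by blast
      moreover have "?H \<in> HH" using F cF by (auto simp: HH_def)
      ultimately show False using gen_y[of ?H] F by simp
    qed
    ultimately show "a' = 0 \<and> b' = 0" by simp
  next
    show "u \<notin> dirs W'" by (rule W'(2))
  next
    fix W'' a' b'
    assume W'': "W'' \<in> kept" "u \<notin> dirs W''" and b': "(b'::real) > 0"
    show "\<not> (\<forall>\<^sub>F \<delta> in at_right 0. z + \<delta> *\<^sub>R (a' *\<^sub>R u - b' *\<^sub>R e) \<in> W'')"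
    proof
      assume ev: "\<forall>\<^sub>F \<delta> in at_right 0. z + \<delta> *\<^sub>R (a' *\<^sub>R u - b' *\<^sub>R e) \<in> W''"
      have lim: "((\<lambda>\<delta>. \<tau> + \<delta> * a') \<longlongrightarrow> \<tau> + 0 * a') (at_right 0)"
        by (intro tendsto_intros)
      have "\<forall>\<^sub>F \<delta> in at_right 0. -1/2 < \<tau> + \<delta> * a'"
        using order_tendstoD(1)[OF lim, of "-1/2"] \<tau> by simp
      moreover have "\<forall>\<^sub>F \<delta> in at_right 0. \<tau> + \<delta> * a' < 1/2"
        using order_tendstoD(2)[OF lim, of "1/2"] \<tau> by simp
      moreover have "\<forall>\<^sub>F \<delta> in at_right 0. \<delta> < t / b'"
        using t0 b' by (intro eventually_at_right_0_less) simp
      ultimately have "\<forall>\<^sub>F \<delta> in at_right (0::real). False"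
        using ev eventually_at_right_0_pos
      proof eventually_elim
        case (elim \<eta>)
        have "\<eta> * b' < t" using elim(3) b' by (simp add: pos_less_divide_eq)
        moreover have "\<eta> * b' > 0" using elim b' by simp
        ultimately have "g (t - \<eta> * b') (\<tau> + \<eta> * a') \<notin> K" using elim by (intro min) auto
        moreover have "g (t - \<eta> * b') (\<tau> + \<eta> * a') = z + \<eta> *\<^sub>R (a' *\<^sub>R u - b' *\<^sub>R e)"
          by (simp add: g_def z_def e_def algebra_simps)
        ultimately show ?case using elim W'' by (auto simp: K_def)
      qed
      then show False by simp
    qed
  qed
qed

text \<open>Suppose a segment from a generic point near \<open>x\<close> to a point short of
  \<open>a\<close> hit a kept wall. That wall would also contain a point strictly between
  \<open>a\<close> and \<open>b\<close>, hence have the direction \<open>b - a\<close> by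
  \<open>kept_wall_parallel\<close>, and its affine hull would contain the generic point.\<close>

lemma open_segment_in_region:
  assumes M: "M \<in> cells" and N: "N \<in> cells" and ab: "a \<in> region C E M" "b \<in> region C E M"
    and x: "x \<in> open_segment a b" "x \<in> region C E N"
  shows "a \<in> region C E N"
proof (rule closed_half_open_segment[OF closed_region, where y = x])
  fix s :: real assume s: "0 < s" "s < 1"
  \<comment> \<open>Stopping short of \<open>a\<close> keeps the closed segment from
    \<open>x\<close> to \<open>a'\<close> strictly between \<open>a\<close> and \<open>b\<close>;
    \<open>a\<close> itself is reached by closedness.\<close>
  define a' where "a' = x + s *\<^sub>R (a - x)"
  obtain l where l: "0 < l" "l < 1" "x = a + l *\<^sub>R (b - a)"
    using x(1) by (auto simp: in_segment algebra_simps)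
  obtain K where K: "K \<in> cells" "linked E N K" "x \<in> K" using x(2) by (auto simp: region_def)
  obtain r where r: "r > 0"
    "\<And>A v y. A \<in> C \<Longrightarrow> v \<in> closed_segment x a' \<Longrightarrow> y \<in> A \<Longrightarrow> dist v y < r \<Longrightarrow> A \<inter> closed_segment x a' \<noteq> {}"
    using compact_local_radius[OF compact_segment[of x a']] by metis
  have "affine X \<and> aff_dim X < aff_dim S" if "X \<in> (\<lambda>W. affine hull W) ` kept" for X
    using that kept_walls_codim by (auto simp: aff_dim_affine_hull codim_faces_def)
  then obtain y where "y \<in> rel_interior K \<inter> ball x r" "y \<notin> \<Union>((\<lambda>W. affine hull W) ` kept)"
    using generic_point[OF openin_rel_interior_cell_ball[OF K(1,3) r(1)], of "(\<lambda>W. affine hull W) ` kept"]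
      finite_kept_walls by blast
  then have y: "y \<in> rel_interior K" "dist x y < r" "\<And>W. W \<in> kept \<Longrightarrow> y \<notin> affine hull W"
    by auto
  have avoid: "y + \<mu> *\<^sub>R (a' - y) \<notin> W" if \<mu>: "0 \<le> \<mu>" "\<mu> < 1" and W: "W \<in> kept" for \<mu> W
  proof
    assume vW: "y + \<mu> *\<^sub>R (a' - y) \<in> W"
    define v where "v = y + \<mu> *\<^sub>R (a' - y)"
    have WC: "W \<in> C" using wall_dims(1)[OF kept_walls_codim[OF W]] .
    have "x + \<mu> *\<^sub>R (a' - x) \<in> closed_segment x a'" using \<mu> by (auto simp: closed_segment_param)
    moreover have "dist (x + \<mu> *\<^sub>R (a' - x)) v < r"
    proof -
      have "(x + \<mu> *\<^sub>R (a' - x)) - v = (1 - \<mu>) *\<^sub>R (x - y)" by (simp add: v_def algebra_simps)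
      then have "dist (x + \<mu> *\<^sub>R (a' - x)) v = (1 - \<mu>) * dist x y" using \<mu> by (simp add: dist_norm)
      also have "\<dots> \<le> 1 * dist x y" using \<mu> by (intro mult_right_mono) auto
      finally show ?thesis using y(2) by simp
    qed
    ultimately have "W \<inter> closed_segment x a' \<noteq> {}" using r(2)[OF WC] vW by (simp add: v_def)
    then obtain c0 where "c0 \<in> W" "c0 \<in> closed_segment x a'" by blast
    then obtain \<nu> where \<nu>: "\<nu> \<in> {0..1}" "x + \<nu> *\<^sub>R (a' - x) \<in> W" unfolding closed_segment_param by blast
    define c where "c = x + \<nu> *\<^sub>R (a' - x)"
    have ax: "a - x = (- l) *\<^sub>R (b - a)" using l(3) by simp
    have cab: "c = a + (l * (1 - \<nu> * s)) *\<^sub>R (b - a)"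
    proof -
      have "c = x + (\<nu> * s) *\<^sub>R (a - x)" by (simp add: c_def a'_def)
      then show ?thesis unfolding ax by (simp add: l(3) algebra_simps)
    qed
    have "0 \<le> \<nu> * s" "\<nu> * s \<le> 1 * s" using \<nu> s by (auto intro: mult_right_mono)
    then have ns: "0 \<le> \<nu> * s" "\<nu> * s < 1" using s by linarith+
    then have "0 < l * (1 - \<nu> * s)" using l by simp
    moreover have "l * (1 - \<nu> * s) \<le> l * 1" using l ns by (intro mult_left_mono) auto
    moreover have "c \<in> W" using \<nu>(2) by (simp add: c_def)
    ultimately have ba: "b - a \<in> dirs W"
      using l(2) by (intro kept_wall_parallel[OF M ab cab _ _ W]) linarith+
    have ca: "a' - c \<in> dirs W"
    proof -
      have "a' - c = ((1 - \<nu>) * s) *\<^sub>R (a - x)" by (simp add: c_def a'_def algebra_simps)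
      then show ?thesis unfolding ax using ba by (simp add: dirs_scale dirs_minus)
    qed
    have "v - c \<in> dirs W" using vW \<nu>(2) by (intro diff_in_dirs') (auto simp: v_def c_def)
    then have "(v - c) - (a' - c) \<in> dirs W" using ca by (rule dirs_diff)
    moreover have "(v - c) - (a' - c) = (1 - \<mu>) *\<^sub>R (y - a')" by (simp add: v_def algebra_simps)
    ultimately have "y - a' \<in> dirs W" using \<mu> by (simp add: dirs_scale_iff)
    then have "(y - a') + (a' - c) \<in> dirs W" using ca by (rule dirs_add)
    moreover have "c \<in> W" using \<nu>(2) by (simp add: c_def)
    ultimately show False using y(3)[OF W] affine_hull_iff_dirs[of c W y] by simp
  qed
  have aS: "a' \<in> S"
  proof -
    have "a \<in> S" "x \<in> S" using ab x(2) region_subset by blast+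
    moreover have "a' = (1 - s) *\<^sub>R x + s *\<^sub>R a" by (simp add: a'_def algebra_simps)
    ultimately show ?thesis using convex_Supp s by (simp add: convex_alt)
  qed
  have "a' \<in> region C E N"
  proof (rule closed_half_open_segment[OF closed_region, where y = y])
    fix \<kappa> :: real assume lam: "0 < \<kappa>" "\<kappa> < 1"
    have "y \<in> S" using y(1) rel_interior_subset cellsD(8)[OF K(1)] by blast
    then have zS: "y + \<kappa> *\<^sub>R (a' - y) \<in> S"
      using convexD_alt[OF convex_Supp _ aS, of y \<kappa>] lam by (simp add: algebra_simps)
    have "closed_segment y (y + \<kappa> *\<^sub>R (a' - y)) \<inter> \<Union>kept = {}"
    proof -
      have "v \<notin> \<Union>kept" if v: "v \<in> closed_segment y (y + \<kappa> *\<^sub>R (a' - y))" for v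
      proof -
        obtain \<mu> where \<mu>: "\<mu> \<in> {0..1}" "v = y + (\<mu> * \<kappa>) *\<^sub>R (a' - y)"
          using v by (auto simp: closed_segment_param)
        have "\<mu> * \<kappa> \<le> 1 * \<kappa>" using \<mu> lam by (intro mult_right_mono) auto
        then have "\<mu> * \<kappa> < 1" using lam by linarith
        moreover have "0 \<le> \<mu> * \<kappa>" using \<mu>(1) lam by simp
        ultimately show ?thesis using avoid \<mu>(2) by blast
      qed
      then show ?thesis by blast
    qed
    then have "y + \<kappa> *\<^sub>R (a' - y) \<in> region C E K" using segment_in_region[OF K(1) y(1) zS] by blast
    then show "y + \<kappa> *\<^sub>R (a' - y) \<in> region C E N" using region_eq[OF K(2)] by metis
  qed
  then show "x + s *\<^sub>R (a - x) \<in> region C E N" by (simp add: a'_def)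
qed

lemma region_Int_face:
  assumes "M \<in> cells" "N \<in> cells"
  shows "region C E M \<inter> region C E N face_of region C E M"
  unfolding face_of_def
proof (intro conjI ballI impI)
  show "convex (region C E M \<inter> region C E N)" using convex_region assms by (intro convex_Int)
  fix a b x assume *: "a \<in> region C E M" "b \<in> region C E M" "x \<in> region C E M \<inter> region C E N"
    "x \<in> open_segment a b"
  show "a \<in> region C E M \<inter> region C E N" using open_segment_in_region[OF assms *(1,2,4)] * by blast
  show "b \<in> region C E M \<inter> region C E N"
    using open_segment_in_region[OF assms *(2,1)] * by (simp add: open_segment_commute)
qed auto

text \<open>A face of the region cuts every cell of the region in a face of that cell, which belongs
  to \<open>C\<close> when nonempty.\<close>

lemma region_face_Union:
  assumes M: "M \<in> cells" and G: "G face_of region C E M"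
  shows "G = \<Union>{A \<in> C. A \<subseteq> G}"
proof
  show "G \<subseteq> \<Union>{A \<in> C. A \<subseteq> G}"
  proof
    fix x assume x: "x \<in> G"
    then obtain N where N: "N \<in> cells" "linked E M N" "x \<in> N"
      using face_of_imp_subset[OF G] by (auto simp: region_def)
    have "G \<inter> N face_of region C E M \<inter> N" using face_of_slice[OF G cellsD(6)[OF N(1)]] .
    also have "region C E M \<inter> N = N" using cell_subset_region[OF N(1,2)] by blast
    finally have "G \<inter> N \<in> C" using face_C[OF cellsD(1)[OF N(1)]] x N by blast
    then show "x \<in> \<Union>{A \<in> C. A \<subseteq> G}" using x N by blast
  qed
qed auto

text \<open>Each face is determined by the members of \<open>C\<close> inside it, so there are
  finitely many; a closed convex set with finitely many faces is a polyhedron.\<close>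

lemma polyhedron_region:
  assumes M: "M \<in> cells"
  shows "polyhedron (region C E M)"
  unfolding polyhedron_eq_finite_faces
proof (intro conjI closed_region convex_region[OF M])
  have "{G. G face_of region C E M} \<subseteq> Union ` Pow C"
  proof
    fix G assume "G \<in> {G. G face_of region C E M}"
    then have "G = \<Union>{A \<in> C. A \<subseteq> G}" using region_face_Union[OF M] by blast
    then show "G \<in> Union ` Pow C" by (rule image_eqI) auto
  qed
  then show "finite {G. G face_of region C E M}" using finite_C finite_subset by blast
qed

section \<open>The complex formed by the faces of the regions\<close>

lemma coarsening_exists:
  "\<exists>C'. polyhedral_complex C' \<and> coarsens C' C \<and> edge_set C C' = E"
proof (intro exI conjI)
  define C' where "C' = {G. \<exists>M\<in>cells. G face_of region C E M}"
  have reg: "region C E M \<in> C'" if "M \<in> cells" for M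
    using that convex_region face_of_refl by (auto simp: C'_def)
  obtain z where "z \<in> S" using S_nonempty by blast
  then obtain M0 where M0: "M0 \<in> cells" using cell_at by blast
  show "polyhedral_complex C'"
    unfolding polyhedral_complex_def
  proof (intro conjI ballI allI impI)
    have "C' = (\<Union>M\<in>cells. {G. G face_of region C E M})" by (auto simp: C'_def)
    then show "finite C'" using finite_codim[of 0] polyhedron_region finite_polyhedron_faces by auto
    have "M0 \<subseteq> region C E M0" using cell_subset_region[OF M0 linked_refl] .
    then show "\<exists>F\<in>C'. F \<noteq> {}" using reg[OF M0] cellsD(2)[OF M0] by blast
    show "polyhedron F" if "F \<in> C'" for F
      using that polyhedron_region face_of_polyhedron_polyhedron by (auto simp: C'_def)
    show "G \<in> C'" if "F \<in> C'" "G face_of F \<and> G \<noteq> {}" for F G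
      using that face_of_trans by (auto simp: C'_def)
    fix F G assume "F \<in> C'" "G \<in> C'"
    then obtain M N where MN: "M \<in> cells" "N \<in> cells" "F face_of region C E M" "G face_of region C E N"
      by (auto simp: C'_def)
    \<comment> \<open>Regions meet in common faces, and this passes on to faces of regions.\<close>
    have "F \<inter> G face_of F \<and> F \<inter> G face_of G"
      using region_Int_face[OF MN(1,2)] region_Int_face[OF MN(2,1)] MN(3,4)
      by (intro face_of_Int_subface) (auto simp: Int_commute)
    then show "F \<inter> G face_of F" "F \<inter> G face_of G" by auto
  qed
  show "coarsens C' C"
    unfolding coarsens_def
  proof (intro conjI ballI)
    have "Supp C' \<subseteq> S" using face_of_imp_subset region_subset by (fastforce simp: C'_def Supp_def)
    moreover have "S \<subseteq> Supp C'"
    proof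
      fix x assume "x \<in> S"
      then obtain M where M: "M \<in> cells" "x \<in> M" using cell_at by blast
      then have "x \<in> region C E M" using cell_subset_region linked_refl by blast
      then show "x \<in> Supp C'" using reg[OF M(1)] by (auto simp: Supp_def)
    qed
    ultimately show "Supp C' = S" by blast
    fix F assume "F \<in> C'"
    then have "F = \<Union>{A \<in> C. A \<subseteq> F}" using region_face_Union by (auto simp: C'_def)
    then show "\<exists>D\<subseteq>C. F = \<Union>D" by (intro exI[of _ "{A \<in> C. A \<subseteq> F}"]) auto
  qed
  show "edge_set C C' = E"
  proof
    show "edge_set C C' \<subseteq> E"
    proof
      fix e assume "e \<in> edge_set C C'"
      then obtain M N G where e: "e = {M, N}" "{M, N} \<in> adjacency_edges C" "G \<in> C'" "M \<subseteq> G" "N \<subseteq> G"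
        by (auto simp: edge_set_def)
      then obtain K where "G \<subseteq> region C E K" using face_of_imp_subset unfolding C'_def by blast
      then have "linked E K M" "linked E K N"
        using e cell_in_region by (auto simp: adjacency_edges_iff)
      then have "linked E M N" using linked_sym linked_trans by metis
      then show "e \<in> E" using linked_adjacent e by simp
    qed
    show "E \<subseteq> edge_set C C'"
    proof
      fix e assume e: "e \<in> E"
      then obtain M N where MN: "e = {M, N}" using E_subset by (auto simp: adjacency_edges_def)
      have c: "{M, N} \<in> adjacency_edges C" "M \<in> cells" "N \<in> cells" using edge_cells e MN by auto
      have "M \<subseteq> region C E M" "N \<subseteq> region C E M"
        using cell_subset_region[OF c(2) linked_refl] cell_subset_region[OF c(3) linked_edge] e MN by simp_all
      then show "e \<in> edge_set C C'" unfolding edge_set_def using MN c reg[OF c(2)] by blast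
    qed
  qed
qed

end

section \<open>Balancing around the faces of a coarsening\<close>

text \<open>Only halfspaces with \<open>x\<close> on their boundary constrain a direction; the
  others hold for all small steps.\<close>

lemma polyhedron_tangent_cone:
  fixes A :: "'a::euclidean_space set"
  assumes "polyhedron A" "x \<in> A"
  shows "polyhedron {v. \<exists>\<epsilon>>0. x + \<epsilon> *\<^sub>R v \<in> A}"
proof -
  obtain H where H: "finite H" "A = \<Inter>H" "\<forall>h\<in>H. \<exists>a b. a \<noteq> 0 \<and> h = {y. a \<bullet> y \<le> b}"
    using assms(1) unfolding polyhedron_def by blast
  then obtain a b where ab: "\<forall>h\<in>H. h = {y. a h \<bullet> y \<le> b h}" by metis
  have xH: "a h \<bullet> x \<le> b h" if "h \<in> H" for h using that assms(2) H(2) ab by blast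
  have "{v. \<exists>\<epsilon>>0. x + \<epsilon> *\<^sub>R v \<in> A} = \<Inter>((\<lambda>h. {v. a h \<bullet> v \<le> 0}) ` {h \<in> H. a h \<bullet> x = b h})"
  proof (intro set_eqI iffI)
    fix v assume "v \<in> {v. \<exists>\<epsilon>>0. x + \<epsilon> *\<^sub>R v \<in> A}"
    then obtain \<epsilon> where e: "\<epsilon> > 0" "x + \<epsilon> *\<^sub>R v \<in> A" by blast
    have "a h \<bullet> v \<le> 0" if h: "h \<in> H" "a h \<bullet> x = b h" for h
    proof -
      have "a h \<bullet> (x + \<epsilon> *\<^sub>R v) \<le> b h" using e(2) H(2) ab h(1) by blast
      then have "\<epsilon> * (a h \<bullet> v) \<le> 0" using h(2) by (simp add: inner_add_right)
      then show ?thesis using e(1) by (simp add: mult_le_0_iff)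
    qed
    then show "v \<in> \<Inter>((\<lambda>h. {v. a h \<bullet> v \<le> 0}) ` {h \<in> H. a h \<bullet> x = b h})" by blast
  next
    fix v assume v: "v \<in> \<Inter>((\<lambda>h. {v. a h \<bullet> v \<le> 0}) ` {h \<in> H. a h \<bullet> x = b h})"
    have "\<forall>h\<in>H. \<forall>\<^sub>F \<delta> in at_right 0. a h \<bullet> (x + \<delta> *\<^sub>R v) \<le> b h"
    proof
      fix h assume h: "h \<in> H"
      show "\<forall>\<^sub>F \<delta> in at_right 0. a h \<bullet> (x + \<delta> *\<^sub>R v) \<le> b h"
      proof (cases "a h \<bullet> x = b h")
        case True
        then have av: "a h \<bullet> v \<le> 0" using v h by blast
        show ?thesis using eventually_at_right_0_pos
          by (rule eventually_mono) (use True av in \<open>simp add: inner_add_right mult_le_0_iff\<close>)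
      next
        case False
        have "((\<lambda>\<delta>. a h \<bullet> (x + \<delta> *\<^sub>R v)) \<longlongrightarrow> a h \<bullet> (x + 0 *\<^sub>R v)) (at_right 0)"
          by (intro tendsto_intros)
        then have "\<forall>\<^sub>F \<delta> in at_right 0. a h \<bullet> (x + \<delta> *\<^sub>R v) < b h"
          using order_tendstoD(2) xH[OF h] False by fastforce
        then show ?thesis by (rule eventually_mono) simp
      qed
    qed
    then have "\<forall>\<^sub>F \<delta> in at_right 0. \<forall>h\<in>H. a h \<bullet> (x + \<delta> *\<^sub>R v) \<le> b h"
      by (rule eventually_ball_finite[OF H(1)])
    then obtain \<delta> where d: "\<delta> > 0" "\<forall>h\<in>H. a h \<bullet> (x + \<delta> *\<^sub>R v) \<le> b h"
      using eventually_at_right_0_obtains by blast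
    then have "x + \<delta> *\<^sub>R v \<in> A" using H(2) ab by blast
    then show "v \<in> {v. \<exists>\<epsilon>>0. x + \<epsilon> *\<^sub>R v \<in> A}" using d(1) by blast
  qed
  moreover have "polyhedron (\<Inter>((\<lambda>h. {v. a h \<bullet> v \<le> 0}) ` {h \<in> H. a h \<bullet> x = b h}))"
    using H(1) by (intro polyhedron_Inter) (auto intro: polyhedron_halfspace_le)
  ultimately show ?thesis by simp
qed

lemma polyhedral_complexD:
  assumes "polyhedral_complex C" "F \<in> C"
  shows "polyhedron F" "convex F" "closed F" "G \<in> C \<Longrightarrow> F \<inter> G face_of F"
  using assms by (auto simp: polyhedral_complex_def polyhedron_imp_convex polyhedron_imp_closed)

context convex_complex
begin

text \<open>A hyperplane supporting \<open>S\<close> at \<open>x\<close> would contain all of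
  \<open>F\<close>, because \<open>F\<close> can be prolonged beyond \<open>x\<close> in every
  direction; this would put \<open>F\<close> into the boundary.\<close>

lemma rel_interior_interior_face:
  assumes F: "F \<in> interior_codim2_faces C" and x: "x \<in> rel_interior F"
  shows "x \<in> rel_interior S"
proof (rule ccontr)
  assume nx: "x \<notin> rel_interior S"
  have FC: "F \<in> C" "F \<subseteq> S" using F C_subset by (auto simp: interior_codim2_faces_def codim_faces_def)
  have xS: "x \<in> closure S" using x FC rel_interior_subset closure_subset by blast
  obtain a where a: "\<And>y. y \<in> closure S \<Longrightarrow> a \<bullet> x \<le> a \<bullet> y" "\<And>y. y \<in> rel_interior S \<Longrightarrow> a \<bullet> x < a \<bullet> y"
    using supporting_hyperplane_relative_frontier[OF convex_Supp xS nx] by metis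
  have "y \<in> rel_frontier S" if y: "y \<in> F" for y
  proof -
    have "y \<notin> rel_interior S"
    proof
      assume "y \<in> rel_interior S"
      then have lt: "a \<bullet> x < a \<bullet> y" by (rule a(2))
      obtain \<delta> where \<delta>: "\<delta> > 0" "x + \<delta> *\<^sub>R (x - y) \<in> rel_interior F"
        using eventually_at_right_0_obtains[OF rel_interior_extend_back[OF x y]] .
      then have "x + \<delta> *\<^sub>R (x - y) \<in> closure S" using FC rel_interior_subset closure_subset by blast
      then have "a \<bullet> x \<le> a \<bullet> (x + \<delta> *\<^sub>R (x - y))" by (rule a(1))
      then have "0 \<le> \<delta> * (a \<bullet> x - a \<bullet> y)" by (simp add: inner_add_right inner_diff_right)
      then show False using \<delta>(1) lt by (simp add: zero_le_mult_iff)
    qed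
    then show ?thesis using y FC closure_subset by (auto simp: rel_frontier_def)
  qed
  then show False using F by (auto simp: interior_codim2_faces_def)
qed

section \<open>Faces of a coarsening around a cell\<close>

lemma coarsening_cell:
  assumes co: "coarsens C' C" and G: "G \<in> C'" and m: "m \<in> rel_interior M" "M \<in> C" "m \<in> G"
  shows "M \<subseteq> G"
proof -
  obtain D where D: "D \<subseteq> C" "G = \<Union>D" using co G unfolding coarsens_def by blast
  then obtain H where "H \<in> D" "m \<in> H" using m(3) by blast
  then show ?thesis using face_contains[OF m(1) _ m(2)] D by blast
qed

lemma coarsening_cell_exists:
  assumes "coarsens C' C" "M \<in> cells"
  obtains G where "G \<in> C'" "M \<subseteq> G"
proof -
  obtain m where m: "m \<in> rel_interior M" using rel_interior_cell_nonempty[OF assms(2)] by blast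
  then have "m \<in> Supp C'"
    using assms(1) cellsD(8)[OF assms(2)] rel_interior_subset by (auto simp: coarsens_def)
  then obtain G where "G \<in> C'" "m \<in> G" by (auto simp: Supp_def)
  then show ?thesis using that coarsening_cell[OF assms(1) _ m cellsD(1)[OF assms(2)]] by blast
qed

text \<open>The two faces meet in a face of each that contains \<open>M\<close>; being
  full-dimensional, it is not proper.\<close>

lemma coarsening_cell_unique:
  assumes C': "polyhedral_complex C'" "coarsens C' C" and M: "M \<in> cells"
    and G: "G \<in> C'" "M \<subseteq> G" "G' \<in> C'" "M \<subseteq> G'"
  shows "G = G'"
proof -
  have eq: "G1 \<inter> G2 = G1" if G12: "G1 \<in> C'" "M \<subseteq> G1" "G2 \<in> C'" "M \<subseteq> G2" for G1 G2
  proof (rule ccontr)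
    assume ne: "G1 \<inter> G2 \<noteq> G1"
    have f: "G1 \<inter> G2 face_of G1" "convex G1"
      using polyhedral_complexD[OF C'(1)] G12 by simp_all
    have "G1 \<subseteq> Supp C'" using G12(1) by (auto simp: Supp_def)
    then have "G1 \<subseteq> S" using C'(2) by (simp add: coarsens_def)
    then have "aff_dim G1 \<le> aff_dim S" by (rule aff_dim_subset)
    moreover have "aff_dim M \<le> aff_dim (G1 \<inter> G2)" using G12 by (intro aff_dim_subset) auto
    ultimately show False using face_of_aff_dim_lt[OF f(2,1) ne] cellsD(3)[OF M] by simp
  qed
  show ?thesis using eq[OF G] eq[OF G(3,4,1,2)] by blast
qed

lemma coarsening_edge:
  assumes C': "polyhedral_complex C'" "coarsens C' C"
    and e: "{K, L} \<in> edge_set C C'" and G: "G \<in> C'" "K \<subseteq> G"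
  shows "L \<subseteq> G"
proof -
  obtain M N G' where MN: "{K, L} = {M, N}" "{M, N} \<in> adjacency_edges C" "G' \<in> C'" "M \<subseteq> G'" "N \<subseteq> G'"
    using e unfolding edge_set_def mem_Collect_eq by (elim exE conjE bexE) (rule that)
  have "K = M \<and> L = N \<or> K = N \<and> L = M" using MN(1) by (simp only: doubleton_eq_iff)
  moreover have "M \<in> cells" "N \<in> cells" using MN(2) by (simp_all add: adjacency_edges_iff)
  ultimately have KL: "K \<subseteq> G'" "L \<subseteq> G'" "K \<in> cells" using MN(4,5) by metis+
  then show ?thesis using coarsening_cell_unique[OF C' KL(3) G MN(3) KL(1)] by simp
qed

text \<open>If no wall outside \<open>E\<close> meets the open half-space \<open>n < 0\<close> near \<open>F\<close>, then one face \<open>G\<close> of the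
  coarsening fills it.  As \<open>G\<close> contains a neighbourhood of \<open>F\<close> in the bounding hyperplane, so does
  every face of the coarsening containing \<open>F\<close>.\<close>

lemma coarsening_balanced:
  assumes C': "polyhedral_complex C'" "coarsens C' C"
    and F: "F \<in> interior_codim2_faces C"
  shows "balanced_at C (edge_set C C') F"
  unfolding balanced_at_def
proof (intro allI impI ballI)
  let ?kept = "kept_walls C (edge_set C C')"
  fix n W w0 x0
  assume nF: "\<forall>y\<in>F. \<forall>z\<in>F. n \<bullet> (y - z) = 0"
    and nonneg: "\<forall>W\<in>?kept. F \<subseteq> W \<longrightarrow> (\<forall>w\<in>W. \<forall>x\<in>F. 0 \<le> n \<bullet> (w - x))"
    and W: "W \<in> ?kept" "F \<subseteq> W" and w0: "w0 \<in> W" and x0: "x0 \<in> F"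
  show "n \<bullet> (w0 - x0) = 0"
  proof (rule ccontr)
    assume "n \<bullet> (w0 - x0) \<noteq> 0"
    then have pos0: "n \<bullet> (w0 - x0) > 0" using nonneg W w0 x0 by (metis less_eq_real_def)
    have F2: "F \<in> C" "F \<noteq> {}" "aff_dim F = aff_dim S - 2"
      using F by (auto simp: interior_codim2_faces_def codim_faces_def)
    obtain x where x: "x \<in> rel_interior F"
      using F2 convex_C by (metis all_not_in_conv rel_interior_eq_empty)
    have xF: "x \<in> F" using x rel_interior_subset by blast
    have "n \<bullet> (w0 - x) = n \<bullet> (w0 - x0) + n \<bullet> (x0 - x)" by (simp add: inner_diff_right)
    then have pos: "n \<bullet> (w0 - x) > 0" using pos0 nF x0 xF by simp
    obtain M N where MN: "W = M \<inter> N" "{M, N} \<in> adjacency_edges C" "{M, N} \<notin> edge_set C C'"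
      "M \<in> cells" "N \<in> cells" "W \<in> codim_faces C 1"
      using kept_wallsE[OF W(1)] by metis
    have xS: "x \<in> rel_interior S" using rel_interior_interior_face[OF F x] .
    obtain r1 where r1: "r1 > 0" "\<And>A y. A \<in> C \<Longrightarrow> y \<in> A \<Longrightarrow> dist x y < r1 \<Longrightarrow> x \<in> A"
      using local_radius[of x] by metis
    obtain r2 where r2: "r2 > 0" "ball x r2 \<inter> affine hull S \<subseteq> S"
      using xS by (auto simp: mem_rel_interior_ball)
    define r where "r = min r1 r2"
    have r: "r > 0" using r1 r2 by (simp add: r_def)
    have near: "F \<subseteq> A" if "A \<in> C" "y \<in> A" "dist x y < r" for A y
      using face_contains[OF x r1(2) F2(1)] that by (simp add: r_def)
    \<comment> \<open>An open half-ball, so small that it lies in \<open>S\<close> and that every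
      face meeting it contains \<open>F\<close>.\<close>
    define H where "H = (ball x r \<inter> affine hull S) \<inter> {y. n \<bullet> y < n \<bullet> x}"
    have HS: "H \<subseteq> S" using r2(2) by (auto simp: H_def r_def)
    have "convex H" unfolding H_def
      by (intro convex_Int convex_halfspace_lt) (auto intro: affine_imp_convex)
    then have conH: "connected H" by (rule convex_connected)
    have xA: "x \<in> affine hull S" using xS by (meson hull_inc rel_interior_subset subsetD)
    have w0S: "w0 \<in> S" using w0 wall_dims(5)[OF MN(6)] by blast
    have w0x: "w0 - x \<in> dirs S" using w0S xA by (intro diff_in_dirs) (auto intro: hull_inc)
    \<comment> \<open>Points of the bounding hyperplane are approached along \<open>x - w0\<close>,
      on which \<open>n\<close> is negative.\<close>
    have approach: "\<forall>\<^sub>F \<eta> in at_right 0. x + k - \<eta> *\<^sub>R (w0 - x) \<in> H"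
      if k: "k \<in> dirs S" "n \<bullet> k = 0" "norm k < r" for k
    proof -
      have "((\<lambda>\<eta>. norm (k - \<eta> *\<^sub>R (w0 - x))) \<longlongrightarrow> norm (k - 0 *\<^sub>R (w0 - x))) (at_right 0)"
        by (intro tendsto_intros)
      then have "\<forall>\<^sub>F \<eta> in at_right 0. norm (k - \<eta> *\<^sub>R (w0 - x)) < r"
        using k(3) by (auto dest: order_tendstoD(2))
      then show ?thesis using eventually_at_right_0_pos
      proof eventually_elim
        case (elim \<eta>)
        have "x + k - \<eta> *\<^sub>R (w0 - x) \<in> ball x r"
          using elim by (simp add: dist_norm norm_minus_commute algebra_simps)
        moreover have "x + (k - \<eta> *\<^sub>R (w0 - x)) \<in> affine hull S"
          using add_dirs_affine_hull[OF xA dirs_diff[OF k(1) dirs_scale[OF w0x]]] .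
        moreover have "n \<bullet> (x + k - \<eta> *\<^sub>R (w0 - x)) = n \<bullet> x - \<eta> * (n \<bullet> (w0 - x))"
          using k(2) by (simp add: inner_add_right inner_diff_right)
        moreover have "\<eta> * (n \<bullet> (w0 - x)) > 0" using elim pos by simp
        ultimately show ?case by (simp add: H_def add_diff_eq)
      qed
    qed
    have "\<forall>\<^sub>F \<eta> in at_right 0. x + 0 - \<eta> *\<^sub>R (w0 - x) \<in> H"
      by (intro approach) (auto simp: dirs_zero r)
    then obtain h where h: "h \<in> H" using eventually_at_right_0_obtains by blast
    obtain K0 where K0: "K0 \<in> cells" "h \<in> K0" using cell_at h HS by blast
    obtain G where G: "G \<in> C'" "K0 \<subseteq> G" using coarsening_cell_exists[OF C'(2) K0(1)] .
    define U where "U = \<Union>{K \<in> cells. K \<subseteq> G}"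
    define V where "V = \<Union>{K \<in> cells. \<not> K \<subseteq> G}"
    have "closed U" "closed V" unfolding U_def V_def
      using finite_codim[of 0] cellsD(7) by (auto intro!: closed_Union)
    moreover have "H \<subseteq> U \<union> V" using HS S_eq_Union_cells unfolding U_def V_def by blast
    \<comment> \<open>A cell in \<open>G\<close> and a cell not in \<open>G\<close> that meet in
      \<open>H\<close> share \<open>F\<close> and a point off its hull, hence a wall. It would be
      kept and reach into the side where \<open>n\<close> is negative.\<close>
    moreover have "U \<inter> V \<inter> H = {}"
    proof (rule ccontr)
      assume "U \<inter> V \<inter> H \<noteq> {}"
      then obtain z K L where z: "z \<in> H" "K \<in> cells" "z \<in> K" "K \<subseteq> G" "L \<in> cells" "z \<in> L" "\<not> L \<subseteq> G"
        unfolding U_def V_def by blast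
      have zr: "dist x z < r" and nz: "n \<bullet> z < n \<bullet> x" using z(1) by (auto simp: H_def)
      have FKL: "F \<subseteq> K \<inter> L" using near[OF cellsD(1) _ zr] z by blast
      have f: "K \<inter> L face_of K" using Int_face_C(1) z cellsD(1) by blast
      have KLC: "K \<inter> L \<in> C" using face_C[OF cellsD(1)[OF z(2)] f] z by blast
      have "K \<inter> L \<noteq> K" using cell_subset[OF z(2) cellsD(1)[OF z(5)]] z by blast
      then have "aff_dim (K \<inter> L) < aff_dim S"
        using face_of_aff_dim_lt[OF cellsD(6)[OF z(2)] f] cellsD(3)[OF z(2)] by simp
      moreover have "z \<notin> affine hull F"
      proof
        assume "z \<in> affine hull F"
        moreover have "n \<bullet> y = n \<bullet> x" if "y \<in> F" for y
        proof -
          have "n \<bullet> (y - x) = 0" using nF that xF by blast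
          then show ?thesis by (simp add: inner_diff_right)
        qed
        then have "affine hull F \<subseteq> {y. n \<bullet> y = n \<bullet> x}"
          by (intro hull_minimal affine_hyperplane) blast
        ultimately show False using nz by auto
      qed
      then have "aff_dim (insert z F) = aff_dim S - 1" using F2(3) by (simp add: aff_dim_insert)
      then have "aff_dim S - 1 \<le> aff_dim (K \<inter> L)"
        using aff_dim_subset[of "insert z F" "K \<inter> L"] FKL z by simp
      ultimately have "K \<inter> L \<in> codim_faces C 1" using KLC z by (auto simp: codim_faces_def)
      then have "{K, L} \<in> adjacency_edges C" using z by (simp add: adjacency_edges_iff)
      moreover have "{K, L} \<notin> edge_set C C'" using coarsening_edge[OF C' _ G(1) z(4)] z(7) by blast
      ultimately have "K \<inter> L \<in> ?kept" unfolding kept_walls_def by (metis DiffI Inter_insert Inter_empty Int_UNIV_right imageI)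
      then have "0 \<le> n \<bullet> (z - x)" using nonneg FKL z xF by blast
      then show False using nz by (simp add: inner_diff_right)
    qed
    moreover have "h \<in> U" using K0 G by (auto simp: U_def)
    ultimately have "V \<inter> H = {}" using conH h unfolding connected_closed by blast
    then have HG: "H \<subseteq> G" using \<open>H \<subseteq> U \<union> V\<close> unfolding U_def by blast
    have closedG: "closed G" using polyhedral_complexD(3)[OF C'(1) G(1)] .
    have hyp: "x + k \<in> G" if k: "k \<in> dirs S" "n \<bullet> k = 0" "norm k < r" for k
    proof -
      have ev: "\<forall>\<^sub>F \<eta> in at_right 0. x + k - \<eta> *\<^sub>R (w0 - x) \<in> G"
        using approach[OF k] by (rule eventually_mono) (use HG in blast)
      have "((\<lambda>\<eta>. x + k - \<eta> *\<^sub>R (w0 - x)) \<longlongrightarrow> x + k - 0 *\<^sub>R (w0 - x)) (at_right 0)"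
        by (intro tendsto_intros)
      from Lim_in_closed_set[OF closedG ev _ this] have "x + k - 0 *\<^sub>R (w0 - x) \<in> G" by simp
      then show ?thesis by simp
    qed
    obtain G2 where G2: "G2 \<in> C'" "N \<subseteq> G2" using coarsening_cell_exists[OF C'(2) MN(5)] .
    have G2f: "G \<inter> G2 face_of G" and G2c: "convex G2"
      using polyhedral_complexD[OF C'(1)] G(1) G2(1) by simp_all
    have xG2: "x \<in> G2" using xF W(2) MN(1) G2(2) by blast
    \<comment> \<open>\<open>x\<close> is the midpoint of \<open>x + k\<close> and
      \<open>x - k\<close>, both in \<open>G\<close>. Since \<open>G \<inter> G2\<close> is a face
      of \<open>G\<close> through \<open>x\<close>, it contains both.\<close>
    have hyp2: "x + k \<in> G2" if k: "k \<in> dirs S" "n \<bullet> k = 0" "norm k < r" for k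
    proof (cases "k = 0")
      case True
      then show ?thesis using xG2 by simp
    next
      case False
      have "(1 - t) *\<^sub>R (x + k) + s *\<^sub>R (x + (- k)) = (1 - t + s) *\<^sub>R x + (1 - t - s) *\<^sub>R k" for t s
        by (simp add: algebra_simps)
      from this[of "1/2" "1/2"] have "x = (1 - 1/2) *\<^sub>R (x + k) + (1/2) *\<^sub>R (x + (- k))" by simp
      moreover have "x + k \<noteq> x + (- k)"
        using False by (simp add: eq_neg_iff_add_eq_0 flip: scaleR_2)
      ultimately have "x \<in> open_segment (x + k) (x + (- k))"
        unfolding in_segment by (intro conjI exI[of _ "1/2"]) simp_all
      moreover have "x + k \<in> G" "x + (- k) \<in> G" using hyp[of k] hyp[of "- k"] k dirs_minus by auto
      moreover have "x \<in> G" using hyp[of 0] r by (simp add: dirs_zero)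
      ultimately show ?thesis using G2f xG2 unfolding face_of_def by blast
    qed
    have W_in: "w0 \<in> M" "w0 \<in> N" "x \<in> M" using w0 MN(1) xF W(2) by auto
    obtain m0 where m0: "m0 \<in> rel_interior M" using rel_interior_cell_nonempty[OF MN(4)] by blast
    obtain m where m: "m \<in> rel_interior M" "n \<bullet> (m - x) > 0"
    proof -
      have "((\<lambda>\<eta>. n \<bullet> (w0 - \<eta> *\<^sub>R (w0 - m0) - x)) \<longlongrightarrow> n \<bullet> (w0 - 0 *\<^sub>R (w0 - m0) - x)) (at_right 0)"
        by (intro tendsto_intros)
      then have "\<forall>\<^sub>F \<eta> in at_right 0. n \<bullet> (w0 - \<eta> *\<^sub>R (w0 - m0) - x) > 0"
        using pos by (auto dest: order_tendstoD(1))
      moreover have "\<forall>\<^sub>F \<eta> in at_right 0. \<eta> < (1::real)" by (rule eventually_at_right_0_less) simp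
      ultimately have "\<forall>\<^sub>F \<eta> in at_right 0. w0 - \<eta> *\<^sub>R (w0 - m0) \<in> rel_interior M
          \<and> n \<bullet> (w0 - \<eta> *\<^sub>R (w0 - m0) - x) > 0"
        using eventually_at_right_0_pos
      proof eventually_elim
        case (elim \<eta>)
        then show ?case using cellsD(6)[OF MN(4)] m0 W_in
          by (auto intro!: rel_interior_convex_shrink)
      qed
      then show ?thesis using that eventually_at_right_0_obtains by blast
    qed
    \<comment> \<open>\<open>\<beta>\<close> is chosen so that subtracting that multiple of
      \<open>w0 - x\<close> brings \<open>m - x\<close> into the hyperplane.\<close>
    define \<beta> where "\<beta> = (n \<bullet> (m - x)) / (n \<bullet> (w0 - x))"
    have \<beta>: "\<beta> > 0" using m(2) pos by (simp add: \<beta>_def)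
    define k where "k = (m - x) - \<beta> *\<^sub>R (w0 - x)"
    have mx: "m - x \<in> dirs S"
      using diff_in_dirs'[of m M x] m(1) rel_interior_subset W_in(3) cellsD(5)[OF MN(4)] by blast
    have kS: "k \<in> dirs S" unfolding k_def by (rule dirs_diff[OF mx dirs_scale[OF w0x]])
    have nk: "n \<bullet> k = 0" using pos by (simp add: k_def \<beta>_def inner_diff_right)
    have "\<forall>\<^sub>F \<delta> in at_right 0. \<delta> < min 1 (1 / (2 * \<beta>))" using \<beta> by (intro eventually_at_right_0_less) simp
    moreover have "\<forall>\<^sub>F \<delta> in at_right 0. norm ((2 * \<delta>) *\<^sub>R k) < r"
    proof -
      have "((\<lambda>\<delta>. norm ((2 * \<delta>) *\<^sub>R k)) \<longlongrightarrow> norm ((2 * 0) *\<^sub>R k)) (at_right 0)"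
        by (intro tendsto_intros)
      then show ?thesis using r by (auto dest: order_tendstoD(2))
    qed
    ultimately have "\<forall>\<^sub>F \<delta> in at_right 0. 0 < \<delta> \<and> \<delta> < 1 \<and> \<delta> < 1 / (2 * \<beta>) \<and> norm ((2 * \<delta>) *\<^sub>R k) < r"
      using eventually_at_right_0_pos by eventually_elim simp
    then obtain \<delta> where \<delta>: "0 < \<delta>" "\<delta> < 1" "\<delta> < 1 / (2 * \<beta>)" "norm ((2 * \<delta>) *\<^sub>R k) < r"
      using eventually_at_right_0_obtains by (metis (no_types, lifting))
    have p1: "x + (2 * \<delta>) *\<^sub>R k \<in> G2"
      using hyp2[of "(2 * \<delta>) *\<^sub>R k"] kS nk \<delta>(4) by (simp add: dirs_scale)
    have w0G2: "w0 \<in> G2" using W_in G2 by blast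
    have "2 * \<delta> * \<beta> < 1" using \<delta>(3) \<beta> by (simp add: field_simps)
    then have p2: "x + (2 * \<delta> * \<beta>) *\<^sub>R (w0 - x) \<in> G2"
      using convexD_alt[OF G2c xG2 w0G2, of "2 * \<delta> * \<beta>"] \<delta>(1) \<beta> by (simp add: algebra_simps)
    \<comment> \<open>A point of \<open>M\<close> near \<open>x\<close> is the midpoint of a point
      of the hyperplane and a point on the way to \<open>w0\<close>, both in \<open>G2\<close>;
      hence the factors 2. So \<open>G2\<close> contains \<open>M\<close> as well as
      \<open>N\<close>, and their wall was not kept.\<close>
    have "x + \<delta> *\<^sub>R (m - x) = (1/2) *\<^sub>R (x + (2 * \<delta>) *\<^sub>R k) + (1/2) *\<^sub>R (x + (2 * \<delta> * \<beta>) *\<^sub>R (w0 - x))"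
    proof -
      have "u *\<^sub>R (x + \<gamma> *\<^sub>R k) + v *\<^sub>R (x + (\<gamma> * \<beta>) *\<^sub>R (w0 - x))
          = (u + v) *\<^sub>R x + (u * \<gamma>) *\<^sub>R k + (v * \<gamma>) *\<^sub>R \<beta> *\<^sub>R (w0 - x)" for u v \<gamma>
        by (simp add: algebra_simps)
      note eq = this[of "1/2" "2 * \<delta>" "1/2"]
      have mk: "m - x = k + \<beta> *\<^sub>R (w0 - x)" by (simp add: k_def)
      show ?thesis unfolding mk scaleR_right_distrib[of \<delta>] using eq by simp
    qed
    then have xm: "x + \<delta> *\<^sub>R (m - x) \<in> G2"
      using convexD[OF G2c p1 p2, of "1/2" "1/2"] by simp
    have "x - \<delta> *\<^sub>R (x - m) \<in> rel_interior M"
      using cellsD(6)[OF MN(4)] m(1) W_in(3) \<delta> by (intro rel_interior_convex_shrink) auto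
    then have "x + \<delta> *\<^sub>R (m - x) \<in> rel_interior M" by (simp add: algebra_simps)
    then have "M \<subseteq> G2" using coarsening_cell[OF C'(2) G2(1) _ cellsD(1)[OF MN(4)] xm] by blast
    then have "{M, N} \<in> edge_set C C'" unfolding edge_set_def using MN(2) G2 by blast
    then show False using MN(3) by simp
  qed
qed

text \<open>Stated for every complex with convex support, so that it applies to \<open>C\<close> and
  also to its local fans, whose supports are planes.\<close>

proposition coarsening_iff_balanced:
  assumes "E \<subseteq> adjacency_edges C"
  shows "(\<exists>C'. polyhedral_complex C' \<and> coarsens C' C \<and> edge_set C C' = E) \<longleftrightarrow>
         (\<forall>F\<in>interior_codim2_faces C. balanced_at C E F)"
proof
  assume "\<exists>C'. polyhedral_complex C' \<and> coarsens C' C \<and> edge_set C C' = E"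
  then show "\<forall>F\<in>interior_codim2_faces C. balanced_at C E F" using coarsening_balanced by blast
next
  assume "\<forall>F\<in>interior_codim2_faces C. balanced_at C E F"
  then interpret balanced_complex C E by unfold_locales (use assms in auto)
  show "\<exists>C'. polyhedral_complex C' \<and> coarsens C' C \<and> edge_set C C' = E" by (rule coarsening_exists)
qed

end

section \<open>Local fans\<close>

locale interior_codim2_face = convex_complex +
  fixes F :: "'a set" and x :: 'a
  assumes F: "F \<in> interior_codim2_faces C" and x: "x \<in> rel_interior F"
begin

abbreviation "P \<equiv> Perp C F"
abbreviation "lcone \<equiv> local_cone C F x"
abbreviation "V \<equiv> polygon_vertices C F"
abbreviation "L \<equiv> local_fan C F x"

lemma F_props: "F \<in> C" "F \<noteq> {}" "aff_dim F = aff_dim S - 2" "x \<in> F" "x \<in> S"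
proof -
  show "F \<in> C" "F \<noteq> {}" "aff_dim F = aff_dim S - 2"
    using F by (auto simp: interior_codim2_faces_def codim_faces_def)
  show "x \<in> F" using x rel_interior_subset by blast
  then show "x \<in> S" using C_subset[OF \<open>F \<in> C\<close>] by blast
qed

lemma x_rel_interior: "x \<in> rel_interior S"
  using rel_interior_interior_face[OF F x] .

section \<open>The normal plane and the cones in it\<close>

lemma Perp_eq: "P = {v \<in> dirs S. \<forall>f\<in>dirs F. orthogonal f v}"
proof -
  have "{p - q | p q. p \<in> affine hull S \<and> q \<in> affine hull S} = dirs S"
  proof
    show "{p - q | p q. p \<in> affine hull S \<and> q \<in> affine hull S} \<subseteq> dirs S"
      using diff_in_dirs by blast
    show "dirs S \<subseteq> {p - q | p q. p \<in> affine hull S \<and> q \<in> affine hull S}"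
    proof
      fix v assume v: "v \<in> dirs S"
      have "x \<in> affine hull S" using F_props by (simp add: hull_inc)
      moreover from this v have "x + v \<in> affine hull S" by (rule add_dirs_affine_hull)
      moreover have "v = (x + v) - x" by simp
      ultimately show "v \<in> {p - q | p q. p \<in> affine hull S \<and> q \<in> affine hull S}" by blast
    qed
  qed
  moreover have "(\<forall>y\<in>affine hull F. \<forall>z\<in>affine hull F. v \<bullet> (y - z) = 0) \<longleftrightarrow> (\<forall>f\<in>dirs F. orthogonal f v)" for v
  proof
    assume *: "\<forall>y\<in>affine hull F. \<forall>z\<in>affine hull F. v \<bullet> (y - z) = 0"
    show "\<forall>f\<in>dirs F. orthogonal f v"
    proof
      fix f assume f: "f \<in> dirs F"
      have xF: "x \<in> affine hull F" using F_props by (simp add: hull_inc)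
      then have "x + f \<in> affine hull F" using f by (rule add_dirs_affine_hull)
      then have "v \<bullet> ((x + f) - x) = 0" using * xF by blast
      then show "orthogonal f v" by (simp add: orthogonal_def inner_commute)
    qed
  next
    assume *: "\<forall>f\<in>dirs F. orthogonal f v"
    show "\<forall>y\<in>affine hull F. \<forall>z\<in>affine hull F. v \<bullet> (y - z) = 0"
    proof (intro ballI)
      fix y z assume "y \<in> affine hull F" "z \<in> affine hull F"
      then have "y - z \<in> dirs F" by (rule diff_in_dirs)
      then have "orthogonal (y - z) v" using * by blast
      then show "v \<bullet> (y - z) = 0" unfolding orthogonal_def by (subst inner_commute)
    qed
  qed
  ultimately show ?thesis unfolding Perp_def by auto
qed

lemma Perp_dirs: "v \<in> P \<Longrightarrow> v \<in> dirs S"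
  and Perp_orthogonal: "v \<in> P \<Longrightarrow> f \<in> dirs F \<Longrightarrow> f \<bullet> v = 0"
  by (simp_all add: Perp_eq orthogonal_def)

lemma subspace_Perp: "subspace P"
  unfolding Perp_eq subspace_def
  by (auto simp: dirs_zero dirs_add dirs_scale orthogonal_clauses)

lemma dirs_C_subset: "A \<in> C \<Longrightarrow> dirs A \<subseteq> dirs S"
  using C_subset dirs_mono by blast

lemma decompose:
  assumes "v \<in> dirs S"
  obtains f q where "f \<in> dirs F" "q \<in> P" "v = f + q"
proof -
  have sp: "span (dirs F) = dirs F" using subspace_dirs by (simp add: span_eq_iff)
  obtain f q where fq: "f \<in> span (dirs F)" "\<And>w. w \<in> span (dirs F) \<Longrightarrow> orthogonal q w" "v = f + q"
    using orthogonal_subspace_decomp_exists[of "dirs F" v] by metis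
  have f: "f \<in> dirs F" using fq sp by simp
  have "q = v - f" using fq(3) by simp
  then have "q \<in> dirs S" using assms f dirs_C_subset[OF F_props(1)] dirs_diff by auto
  then have "q \<in> P" using fq(2) sp by (auto simp: Perp_eq orthogonal_commute)
  then show ?thesis using that f fq(3) by blast
qed

lemma cone_iff: "v \<in> lcone A \<longleftrightarrow> v \<in> P \<and> (\<exists>\<epsilon>>0. x + \<epsilon> *\<^sub>R v \<in> A)"
  by (auto simp: local_cone_def)

text \<open>Convexity turns one admissible step into all smaller ones, so that conditions on several
  vectors can be met with a common step.\<close>

lemma cone_eventually:
  assumes "convex A" "x \<in> A" "v \<in> lcone A"
  shows "\<forall>\<^sub>F \<delta> in at_right 0. x + \<delta> *\<^sub>R v \<in> A"
proof -
  obtain e where e: "e > 0" "x + e *\<^sub>R v \<in> A" using assms(3) by (auto simp: cone_iff)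
  have "x + \<delta> *\<^sub>R v \<in> A" if d: "0 < \<delta>" "\<delta> < e" for \<delta>
  proof -
    have "(1 - \<delta> / e) *\<^sub>R x + (\<delta> / e) *\<^sub>R (x + e *\<^sub>R v) \<in> A"
      using d e by (intro convexD_alt[OF assms(1,2)]) (auto simp: field_simps)
    moreover have "(1 - \<delta> / e) *\<^sub>R x + (\<delta> / e) *\<^sub>R (x + e *\<^sub>R v) = x + \<delta> *\<^sub>R v"
      using e by (simp add: algebra_simps)
    ultimately show ?thesis by simp
  qed
  then show ?thesis using e(1) unfolding eventually_at_right_field by blast
qed

lemma coneI_eventually:
  assumes "v \<in> P" "\<forall>\<^sub>F \<delta> in at_right 0. x + \<delta> *\<^sub>R v \<in> A"
  shows "v \<in> lcone A"
  using assms eventually_at_right_0_obtains[OF assms(2)] by (auto simp: cone_iff)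

lemma zero_in_cone: "x \<in> A \<Longrightarrow> 0 \<in> lcone A"
  using subspace_0[OF subspace_Perp] by (auto simp: cone_iff intro: exI[of _ 1])

lemma cone_Int:
  assumes "convex A" "convex B" "x \<in> A" "x \<in> B"
  shows "lcone (A \<inter> B) = lcone A \<inter> lcone B"
proof
  show "lcone (A \<inter> B) \<subseteq> lcone A \<inter> lcone B" by (auto simp: cone_iff)
  show "lcone A \<inter> lcone B \<subseteq> lcone (A \<inter> B)"
  proof
    fix v assume v: "v \<in> lcone A \<inter> lcone B"
    then have "\<forall>\<^sub>F \<delta> in at_right 0. x + \<delta> *\<^sub>R v \<in> A \<and> x + \<delta> *\<^sub>R v \<in> B"
      using cone_eventually assms by (intro eventually_conj) auto
    then show "v \<in> lcone (A \<inter> B)" using v by (intro coneI_eventually) (auto simp: cone_iff)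
  qed
qed

lemma convex_cone:
  assumes A: "convex A" "x \<in> A"
  shows "convex (lcone A)"
proof (rule convexI)
  fix v w and a b :: real
  assume vw: "v \<in> lcone A" "w \<in> lcone A" and ab: "0 \<le> a" "0 \<le> b" "a + b = 1"
  have "\<forall>\<^sub>F \<delta> in at_right 0. x + \<delta> *\<^sub>R (a *\<^sub>R v + b *\<^sub>R w) \<in> A"
    using cone_eventually[OF A vw(1)] cone_eventually[OF A vw(2)]
  proof eventually_elim
    case (elim \<delta>)
    have "a *\<^sub>R (x + \<delta> *\<^sub>R v) + b *\<^sub>R (x + \<delta> *\<^sub>R w) \<in> A"
      using A(1) elim ab by (intro convexD)
    moreover have "a *\<^sub>R (x + \<delta> *\<^sub>R v) + b *\<^sub>R (x + \<delta> *\<^sub>R w) = (a + b) *\<^sub>R x + \<delta> *\<^sub>R (a *\<^sub>R v + b *\<^sub>R w)"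
      by (simp add: algebra_simps)
    ultimately show ?case using ab by simp
  qed
  moreover have "a *\<^sub>R v + b *\<^sub>R w \<in> P"
    using vw subspace_Perp by (auto simp: cone_iff intro: subspace_add subspace_scale)
  ultimately show "a *\<^sub>R v + b *\<^sub>R w \<in> lcone A" by (intro coneI_eventually)
qed

lemma polyhedron_cone:
  assumes "polyhedron A" "x \<in> A"
  shows "polyhedron (lcone A)"
proof -
  have "lcone A = P \<inter> {v. \<exists>\<epsilon>>0. x + \<epsilon> *\<^sub>R v \<in> A}" by (auto simp: cone_iff)
  then show ?thesis
    using polyhedron_tangent_cone[OF assms] subspace_Perp
    by (simp add: polyhedron_Int affine_imp_polyhedron subspace_imp_affine)
qed

text \<open>A common small step maps a segment of the cone to a segment of \<open>A\<close>, where
  the face condition is available.\<close>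

lemma cone_face_of:
  assumes BA: "B face_of A" and A: "convex A" and xB: "x \<in> B"
  shows "lcone B face_of lcone A"
  unfolding face_of_def
proof (intro conjI ballI impI)
  have sub: "B \<subseteq> A" and B: "convex B" using BA face_of_imp_subset face_of_imp_convex by blast+
  have xA: "x \<in> A" using sub xB by blast
  show "lcone B \<subseteq> lcone A" using sub by (intro subsetI) (metis cone_iff subsetD)
  show "convex (lcone B)" using convex_cone[OF B xB] .
  fix a b v assume ab: "a \<in> lcone A" "b \<in> lcone A" and v: "v \<in> lcone B" "v \<in> open_segment a b"
  have "\<forall>\<^sub>F \<delta> in at_right 0. x + \<delta> *\<^sub>R a \<in> B \<and> x + \<delta> *\<^sub>R b \<in> B"
    using cone_eventually[OF A xA ab(1)] cone_eventually[OF A xA ab(2)] cone_eventually[OF B xB v(1)]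
      eventually_at_right_0_pos
  proof eventually_elim
    case (elim \<delta>)
    obtain u where u: "a \<noteq> b" "0 < u" "u < 1" "v = (1 - u) *\<^sub>R a + u *\<^sub>R b"
      using v(2) by (auto simp: in_segment)
    have "x + \<delta> *\<^sub>R v = (1 - u) *\<^sub>R (x + \<delta> *\<^sub>R a) + u *\<^sub>R (x + \<delta> *\<^sub>R b)"
      unfolding u(4) by (simp add: algebra_simps)
    then have "x + \<delta> *\<^sub>R v \<in> open_segment (x + \<delta> *\<^sub>R a) (x + \<delta> *\<^sub>R b)"
      using u(1-3) elim(4) unfolding in_segment by auto
    then show ?case using BA elim(1-3) unfolding face_of_def by blast
  qed
  then have ev: "\<forall>\<^sub>F \<delta> in at_right 0. x + \<delta> *\<^sub>R a \<in> B" "\<forall>\<^sub>F \<delta> in at_right 0. x + \<delta> *\<^sub>R b \<in> B"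
    by (auto simp: eventually_conj_iff)
  show "a \<in> lcone B" using ab(1) ev(1) by (intro coneI_eventually) (auto simp: cone_iff)
  show "b \<in> lcone B" using ab(2) ev(2) by (intro coneI_eventually) (auto simp: cone_iff)
qed

text \<open>The tangent cone at \<open>x\<close> is invariant under \<open>dirs F\<close>, so the
  orthogonal projection of a vector into \<open>A\<close> still points into \<open>A\<close>. Hence
  the cone is not merely a section of \<open>A\<close> but records all of its directions modulo
  \<open>F\<close>.\<close>

lemma Perp_part_in_cone:
  assumes A: "convex A" "F \<subseteq> A" and w: "w \<in> A" and fq: "f \<in> dirs F" "q \<in> P" "w - x = f + q"
  shows "q \<in> lcone A"
proof (rule coneI_eventually[OF fq(2)])
  have "\<forall>\<^sub>F \<delta> in at_right 0. x + \<delta> *\<^sub>R ((w - x) + (- f)) \<in> A"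
    using convex_move[OF A x dirs_minus[OF fq(1)] w] .
  then show "\<forall>\<^sub>F \<delta> in at_right 0. x + \<delta> *\<^sub>R q \<in> A" by (simp add: fq(3))
qed

lemma dirs_cone:
  assumes A: "A \<in> C" "F \<subseteq> A"
  shows "dirs (lcone A) = {v \<in> dirs A. \<forall>f\<in>dirs F. orthogonal f v}"
proof
  let ?R = "{v \<in> dirs A. \<forall>f\<in>dirs F. orthogonal f v}"
  have xA: "x \<in> A" using A(2) F_props by blast
  have sub: "subspace ?R" unfolding subspace_def
    by (auto simp: dirs_zero dirs_add dirs_scale orthogonal_clauses)
  have "v \<in> ?R" if v: "v \<in> lcone A" for v
  proof -
    obtain e where e: "e > 0" "x + e *\<^sub>R v \<in> A" "v \<in> P" using v by (auto simp: cone_iff)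
    have "(x + e *\<^sub>R v) - x \<in> dirs A" using e(2) xA by (rule diff_in_dirs')
    then have "v \<in> dirs A" using e(1) by (simp add: dirs_scale_iff)
    then show ?thesis using e(3) by (simp add: Perp_eq)
  qed
  then show "dirs (lcone A) \<subseteq> ?R"
    unfolding dirs_def[of "lcone A"] using subspace_diff[OF sub] by (intro span_minimal sub) blast
  show "?R \<subseteq> dirs (lcone A)"
  proof
    fix v assume v: "v \<in> ?R"
    have vP: "v \<in> P" using v dirs_C_subset[OF A(1)] by (auto simp: Perp_eq)
    obtain g where g: "g \<in> rel_interior A"
      using convex_C[OF A(1)] xA by (metis empty_iff equals0I rel_interior_eq_empty)
    have gA: "g \<in> A" using g rel_interior_subset by blast
    have vA: "v \<in> dirs A" using v by blast
    obtain \<eta> where \<eta>: "\<eta> > 0" "g + \<eta> *\<^sub>R v \<in> rel_interior A"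
      using eventually_at_right_0_obtains[OF rel_interior_move_eventually[OF g vA]] .
    have gA': "g + \<eta> *\<^sub>R v \<in> A" using \<eta>(2) rel_interior_subset by blast
    have "g - x \<in> dirs S" using diff_in_dirs'[OF gA xA] dirs_C_subset[OF A(1)] by blast
    \<comment> \<open>Two points of \<open>A\<close> that differ by a multiple of \<open>v\<close>
      project to points of the cone with the same difference, as \<open>v\<close> is orthogonal to
      \<open>F\<close>.\<close>
    then obtain f q where fq: "f \<in> dirs F" "q \<in> P" "g - x = f + q" by (rule decompose)
    have "q \<in> lcone A" using Perp_part_in_cone[OF convex_C[OF A(1)] A(2) gA fq] .
    moreover have "q + \<eta> *\<^sub>R v \<in> lcone A"
    proof (rule Perp_part_in_cone[OF convex_C[OF A(1)] A(2) gA' fq(1)])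
      show "q + \<eta> *\<^sub>R v \<in> P" using fq(2) vP subspace_Perp by (intro subspace_add subspace_scale)
      show "g + \<eta> *\<^sub>R v - x = f + (q + \<eta> *\<^sub>R v)" using fq(3) by (simp add: algebra_simps)
    qed
    ultimately have "(q + \<eta> *\<^sub>R v) - q \<in> dirs (lcone A)" by (intro diff_in_dirs')
    then show "v \<in> dirs (lcone A)" using \<eta>(1) by (simp add: dirs_scale_iff)
  qed
qed

text \<open>The directions of the cone form the orthogonal complement of \<open>dirs F\<close> in
  \<open>dirs A\<close>.\<close>

lemma aff_dim_cone:
  assumes A: "A \<in> C" "F \<subseteq> A"
  shows "aff_dim (lcone A) = aff_dim A - aff_dim F"
proof -
  have xA: "x \<in> A" using A(2) F_props by blast
  have "dim (dirs (lcone A)) + dim (dirs F) = dim (dirs A)"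
    unfolding dirs_cone[OF A]
    using dirs_mono[OF A(2)] by (intro dim_subspace_orthogonal_to_vectors subspace_dirs)
  moreover have "int (dim (dirs (lcone A))) = aff_dim (lcone A)"
    using zero_in_cone[OF xA] by (intro dim_dirs) blast
  moreover have "int (dim (dirs F)) = aff_dim F" using F_props by (intro dim_dirs)
  moreover have "int (dim (dirs A)) = aff_dim A" using xA by (intro dim_dirs) blast
  ultimately show ?thesis by linarith
qed

lemma aff_dim_Perp: "aff_dim P = 2"
proof -
  have "dim P + dim (dirs F) = dim (dirs S)"
    unfolding Perp_eq
    using dirs_C_subset[OF F_props(1)] by (intro dim_subspace_orthogonal_to_vectors subspace_dirs)
  moreover have "aff_dim P = int (dim P)" using subspace_Perp by (rule aff_dim_subspace)
  ultimately show ?thesis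
    using dim_dirs[OF F_props(2)] dim_dirs[OF S_nonempty] F_props(3) by linarith
qed

section \<open>The local fan as a complex\<close>

lemma verticesD:
  assumes "M \<in> V"
  shows "M \<in> cells" "M \<in> C" "F \<subseteq> M" "x \<in> M" "convex M"
  using assms F_props cellsD by (auto simp: polygon_vertices_def)

lemma finite_V: "finite V"
  using finite_C by (rule rev_finite_subset) (auto simp: polygon_vertices_def codim_faces_def)

lemma cell_containing_x:
  assumes "M \<in> cells" "x \<in> M"
  shows "M \<in> V"
  using assms face_contains[OF x assms(2) F_props(1) cellsD(1)[OF assms(1)]]
  by (simp add: polygon_vertices_def)

lemma local_fanI: "M \<in> V \<Longrightarrow> \<tau> face_of lcone M \<Longrightarrow> \<tau> \<in> L"
  by (auto simp: local_fan_def)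

lemma cone_in_L:
  assumes "M \<in> V"
  shows "lcone M \<in> L"
  using assms verticesD convex_cone by (intro local_fanI[OF assms] face_of_refl) auto

text \<open>\<open>x\<close> is a relative interior point of \<open>S\<close>, and cells that come
  close to it contain it; so a small step in any direction of the plane ends in a cell around
  \<open>F\<close>.\<close>

lemma Supp_L: "Supp L = P"
proof
  show "Supp L \<subseteq> P"
    using face_of_imp_subset by (fastforce simp: Supp_def local_fan_def cone_iff)
  show "P \<subseteq> Supp L"
  proof
    fix v assume v: "v \<in> P"
    obtain r where r: "r > 0" "\<And>A y. A \<in> C \<Longrightarrow> y \<in> A \<Longrightarrow> dist x y < r \<Longrightarrow> x \<in> A"
      using local_radius[of x] by metis
    have "((\<lambda>\<delta>. norm (\<delta> *\<^sub>R v)) \<longlongrightarrow> norm (0 *\<^sub>R v)) (at_right 0)"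
      by (intro tendsto_intros)
    then have "\<forall>\<^sub>F \<delta> in at_right 0. norm (\<delta> *\<^sub>R v) < r" using r(1) by (auto dest: order_tendstoD(2))
    moreover have "\<forall>\<^sub>F \<delta> in at_right 0. x + \<delta> *\<^sub>R v \<in> rel_interior S"
      using rel_interior_move_eventually[OF x_rel_interior Perp_dirs[OF v]] .
    ultimately have "\<forall>\<^sub>F \<delta> in at_right 0. norm (\<delta> *\<^sub>R v) < r \<and> x + \<delta> *\<^sub>R v \<in> rel_interior S"
      by (rule eventually_conj)
    then obtain \<delta> where \<delta>: "\<delta> > 0" "norm (\<delta> *\<^sub>R v) < r" "x + \<delta> *\<^sub>R v \<in> rel_interior S"
      using eventually_at_right_0_obtains by (metis (mono_tags, lifting))
    have "x + \<delta> *\<^sub>R v \<in> S" using \<delta>(3) rel_interior_subset by blast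
    then obtain K where K: "K \<in> cells" "x + \<delta> *\<^sub>R v \<in> K" by (rule cell_at)
    have "dist x (x + \<delta> *\<^sub>R v) < r" using \<delta>(2) by (simp add: dist_norm)
    then have "x \<in> K" using r(2)[OF cellsD(1)[OF K(1)] K(2)] by blast
    then have KV: "K \<in> V" using cell_containing_x K by blast
    have "v \<in> lcone K" using v \<delta>(1) K(2) by (auto simp: cone_iff)
    then show "v \<in> Supp L" using cone_in_L[OF KV] by (auto simp: Supp_def)
  qed
qed

lemma cone_Int_V:
  assumes "M \<in> V" "N \<in> V"
  shows "lcone M \<inter> lcone N = lcone (M \<inter> N)" "lcone (M \<inter> N) face_of lcone M"
    "lcone (M \<inter> N) face_of lcone N" "M \<inter> N \<in> C"
proof -
  note M = verticesD[OF assms(1)] and N = verticesD[OF assms(2)]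
  show "lcone M \<inter> lcone N = lcone (M \<inter> N)" using cone_Int M N by simp
  show "lcone (M \<inter> N) face_of lcone M" "lcone (M \<inter> N) face_of lcone N"
    using Int_face_C[OF M(2) N(2)] M N by (auto intro: cone_face_of)
  show "M \<inter> N \<in> C" using face_C[OF M(2) Int_face_C(1)[OF M(2) N(2)]] M(4) N(4) by blast
qed

lemma polyhedral_complex_L: "polyhedral_complex L"
  unfolding polyhedral_complex_def
proof (intro conjI ballI allI impI)
  have poly: "polyhedron (lcone M)" if "M \<in> V" for M
    using polyhedron_cone polyhedron_C verticesD[OF that] by blast
  have "L = (\<Union>M\<in>V. {\<tau>. \<tau> face_of lcone M})" by (auto simp: local_fan_def)
  then show "finite L" using finite_V finite_polyhedron_faces[OF poly] by simp
  obtain K where "K \<in> cells" "x \<in> K" using cell_at[OF F_props(5)] .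
  then have "K \<in> V" by (rule cell_containing_x)
  then have "lcone K \<in> L" "0 \<in> lcone K" using cone_in_L zero_in_cone verticesD by auto
  then show "\<exists>\<tau>\<in>L. \<tau> \<noteq> {}" by blast
  show "polyhedron \<tau>" if "\<tau> \<in> L" for \<tau>
    using that poly face_of_polyhedron_polyhedron by (auto simp: local_fan_def)
  show "\<rho> \<in> L" if "\<tau> \<in> L" "\<rho> face_of \<tau> \<and> \<rho> \<noteq> {}" for \<tau> \<rho>
    using that face_of_trans by (auto simp: local_fan_def)
  fix \<sigma> \<tau> assume "\<sigma> \<in> L" "\<tau> \<in> L"
  then obtain M N where MN: "M \<in> V" "N \<in> V" "\<sigma> face_of lcone M" "\<tau> face_of lcone N"
    by (auto simp: local_fan_def)
  have "\<sigma> \<inter> \<tau> face_of \<sigma> \<and> \<sigma> \<inter> \<tau> face_of \<tau>"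
    using cone_Int_V[OF MN(1,2)] MN(3,4) by (intro face_of_Int_subface) auto
  then show "\<sigma> \<inter> \<tau> face_of \<sigma>" "\<sigma> \<inter> \<tau> face_of \<tau>" by auto
qed

text \<open>This makes \<open>coarsening_iff_balanced\<close> available for the local fan.\<close>

sublocale L: convex_complex L
  by unfold_locales
    (use polyhedral_complex_L in \<open>simp_all add: Supp_L subspace_Perp subspace_imp_convex\<close>)

text \<open>Cones are closed under doubling, so a nonzero \<open>v\<close> lies strictly between
  \<open>0\<close> and \<open>2 *\<^sub>R v\<close>, and a face through \<open>v\<close> contains
  both.\<close>

lemma zero_in_face:
  assumes "\<tau> \<in> L" "\<tau> \<noteq> {}"
  shows "0 \<in> \<tau>"
proof -
  obtain M where M: "M \<in> V" "\<tau> face_of lcone M" using assms(1) by (auto simp: local_fan_def)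
  obtain v where v: "v \<in> \<tau>" using assms(2) by blast
  show ?thesis
  proof (cases "v = 0")
    case False
    have vM: "v \<in> lcone M" using M(2) v face_of_imp_subset by blast
    then obtain e where e: "v \<in> P" "e > 0" "x + e *\<^sub>R v \<in> M" by (auto simp: cone_iff)
    have "2 *\<^sub>R v \<in> lcone M" unfolding cone_iff
      using e subspace_scale[OF subspace_Perp] by (intro conjI exI[of _ "e / 2"]) auto
    moreover have "0 \<in> lcone M" using zero_in_cone verticesD(4)[OF M(1)] .
    moreover have "v \<in> open_segment 0 (2 *\<^sub>R v)"
      unfolding in_segment using False by (intro conjI exI[of _ "1/2"]) auto
    ultimately show ?thesis using M(2) v unfolding face_of_def by blast
  qed (use v in simp)
qed

lemma L_codim_0: "codim_faces L 0 = lcone ` V"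
proof -
  have dim: "aff_dim (lcone M) = 2" if "M \<in> V" for M
    using aff_dim_cone verticesD[OF that] F_props cellsD(3) by simp
  show ?thesis
  proof
    show "codim_faces L 0 \<subseteq> lcone ` V"
    proof
      fix \<tau> assume "\<tau> \<in> codim_faces L 0"
      then have t: "\<tau> \<in> L" "aff_dim \<tau> = 2" by (auto simp: codim_faces_def Supp_L aff_dim_Perp)
      then obtain M where M: "M \<in> V" "\<tau> face_of lcone M" by (auto simp: local_fan_def)
      have "\<tau> = lcone M"
        using face_of_aff_dim_lt[OF _ M(2)] dim[OF M(1)] t(2) convex_cone verticesD[OF M(1)] by force
      then show "\<tau> \<in> lcone ` V" using M by blast
    qed
    show "lcone ` V \<subseteq> codim_faces L 0"
    proof
      fix \<tau> assume "\<tau> \<in> lcone ` V"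
      then obtain M where M: "M \<in> V" "\<tau> = lcone M" by blast
      have "0 \<in> lcone M" using zero_in_cone verticesD(4)[OF M(1)] .
      then show "\<tau> \<in> codim_faces L 0"
        using M dim cone_in_L by (auto simp: codim_faces_def Supp_L aff_dim_Perp)
    qed
  qed
qed

section \<open>Edges and walls of the local fan\<close>

lemma cone_Int_codim_1:
  assumes "M \<in> V" "N \<in> V"
  shows "lcone M \<inter> lcone N \<in> codim_faces L 1 \<longleftrightarrow> M \<inter> N \<in> codim_faces C 1"
proof -
  note c = cone_Int_V[OF assms] and M = verticesD[OF assms(1)] and N = verticesD[OF assms(2)]
  have "lcone (M \<inter> N) \<in> L" using local_fanI[OF assms(1) c(2)] .
  moreover have "0 \<in> lcone (M \<inter> N)" using M(4) N(4) by (intro zero_in_cone) blast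
  moreover have "aff_dim (lcone (M \<inter> N)) = aff_dim (M \<inter> N) - aff_dim F"
    using c(4) M(3) N(3) by (intro aff_dim_cone) auto
  moreover have "M \<inter> N \<noteq> {}" using M N by blast
  ultimately show ?thesis using c(1,4) F_props(3)
    by (auto simp: codim_faces_def Supp_L aff_dim_Perp)
qed

text \<open>Equal cones force \<open>M \<inter> N\<close> to be full-dimensional, as all dimensions
  drop by that of \<open>F\<close>.\<close>

lemma inj_on_cone: "inj_on lcone V"
proof (rule inj_onI)
  fix M N assume MN: "M \<in> V" "N \<in> V" "lcone M = lcone N"
  note c = cone_Int_V[OF MN(1,2)] and M = verticesD[OF MN(1)] and N = verticesD[OF MN(2)]
  have "lcone (M \<inter> N) = lcone M" using c(1) MN(3) by simp
  moreover have "aff_dim (lcone (M \<inter> N)) = aff_dim (M \<inter> N) - aff_dim F"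
    using c(4) M(3) N(3) by (intro aff_dim_cone) auto
  moreover have "aff_dim (lcone M) = aff_dim M - aff_dim F" using aff_dim_cone M by simp
  ultimately have "aff_dim (M \<inter> N) = aff_dim M" by simp
  then have "M \<inter> N = M"
    using face_of_aff_dim_lt[OF M(5) Int_face_C(1)[OF M(2) N(2)]] by force
  then show "M = N" using cell_subset[OF M(1) N(2)] by blast
qed

lemma polygon_edges_iff:
  "{M, N} \<in> polygon_edges C F \<longleftrightarrow> M \<in> V \<and> N \<in> V \<and> M \<inter> N \<in> codim_faces C 1"
  by (auto simp: polygon_edges_def adjacency_edges_iff polygon_vertices_def)

lemma polygon_edgesE:
  assumes "e \<in> polygon_edges C F"
  obtains M N where "e = {M, N}" "M \<in> V" "N \<in> V" "M \<inter> N \<in> codim_faces C 1"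
proof -
  obtain M N where e: "e = {M, N}" using assms by (auto simp: polygon_edges_def adjacency_edges_def)
  then show ?thesis using that assms polygon_edges_iff by blast
qed

lemma adjacency_edges_L: "adjacency_edges L = (`) lcone ` polygon_edges C F"
proof
  show "adjacency_edges L \<subseteq> (`) lcone ` polygon_edges C F"
  proof
    fix e assume e: "e \<in> adjacency_edges L"
    then obtain \<sigma> \<tau> where "e = {\<sigma>, \<tau>}" "\<sigma> \<in> lcone ` V" "\<tau> \<in> lcone ` V" "\<sigma> \<inter> \<tau> \<in> codim_faces L 1"
      unfolding adjacency_edges_def L_codim_0 by blast
    then obtain M N where MN: "e = {lcone M, lcone N}" "M \<in> V" "N \<in> V" "lcone M \<inter> lcone N \<in> codim_faces L 1"
      by blast
    then have "{M, N} \<in> polygon_edges C F" using cone_Int_codim_1 polygon_edges_iff by simp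
    moreover have "e = lcone ` {M, N}" using MN by simp
    ultimately show "e \<in> (`) lcone ` polygon_edges C F" by blast
  qed
  show "(`) lcone ` polygon_edges C F \<subseteq> adjacency_edges L"
  proof
    fix e assume "e \<in> (`) lcone ` polygon_edges C F"
    then obtain e' where "e = lcone ` e'" "e' \<in> polygon_edges C F" by blast
    then obtain M N where MN: "e = lcone ` {M, N}" "M \<in> V" "N \<in> V" "M \<inter> N \<in> codim_faces C 1"
      using polygon_edgesE by metis
    then have "{lcone M, lcone N} \<in> adjacency_edges L"
      using cone_Int_codim_1 by (simp add: adjacency_edges_iff L_codim_0)
    then show "e \<in> adjacency_edges L" using MN by simp
  qed
qed

text \<open>Rests on injectivity on edges: no edge outside \<open>E\<close> may have the same image
  as an edge in \<open>E\<close>.\<close>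

lemma kept_walls_L:
  "kept_walls L ((`) lcone ` (E \<inter> polygon_edges C F)) = lcone ` {W \<in> kept_walls C E. F \<subseteq> W}"
proof -
  have inj: "inj_on ((`) lcone) (polygon_edges C F)"
  proof (rule inj_on_image)
    have "\<Union>(polygon_edges C F) \<subseteq> V" unfolding polygon_edges_def by blast
    then show "inj_on lcone (\<Union>(polygon_edges C F))" by (rule inj_on_subset[OF inj_on_cone])
  qed
  have "adjacency_edges L - (`) lcone ` (E \<inter> polygon_edges C F) = (`) lcone ` (polygon_edges C F - E)"
    unfolding adjacency_edges_L
    using inj_on_image_set_diff[OF inj, of "polygon_edges C F" "E \<inter> polygon_edges C F"]
    by (simp add: Diff_Int Int_commute)
  then have eq: "kept_walls L ((`) lcone ` (E \<inter> polygon_edges C F)) = (\<lambda>e. \<Inter>(lcone ` e)) ` (polygon_edges C F - E)"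
    by (simp add: kept_walls_def image_image)
  have Int: "\<Inter>(lcone ` e) = lcone (\<Inter>e)" if e: "e \<in> polygon_edges C F - E" for e
  proof -
    have "e \<in> polygon_edges C F" using e by blast
    then obtain M N where "e = {M, N}" "M \<in> V" "N \<in> V" by (rule polygon_edgesE)
    then show ?thesis using cone_Int_V(1) by simp
  qed
  have "{W \<in> kept_walls C E. F \<subseteq> W} = Inter ` (polygon_edges C F - E)"
  proof
    show "{W \<in> kept_walls C E. F \<subseteq> W} \<subseteq> Inter ` (polygon_edges C F - E)"
    proof
      fix W assume "W \<in> {W \<in> kept_walls C E. F \<subseteq> W}"
      then obtain e where e: "e \<in> adjacency_edges C" "e \<notin> E" "W = \<Inter>e" "F \<subseteq> W"
        unfolding kept_walls_def by blast
      obtain M N where MN: "e = {M, N}" "M \<in> cells" "N \<in> cells"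
        using e(1) by (auto simp: adjacency_edges_def)
      then have "M \<in> V" "N \<in> V" using e(3,4) by (auto simp: polygon_vertices_def)
      then have "e \<in> polygon_edges C F" using e(1) MN(1) by (simp add: polygon_edges_def)
      then show "W \<in> Inter ` (polygon_edges C F - E)" using e by blast
    qed
    show "Inter ` (polygon_edges C F - E) \<subseteq> {W \<in> kept_walls C E. F \<subseteq> W}"
    proof
      fix W assume "W \<in> Inter ` (polygon_edges C F - E)"
      then obtain e where e: "e \<in> adjacency_edges C" "e \<subseteq> V" "e \<notin> E" "W = \<Inter>e"
        unfolding polygon_edges_def by blast
      then have "W \<in> kept_walls C E" unfolding kept_walls_def by blast
      moreover have "F \<subseteq> W" using e(2) verticesD(3) unfolding e(4) by blast
      ultimately show "W \<in> {W \<in> kept_walls C E. F \<subseteq> W}" by blast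
    qed
  qed
  then have "lcone ` {W \<in> kept_walls C E. F \<subseteq> W} = (\<lambda>e. lcone (\<Inter>e)) ` (polygon_edges C F - E)"
    by (simp add: image_image)
  moreover have "(\<lambda>e. \<Inter>(lcone ` e)) ` (polygon_edges C F - E) = (\<lambda>e. lcone (\<Inter>e)) ` (polygon_edges C F - E)"
    using Int by (rule image_cong[OF refl])
  ultimately show ?thesis unfolding eq by simp
qed

text \<open>A nonempty face of dimension 0 is the origin, which is \<open>lcone F\<close>, and a
  plane has no relative boundary.\<close>

lemma interior_codim2_faces_L: "interior_codim2_faces L = {{0}}"
proof
  show "interior_codim2_faces L \<subseteq> {{0}}"
  proof
    fix \<tau> assume "\<tau> \<in> interior_codim2_faces L"
    then have t: "\<tau> \<in> L" "\<tau> \<noteq> {}" "aff_dim \<tau> = 0"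
      by (auto simp: interior_codim2_faces_def codim_faces_def Supp_L aff_dim_Perp)
    then obtain a where "\<tau> = {a}" by (auto simp: aff_dim_eq_0)
    then show "\<tau> \<in> {{0}}" using zero_in_face[OF t(1,2)] by simp
  qed
  obtain K where "K \<in> cells" "x \<in> K" using cell_at[OF F_props(5)] .
  then have K: "K \<in> V" by (rule cell_containing_x)
  have "F face_of K"
    using Int_face_C(2)[OF F_props(1) verticesD(2)[OF K]] verticesD(3)[OF K] by (simp add: Int_absorb2)
  then have "lcone F face_of lcone K" using cone_face_of verticesD[OF K] F_props by blast
  then have cF: "lcone F \<in> L" using local_fanI K by blast
  have "aff_dim (lcone F) = 0" using aff_dim_cone[OF F_props(1)] by simp
  then obtain a where "lcone F = {a}" by (auto simp: aff_dim_eq_0)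
  then have "lcone F = {0}" using zero_in_cone[OF F_props(4)] by simp
  then have "{0} \<in> codim_faces L 2" using cF by (simp add: codim_faces_def Supp_L aff_dim_Perp)
  moreover have "rel_frontier P = {}"
    using subspace_Perp by (simp add: rel_frontier_def closed_subspace rel_interior_affine subspace_imp_affine)
  ultimately show "{{0}} \<subseteq> interior_codim2_faces L" by (simp add: interior_codim2_faces_def Supp_L)
qed

text \<open>Vectors of the plane do not see the component of \<open>n\<close> along
  \<open>dirs F\<close>, and functionals constant on \<open>F\<close> do not distinguish a vector
  from its projection to the plane. So both sides test the same functionals on the same
  cones.\<close>

lemma balanced_L:
  "balanced_at L ((`) lcone ` (E \<inter> polygon_edges C F)) {0} \<longleftrightarrow> balanced_at C E F"
proof -
  define K where "K = {W \<in> kept_walls C E. F \<subseteq> W}"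
  have K: "W \<in> C" "F \<subseteq> W" "convex W" "x \<in> W" if "W \<in> K" for W
    using that F_props wall_dims kept_wallsE unfolding K_def by (metis (no_types, lifting) mem_Collect_eq subsetD)+
  have xF: "x \<in> F" using F_props by simp
  have balL: "balanced_at L ((`) lcone ` (E \<inter> polygon_edges C F)) {0} \<longleftrightarrow>
      (\<forall>n. (\<forall>W\<in>K. \<forall>v\<in>lcone W. 0 \<le> n \<bullet> v) \<longrightarrow> (\<forall>W\<in>K. \<forall>v\<in>lcone W. n \<bullet> v = 0))"
    unfolding balanced_at_def kept_walls_L K_def[symmetric] using zero_in_cone K(4) by auto
  have balC: "balanced_at C E F \<longleftrightarrow>
      (\<forall>n. (\<forall>y\<in>F. \<forall>z\<in>F. n \<bullet> (y - z) = 0) \<longrightarrow> (\<forall>W\<in>K. \<forall>w\<in>W. \<forall>y\<in>F. 0 \<le> n \<bullet> (w - y)) \<longrightarrow>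
         (\<forall>W\<in>K. \<forall>w\<in>W. \<forall>y\<in>F. n \<bullet> (w - y) = 0))"
  proof -
    have "(\<forall>W\<in>K. Q W) \<longleftrightarrow> (\<forall>W\<in>kept_walls C E. F \<subseteq> W \<longrightarrow> Q W)" for Q
      unfolding K_def by blast
    then show ?thesis unfolding balanced_at_def by (simp only:)
  qed
  have nF: "n \<bullet> f = 0" if "\<forall>y\<in>F. \<forall>z\<in>F. n \<bullet> (y - z) = 0" "f \<in> dirs F" for n f
  proof -
    have "dirs F \<subseteq> {v. n \<bullet> v = 0}"
      unfolding dirs_def using that(1) by (intro span_minimal subspace_hyperplane) auto
    then show ?thesis using that(2) by blast
  qed
  have split: "\<exists>v\<in>lcone W. n \<bullet> (w - y) = n \<bullet> v"
    if n: "\<forall>y\<in>F. \<forall>z\<in>F. n \<bullet> (y - z) = 0" and W: "W \<in> K" and w: "w \<in> W" and y: "y \<in> F" for n W w y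
  proof -
    have "w - x \<in> dirs S" using diff_in_dirs'[OF w K(4)[OF W]] dirs_C_subset K(1)[OF W] by blast
    then obtain f q where fq: "f \<in> dirs F" "q \<in> P" "w - x = f + q" by (rule decompose)
    have "n \<bullet> (w - y) = n \<bullet> (w - x) + n \<bullet> (x - y)" by (simp add: inner_diff_right)
    also have "\<dots> = n \<bullet> q" using nF[OF n fq(1)] n y xF by (simp add: fq(3) inner_add_right)
    finally show ?thesis using Perp_part_in_cone[OF K(3,2)[OF W] w fq] by blast
  qed
  show ?thesis
    unfolding balL balC
  proof (intro iffI allI impI)
    fix n
    assume bal: "\<forall>n. (\<forall>W\<in>K. \<forall>v\<in>lcone W. 0 \<le> n \<bullet> v) \<longrightarrow> (\<forall>W\<in>K. \<forall>v\<in>lcone W. n \<bullet> v = 0)"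
      and n: "\<forall>y\<in>F. \<forall>z\<in>F. n \<bullet> (y - z) = 0" and nonneg: "\<forall>W\<in>K. \<forall>w\<in>W. \<forall>y\<in>F. 0 \<le> n \<bullet> (w - y)"
    have "0 \<le> n \<bullet> v" if W: "W \<in> K" and v: "v \<in> lcone W" for W v
    proof -
      obtain e where e: "e > 0" "x + e *\<^sub>R v \<in> W" using v by (auto simp: cone_iff)
      then have "0 \<le> n \<bullet> ((x + e *\<^sub>R v) - x)" using nonneg W xF by blast
      then show ?thesis using e(1) by (simp add: zero_le_mult_iff)
    qed
    then have "\<forall>W\<in>K. \<forall>v\<in>lcone W. n \<bullet> v = 0" using bal by blast
    then show "\<forall>W\<in>K. \<forall>w\<in>W. \<forall>y\<in>F. n \<bullet> (w - y) = 0" using split[OF n] by metis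
  next
    fix n
    assume bal: "\<forall>n. (\<forall>y\<in>F. \<forall>z\<in>F. n \<bullet> (y - z) = 0) \<longrightarrow> (\<forall>W\<in>K. \<forall>w\<in>W. \<forall>y\<in>F. 0 \<le> n \<bullet> (w - y)) \<longrightarrow>
         (\<forall>W\<in>K. \<forall>w\<in>W. \<forall>y\<in>F. n \<bullet> (w - y) = 0)"
      and nonneg: "\<forall>W\<in>K. \<forall>v\<in>lcone W. 0 \<le> n \<bullet> v"
    have sp: "span (dirs F) = dirs F" using subspace_dirs by (simp add: span_eq_iff)
    \<comment> \<open>\<open>n\<close> may vary along \<open>F\<close>. Its component
      \<open>n2\<close> orthogonal to \<open>dirs F\<close> does not, and it agrees with
      \<open>n\<close> on the cones.\<close>
    obtain n1 n2 where n12: "n1 \<in> span (dirs F)" "\<And>w. w \<in> span (dirs F) \<Longrightarrow> orthogonal n2 w" "n = n1 + n2"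
      using orthogonal_subspace_decomp_exists[of "dirs F" n] by metis
    have n2: "\<forall>y\<in>F. \<forall>z\<in>F. n2 \<bullet> (y - z) = 0"
      using n12(2) diff_in_dirs' sp by (auto simp: orthogonal_def)
    have eq: "n \<bullet> v = n2 \<bullet> v" if "v \<in> lcone W" for v W
      using Perp_orthogonal[of v n1] that n12(1) sp by (simp add: cone_iff n12(3) inner_add_left)
    have "\<forall>W\<in>K. \<forall>w\<in>W. \<forall>y\<in>F. 0 \<le> n2 \<bullet> (w - y)" using split[OF n2] eq nonneg by metis
    then have zero: "\<forall>W\<in>K. \<forall>w\<in>W. \<forall>y\<in>F. n2 \<bullet> (w - y) = 0" using bal n2 by blast
    show "\<forall>W\<in>K. \<forall>v\<in>lcone W. n \<bullet> v = 0"
    proof (intro ballI)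
      fix W v assume W: "W \<in> K" and v: "v \<in> lcone W"
      obtain e where e: "e > 0" "x + e *\<^sub>R v \<in> W" using v by (auto simp: cone_iff)
      then have "n2 \<bullet> ((x + e *\<^sub>R v) - x) = 0" using zero W xF by blast
      then show "n \<bullet> v = 0" using e(1) eq[OF v] by simp
    qed
  qed
qed

text \<open>Every nonempty cone of \<open>L\<close> contains the origin, hence so does a union of
  such cones. This supplies the fan condition for the coarsening that
  \<open>coarsening_iff_balanced\<close> yields.\<close>

lemma coarsening_is_fan:
  assumes "polyhedral_complex D" "coarsens D L"
  shows "polyhedral_fan D"
  unfolding polyhedral_fan_def
proof (intro conjI ballI impI)
  fix G assume G: "G \<in> D" "G \<noteq> {}"
  then obtain D' where D': "D' \<subseteq> L" "G = \<Union>D'" using assms(2) unfolding coarsens_def by blast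
  then obtain \<tau> where "\<tau> \<in> D'" "\<tau> \<noteq> {}" using G(2) by blast
  then show "0 \<in> G" using zero_in_face D' by blast
qed (rule assms(1))

lemma local_polygon_property:
  "(\<exists>D. polyhedral_fan D \<and> coarsens D L \<and> edge_set L D = (`) lcone ` (E \<inter> polygon_edges C F))
    \<longleftrightarrow> balanced_at C E F"
proof -
  have "(\<exists>D. polyhedral_fan D \<and> coarsens D L \<and> edge_set L D = (`) lcone ` (E \<inter> polygon_edges C F))
    \<longleftrightarrow> (\<exists>D. polyhedral_complex D \<and> coarsens D L \<and> edge_set L D = (`) lcone ` (E \<inter> polygon_edges C F))"
    using coarsening_is_fan polyhedral_fan_def by metis
  also have "\<dots> \<longleftrightarrow> balanced_at L ((`) lcone ` (E \<inter> polygon_edges C F)) {0}"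
    using L.coarsening_iff_balanced[of "(`) lcone ` (E \<inter> polygon_edges C F)"]
    by (auto simp: adjacency_edges_L interior_codim2_faces_L)
  also have "\<dots> \<longleftrightarrow> balanced_at C E F" by (rule balanced_L)
  finally show ?thesis .
qed

end

theorem theorem1p1:
  fixes C :: "'a::euclidean_space set set" and E :: "'a set set set"
  assumes "polyhedral_complex C"
    and "convex (Supp C)"
    and "E \<subseteq> adjacency_edges C"
  shows "(\<exists>C'. polyhedral_complex C' \<and> coarsens C' C \<and> edge_set C C' = E)
           \<longleftrightarrow> polygon_property C E"
proof -
  interpret convex_complex C by unfold_locales (use assms in auto)
  have local: "(\<exists>D. polyhedral_fan D \<and> coarsens D (local_fan C F x) \<and>
            edge_set (local_fan C F x) D = (`) (local_cone C F x) ` (E \<inter> polygon_edges C F))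
      \<longleftrightarrow> balanced_at C E F" if "F \<in> interior_codim2_faces C" "x \<in> rel_interior F" for F x
  proof -
    interpret interior_codim2_face C F x by unfold_locales (use that in auto)
    show ?thesis by (rule local_polygon_property)
  qed
  \<comment> \<open>Balancing mentions no base point, while the polygon property quantifies over all
    of them; to deduce the former from the latter, one has to exist.\<close>
  have ex: "\<exists>x. x \<in> rel_interior F" if F: "F \<in> interior_codim2_faces C" for F
  proof -
    have "F \<in> C" "F \<noteq> {}" using F by (auto simp: interior_codim2_faces_def codim_faces_def)
    then show ?thesis using convex_C rel_interior_eq_empty by (metis ex_in_conv)
  qed
  have "polygon_property C E \<longleftrightarrow> (\<forall>F\<in>interior_codim2_faces C. balanced_at C E F)"
    unfolding polygon_property_def using local ex by (metis (no_types, lifting))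
  then show ?thesis using coarsening_iff_balanced[OF assms(3)] by simp
qed

end
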